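(* For any field $k$, there is a functor $Z$ from the category of 3-dimensional vector spaces over $k$ with volume form, with linear operators preserving the volume form as morphisms, to the category of algebras isomorphic to the split octonion algebra over $k$ equipped with a chosen nontrivial idempotent, with algebra isomorphisms preserving the chosen idempotent as morphisms, sending $(V,\omega)$ to the Zorn algebra $Z(V,\omega)$ equipped with the nontrivial idempotent $\pi$. This functor $Z$ is an equivalence of categories.
   Context: An algebra means a finite-dimensional vector space with a bilinear, not necessarily associative, product and a unit. The split octonion algebra over $k$ is the 8-dimensional space of matrices $\begin{pmatrix}\alpha&\mathbf{a}\\ \mathbf{a}'&\alpha'\end{pmatrix}$ with $\alpha,\alpha'\in k$, $\mathbf{a},\mathbf{a}'\in k^3$, with product $$\begin{pmatrix}\alpha&\mathbf{a}\\ \mathbf{a}'&\alpha'\end{pmatrix}\begin{pmatrix}\beta&\mathbf{b}\\ \mathbf{b}'&\beta'\end{pmatrix}=\begin{pmatrix}\alpha\beta+\mathbf{a}\cdot\mathbf{b}'&\alpha\mathbf{b}+\beta'\mathbf{a}-\mathbf{a}'\times\mathbf{b}'\\ \beta\mathbf{a}'+\alpha'\mathbf{b}'+\mathbf{a}\times\mathbf{b}&\mathbf{a}'\cdot\mathbf{b}+\alpha'\beta'\end{pmatrix},$$ with the standard dot and cross products on $k^3$. A volume form on a 3-dimensional vector space $V$ is a nonzero $\omega\in\Lambda^3V^*$; a linear map $f\colon V\to V'$ preserves volume forms if $f^*\omega'=\omega$. Let $\{-,-\}\colon\Lambda^iV^*\times\Lambda^iV\to k$ be the pairing $\{f_1\wedge\cdots\wedge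 f_i,\mathbf{a}_1\wedge\cdots\wedge\mathbf{a}_i\}=\det(f_p(\mathbf{a}_q))$, and let $\star\colon\Lambda^iV\to\Lambda^{3-i}V^*$ be the linear bijection with $\{\star(\mathbf{a}_1\wedge\cdots\wedge\mathbf{a}_i),\mathbf{a}_{i+1}\wedge\cdots\wedge\mathbf{a}_3\}=\omega(\mathbf{a}_1\wedge\mathbf{a}_2\wedge\mathbf{a}_3)$. The regressive product on $\Lambda V$ is $\mu\vee\nu=\star^{-1}(\star\mu\wedge\star\nu)$. The Zorn algebra $Z(V,\omega)$ is $\Lambda V=\Lambda^0V\oplus\Lambda^1V\oplus\Lambda^2V\oplus\Lambda^3V$, whose element $(\alpha,\mathbf{a},\mathbf{a}',\alpha')$ (in these respective summands) is written $\begin{pmatrix}\alpha&\mathbf{a}\\ \mathbf{a}'&\alpha'\end{pmatrix}$, with product $$\begin{pmatrix}\alpha&\mathbf{a}\\ \mathbf{a}'&\alpha'\end{pmatrix}\begin{pmatrix}\beta&\mathbf{b}\\ \mathbf{b}'&\beta'\end{pmatrix}=\begin{pmatrix}\alpha\wedge\beta+\mathbf{a}\vee\mathbf{b}'&\alpha\wedge\mathbf{b}+\beta'\vee\mathbf{a}-\mathbf{a}'\vee\mathbf{b}'\\ \alpha'\vee\mathbf{b}'+\beta\wedge\mathbf{a}'+\mathbf{a}\wedge\mathbf{b}&\alpha'\vee\beta'+\mathbf{a}'\wedge\mathbf{b}\end{pmatrix}.$$ The covolume form $\pi\in\Lambda^3V$ is the unique element with $\{\omega,\pi\}=1$. The unit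 of $Z(V,\omega)$ is $e=1+\pi$, where $1\in\Lambda^0V$. A nontrivial idempotent is an idempotent different from $0$ and from the unit of the algebra. *)

theory Defs
  imports
    "Jordan_Normal_Form.VS_Connect"
    "HOL-Algebra.AbelCoset"
    "HOL-Library.Poly_Mapping"
begin

section \<open>Categories, functors and equivalences\<close>

text \<open>Hom-sets are indexed by source and target and need not be disjoint; accordingly composition
  takes the three objects as arguments: \<open>cmp C X Y Z g f\<close> is \<open>g \<circ> f\<close> for \<open>f : X \<rightarrow> Y\<close>, \<open>g : Y \<rightarrow> Z\<close>.\<close>

record ('o, 'm) cat =
  ob :: "'o set"
  hom_set :: "'o \<Rightarrow> 'o \<Rightarrow> 'm set"
  idn :: "'o \<Rightarrow> 'm"
  cmp :: "'o \<Rightarrow> 'o \<Rightarrow> 'o \<Rightarrow> 'm \<Rightarrow> 'm \<Rightarrow> 'm"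

definition is_category :: "('o, 'm) cat \<Rightarrow> bool" where
  "is_category C \<longleftrightarrow>
     (\<forall>X \<in> ob C. idn C X \<in> hom_set C X X) \<and>
     (\<forall>X \<in> ob C. \<forall>Y \<in> ob C. \<forall>Z \<in> ob C. \<forall>f \<in> hom_set C X Y. \<forall>g \<in> hom_set C Y Z.
        cmp C X Y Z g f \<in> hom_set C X Z) \<and>
     (\<forall>X \<in> ob C. \<forall>Y \<in> ob C. \<forall>f \<in> hom_set C X Y.
        cmp C X X Y f (idn C X) = f \<and> cmp C X Y Y (idn C Y) f = f) \<and>
     (\<forall>W \<in> ob C. \<forall>X \<in> ob C. \<forall>Y \<in> ob C. \<forall>Z \<in> ob C.
        \<forall>f \<in> hom_set C W X. \<forall>g \<in> hom_set C X Y. \<forall>h \<in> hom_set C Y Z.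
        cmp C W Y Z h (cmp C W X Y g f) = cmp C W X Z (cmp C X Y Z h g) f)"

definition is_iso :: "('o, 'm) cat \<Rightarrow> 'o \<Rightarrow> 'o \<Rightarrow> 'm \<Rightarrow> bool" where
  "is_iso C X Y f \<longleftrightarrow> f \<in> hom_set C X Y \<and>
     (\<exists>g \<in> hom_set C Y X. cmp C X Y X g f = idn C X \<and> cmp C Y X Y f g = idn C Y)"

record ('o, 'm, 'p, 'n) fnctr =
  omap :: "'o \<Rightarrow> 'p"
  amap :: "'o \<Rightarrow> 'o \<Rightarrow> 'm \<Rightarrow> 'n"

definition is_functor :: "('o, 'm) cat \<Rightarrow> ('p, 'n) cat \<Rightarrow> ('o, 'm, 'p, 'n) fnctr \<Rightarrow> bool" where
  "is_functor C D F \<longleftrightarrow> is_category C \<and> is_category D \<and>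
     (\<forall>X \<in> ob C. omap F X \<in> ob D) \<and>
     (\<forall>X \<in> ob C. \<forall>Y \<in> ob C. \<forall>f \<in> hom_set C X Y.
        amap F X Y f \<in> hom_set D (omap F X) (omap F Y)) \<and>
     (\<forall>X \<in> ob C. amap F X X (idn C X) = idn D (omap F X)) \<and>
     (\<forall>X \<in> ob C. \<forall>Y \<in> ob C. \<forall>Z \<in> ob C. \<forall>f \<in> hom_set C X Y. \<forall>g \<in> hom_set C Y Z.
        amap F X Z (cmp C X Y Z g f) =
        cmp D (omap F X) (omap F Y) (omap F Z) (amap F Y Z g) (amap F X Y f))"

definition id_functor :: "('o, 'm, 'o, 'm) fnctr" where
  "id_functor = \<lparr>omap = (\<lambda>X. X), amap = (\<lambda>X Y f. f)\<rparr>"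

definition comp_functor ::
  "('p, 'n, 'q, 'l) fnctr \<Rightarrow> ('o, 'm, 'p, 'n) fnctr \<Rightarrow> ('o, 'm, 'q, 'l) fnctr" where
  "comp_functor G F = \<lparr>omap = (\<lambda>X. omap G (omap F X)),
     amap = (\<lambda>X Y f. amap G (omap F X) (omap F Y) (amap F X Y f))\<rparr>"

definition is_natural_iso ::
  "('o, 'm) cat \<Rightarrow> ('p, 'n) cat \<Rightarrow> ('o, 'm, 'p, 'n) fnctr \<Rightarrow> ('o, 'm, 'p, 'n) fnctr
    \<Rightarrow> ('o \<Rightarrow> 'n) \<Rightarrow> bool" where
  "is_natural_iso C D F G \<eta> \<longleftrightarrow>
     (\<forall>X \<in> ob C. is_iso D (omap F X) (omap G X) (\<eta> X)) \<and>
     (\<forall>X \<in> ob C. \<forall>Y \<in> ob C. \<forall>f \<in> hom_set C X Y.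
        cmp D (omap F X) (omap F Y) (omap G Y) (\<eta> Y) (amap F X Y f) =
        cmp D (omap F X) (omap G X) (omap G Y) (amap G X Y f) (\<eta> X))"

definition is_equivalence :: "('o, 'm) cat \<Rightarrow> ('p, 'n) cat \<Rightarrow> ('o, 'm, 'p, 'n) fnctr \<Rightarrow> bool" where
  "is_equivalence C D F \<longleftrightarrow> is_functor C D F \<and>
     (\<exists>G \<eta> \<epsilon>. is_functor D C G \<and>
        is_natural_iso C C id_functor (comp_functor G F) \<eta> \<and>
        is_natural_iso D D (comp_functor F G) id_functor \<epsilon>)"


section \<open>Linear algebra\<close>

text \<open>The ground field is a type \<open>'k\<close> of class \<^class>\<open>field\<close>, seen as the ring \<^term>\<open>class_ring\<close>;
  a vector space is a record satisfying \<open>vectorspace class_ring\<close>.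
  The record type has fields \<open>mult\<close> and \<open>one\<close>, which \<open>vectorspace\<close> ignores; they are only
  meaningful for algebras. Maps are \<^const>\<open>extensional\<close>, so that two maps are equal
  exactly if they agree on their domain.\<close>

definition linear_maps ::
  "('k::field, 'a) module \<Rightarrow> ('k, 'b) module \<Rightarrow> ('a \<Rightarrow> 'b) set" where
  "linear_maps V W = LinearCombinations.module_hom class_ring V W \<inter> extensional (carrier V)"

definition bilinear_maps ::
  "('k::field, 'a) module \<Rightarrow> ('k, 'b) module \<Rightarrow> ('k, 'c) module \<Rightarrow> ('a \<times> 'b \<Rightarrow> 'c) set" where
  "bilinear_maps U V W = {B \<in> extensional (carrier U \<times> carrier V).
     (\<forall>x \<in> carrier U. (\<lambda>y. B (x, y)) \<in> LinearCombinations.module_hom class_ring V W) \<and>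
     (\<forall>y \<in> carrier V. (\<lambda>x. B (x, y)) \<in> LinearCombinations.module_hom class_ring U W)}"

definition ground_space :: "('k::field, 'k) module" where
  "ground_space = \<lparr>carrier = UNIV, mult = (*), one = 1, zero = 0, add = (+), smult = (*)\<rparr>"

definition dual :: "('k::field, 'v) module \<Rightarrow> ('k, 'v \<Rightarrow> 'k) module" where
  "dual V = (ring.func_space class_ring (carrier V)) \<lparr>carrier := linear_maps V ground_space\<rparr>"

definition quotient_space :: "('k::field, 'a) module \<Rightarrow> 'a set \<Rightarrow> ('k, 'a set) module" where
  "quotient_space M N = \<lparr>carrier = a_rcosets\<^bsub>M\<^esub> N, mult = (\<lambda>_ _. N), one = N, zero = N,
     add = set_add M, smult = (\<lambda>c X. \<Union>x\<in>X. N +>\<^bsub>M\<^esub> (c \<odot>\<^bsub>M\<^esub> x))\<rparr>"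


section \<open>Exterior powers\<close>

text \<open>The \<open>i\<close>-th exterior power is the free vector space on \<open>i\<close>-tuples of vectors modulo
  multilinearity and the vanishing of tuples with a repeated entry.\<close>

definition word_space :: "('k::field, 'v) module \<Rightarrow> nat \<Rightarrow> ('k, 'v list \<Rightarrow>\<^sub>0 'k) module" where
  "word_space V i = \<lparr>carrier = {p. \<forall>w \<in> Poly_Mapping.keys p. length w = i \<and> set w \<subseteq> carrier V},
     mult = (\<lambda>_ _. 0), one = 0, zero = 0, add = (+),
     smult = (\<lambda>c. Poly_Mapping.map ((*) c))\<rparr>"

definition word_relations :: "('k::field, 'v) module \<Rightarrow> nat \<Rightarrow> ('v list \<Rightarrow>\<^sub>0 'k) set" where
  "word_relations V i =
     {Poly_Mapping.single (us @ (x \<oplus>\<^bsub>V\<^esub> y) # vs) 1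
        - Poly_Mapping.single (us @ x # vs) 1 - Poly_Mapping.single (us @ y # vs) 1 | us vs x y.
        set us \<subseteq> carrier V \<and> set vs \<subseteq> carrier V \<and> x \<in> carrier V \<and> y \<in> carrier V \<and>
        length us + length vs + 1 = i} \<union>
     {Poly_Mapping.single (us @ (c \<odot>\<^bsub>V\<^esub> x) # vs) 1 - Poly_Mapping.single (us @ x # vs) c | us vs c x.
        set us \<subseteq> carrier V \<and> set vs \<subseteq> carrier V \<and> x \<in> carrier V \<and>
        length us + length vs + 1 = i} \<union>
     {Poly_Mapping.single (us @ x # vs @ x # ws) 1 | us vs ws x.
        set us \<subseteq> carrier V \<and> set vs \<subseteq> carrier V \<and> set ws \<subseteq> carrier V \<and> x \<in> carrier V \<and>
        length us + length vs + length ws + 2 = i}"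

definition word_ideal :: "('k::field, 'v) module \<Rightarrow> nat \<Rightarrow> ('v list \<Rightarrow>\<^sub>0 'k) set" where
  "word_ideal V i = LinearCombinations.module.span class_ring (word_space V i) (word_relations V i)"

type_synonym ('k, 'v) ext = "('v list \<Rightarrow>\<^sub>0 'k) set"

definition Ext :: "('k::field, 'v) module \<Rightarrow> nat \<Rightarrow> ('k, ('k, 'v) ext) module" where
  "Ext V i = quotient_space (word_space V i) (word_ideal V i)"

text \<open>\<open>wedge V [a\<^sub>1, \<dots>, a\<^sub>i]\<close> is \<open>a\<^sub>1 \<and> \<dots> \<and> a\<^sub>i\<close>; in particular \<open>wedge V []\<close> is
  the unit \<open>1\<close> of degree \<open>0\<close>, whose multiples identify the ground field with \<open>Ext V 0\<close>.\<close>

definition wedge :: "('k::field, 'v) module \<Rightarrow> 'v list \<Rightarrow> ('k, 'v) ext" where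
  "wedge V vs =
     word_ideal V (length vs) +>\<^bsub>word_space V (length vs)\<^esub> Poly_Mapping.single vs 1"

definition tuples :: "('k::field, 'v) module \<Rightarrow> nat \<Rightarrow> 'v list set" where
  "tuples V i = {vs. length vs = i \<and> set vs \<subseteq> carrier V}"

text \<open>The following maps are given by their values on decomposable elements, which span.\<close>

definition ext_map ::
  "('k::field, 'v) module \<Rightarrow> ('k, 'w) module \<Rightarrow> nat \<Rightarrow> ('v \<Rightarrow> 'w) \<Rightarrow> ('k, 'v) ext \<Rightarrow> ('k, 'w) ext" where
  "ext_map V W i f = (THE h. h \<in> linear_maps (Ext V i) (Ext W i) \<and>
     (\<forall>vs \<in> tuples V i. h (wedge V vs) = wedge W (map f vs)))"

definition ext_prod ::
  "('k::field, 'v) module \<Rightarrow> nat \<Rightarrow> nat \<Rightarrow> ('k, 'v) ext \<times> ('k, 'v) ext \<Rightarrow> ('k, 'v) ext" where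
  "ext_prod V i j = (THE B. B \<in> bilinear_maps (Ext V i) (Ext V j) (Ext V (i + j)) \<and>
     (\<forall>us \<in> tuples V i. \<forall>vs \<in> tuples V j. B (wedge V us, wedge V vs) = wedge V (us @ vs)))"

definition pairing ::
  "('k::field, 'v) module \<Rightarrow> nat \<Rightarrow> ('k, 'v \<Rightarrow> 'k) ext \<times> ('k, 'v) ext \<Rightarrow> 'k" where
  "pairing V i = (THE B. B \<in> bilinear_maps (Ext (dual V) i) (Ext V i) ground_space \<and>
     (\<forall>fs \<in> tuples (dual V) i. \<forall>vs \<in> tuples V i.
        B (wedge (dual V) fs, wedge V vs) = det (mat i i (\<lambda>(p, q). (fs ! p) (vs ! q)))))"


section \<open>Three-dimensional spaces with volume form\<close>

definition volume_forms :: "('k::field, 'v) module \<Rightarrow> ('k, 'v \<Rightarrow> 'k) ext set" where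
  "volume_forms V = carrier (Ext (dual V) 3) - {\<zero>\<^bsub>Ext (dual V) 3\<^esub>}"

definition dual_map ::
  "('k::field, 'v) module \<Rightarrow> ('k, 'w) module \<Rightarrow> ('v \<Rightarrow> 'w) \<Rightarrow> ('w \<Rightarrow> 'k) \<Rightarrow> 'v \<Rightarrow> 'k" where
  "dual_map V W f = (\<lambda>g \<in> carrier (dual W). \<lambda>v \<in> carrier V. g (f v))"

definition pullback ::
  "('k::field, 'v) module \<Rightarrow> ('k, 'w) module \<Rightarrow> ('v \<Rightarrow> 'w)
    \<Rightarrow> ('k, 'w \<Rightarrow> 'k) ext \<Rightarrow> ('k, 'v \<Rightarrow> 'k) ext" where
  "pullback V W f = ext_map (dual W) (dual V) 3 (dual_map V W f)"

definition star ::
  "('k::field, 'v) module \<Rightarrow> ('k, 'v \<Rightarrow> 'k) ext \<Rightarrow> nat \<Rightarrow> ('k, 'v) ext \<Rightarrow> ('k, 'v \<Rightarrow> 'k) ext" where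
  "star V \<omega> i = (THE s. s \<in> linear_maps (Ext V i) (Ext (dual V) (3 - i)) \<and>
     bij_betw s (carrier (Ext V i)) (carrier (Ext (dual V) (3 - i))) \<and>
     (\<forall>us \<in> tuples V i. \<forall>vs \<in> tuples V (3 - i).
        pairing V (3 - i) (s (wedge V us), wedge V vs) = pairing V 3 (\<omega>, wedge V (us @ vs))))"

text \<open>The regressive product of degrees \<open>i\<close> and \<open>j\<close> lands in degree \<open>i + j - 3\<close>;
  it is used only for \<open>i, j \<le> 3 \<le> i + j\<close>, where the natural number subtractions are exact.\<close>

definition regr_prod ::
  "('k::field, 'v) module \<Rightarrow> ('k, 'v \<Rightarrow> 'k) ext \<Rightarrow> nat \<Rightarrow> nat
    \<Rightarrow> ('k, 'v) ext \<times> ('k, 'v) ext \<Rightarrow> ('k, 'v) ext" where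
  "regr_prod V \<omega> i j = (\<lambda>(\<mu>, \<nu>).
     inv_into (carrier (Ext V (i + j - 3))) (star V \<omega> (i + j - 3))
       (ext_prod (dual V) (3 - i) (3 - j) (star V \<omega> i \<mu>, star V \<omega> j \<nu>)))"

definition covolume ::
  "('k::field, 'v) module \<Rightarrow> ('k, 'v \<Rightarrow> 'k) ext \<Rightarrow> ('k, 'v) ext" where
  "covolume V \<omega> = (THE p. p \<in> carrier (Ext V 3) \<and> pairing V 3 (\<omega>, p) = 1)"


section \<open>Algebras\<close>

definition is_algebra :: "('k::field, 'a) module \<Rightarrow> bool" where
  "is_algebra A \<longleftrightarrow> vectorspace class_ring A \<and> vectorspace.fin_dim class_ring A \<and>
     restrict (\<lambda>(x, y). x \<otimes>\<^bsub>A\<^esub> y) (carrier A \<times> carrier A) \<in> bilinear_maps A A A \<and>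
     \<one>\<^bsub>A\<^esub> \<in> carrier A \<and>
     (\<forall>x \<in> carrier A. \<one>\<^bsub>A\<^esub> \<otimes>\<^bsub>A\<^esub> x = x \<and> x \<otimes>\<^bsub>A\<^esub> \<one>\<^bsub>A\<^esub> = x)"

definition algebra_isos ::
  "('k::field, 'a) module \<Rightarrow> ('k, 'b) module \<Rightarrow> ('a \<Rightarrow> 'b) set" where
  "algebra_isos A B = {h \<in> linear_maps A B. bij_betw h (carrier A) (carrier B) \<and>
     (\<forall>x \<in> carrier A. \<forall>y \<in> carrier A. h (x \<otimes>\<^bsub>A\<^esub> y) = h x \<otimes>\<^bsub>B\<^esub> h y) \<and> h \<one>\<^bsub>A\<^esub> = \<one>\<^bsub>B\<^esub>}"

definition nontrivial_idempotents :: "('k::field, 'a) module \<Rightarrow> 'a set" where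
  "nontrivial_idempotents A =
     {p \<in> carrier A. p \<otimes>\<^bsub>A\<^esub> p = p \<and> p \<noteq> \<zero>\<^bsub>A\<^esub> \<and> p \<noteq> \<one>\<^bsub>A\<^esub>}"


subsection \<open>Split octonions\<close>

type_synonym 'k vec3 = "'k \<times> 'k \<times> 'k"

abbreviation space3 :: "('k::field, 'k vec3) module" where
  "space3 \<equiv> direct_sum ground_space (direct_sum ground_space ground_space)"

fun dot3 :: "'k::field vec3 \<Rightarrow> 'k vec3 \<Rightarrow> 'k" where
  "dot3 (x1, x2, x3) (y1, y2, y3) = x1 * y1 + x2 * y2 + x3 * y3"

fun cross3 :: "'k::field vec3 \<Rightarrow> 'k vec3 \<Rightarrow> 'k vec3" where
  "cross3 (x1, x2, x3) (y1, y2, y3) =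
     (x2 * y3 - x3 * y2, x3 * y1 - x1 * y3, x1 * y2 - x2 * y1)"

text \<open>The tuple \<open>(\<alpha>, a, a', \<alpha>')\<close> stands for the matrix with rows \<open>\<alpha>, a\<close> and \<open>a', \<alpha>'\<close>.\<close>

definition split_octonions :: "('k::field, 'k \<times> 'k vec3 \<times> 'k vec3 \<times> 'k) module" where
  "split_octonions =
     (direct_sum ground_space (direct_sum space3 (direct_sum space3 ground_space)))
     \<lparr>mult := (\<lambda>(\<alpha>, a, a', \<alpha>') (\<beta>, b, b', \<beta>').
        (\<alpha> * \<beta> + dot3 a b',
         (\<alpha> \<odot>\<^bsub>space3\<^esub> b \<oplus>\<^bsub>space3\<^esub> \<beta>' \<odot>\<^bsub>space3\<^esub> a) \<ominus>\<^bsub>space3\<^esub> cross3 a' b',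
         \<beta> \<odot>\<^bsub>space3\<^esub> a' \<oplus>\<^bsub>space3\<^esub> \<alpha>' \<odot>\<^bsub>space3\<^esub> b' \<oplus>\<^bsub>space3\<^esub> cross3 a b,
         dot3 a' b + \<alpha>' * \<beta>')),
      one := (1, \<zero>\<^bsub>space3\<^esub>, \<zero>\<^bsub>space3\<^esub>, 1)\<rparr>"


subsection \<open>Zorn algebras\<close>

type_synonym ('k, 'v) zorn = "('k, 'v) ext \<times> ('k, 'v) ext \<times> ('k, 'v) ext \<times> ('k, 'v) ext"

definition Zorn ::
  "('k::field, 'v) module \<Rightarrow> ('k, 'v \<Rightarrow> 'k) ext \<Rightarrow> ('k, ('k, 'v) zorn) module" where
  "Zorn V \<omega> =
     (direct_sum (Ext V 0) (direct_sum (Ext V 1) (direct_sum (Ext V 2) (Ext V 3))))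
     \<lparr>mult := (\<lambda>(\<alpha>, a, a', \<alpha>') (\<beta>, b, b', \<beta>').
        (ext_prod V 0 0 (\<alpha>, \<beta>) \<oplus>\<^bsub>Ext V 0\<^esub> regr_prod V \<omega> 1 2 (a, b'),
         (ext_prod V 0 1 (\<alpha>, b) \<oplus>\<^bsub>Ext V 1\<^esub> regr_prod V \<omega> 3 1 (\<beta>', a))
           \<ominus>\<^bsub>Ext V 1\<^esub> regr_prod V \<omega> 2 2 (a', b'),
         regr_prod V \<omega> 3 2 (\<alpha>', b') \<oplus>\<^bsub>Ext V 2\<^esub> ext_prod V 0 2 (\<beta>, a')
           \<oplus>\<^bsub>Ext V 2\<^esub> ext_prod V 1 1 (a, b),
         regr_prod V \<omega> 3 3 (\<alpha>', \<beta>') \<oplus>\<^bsub>Ext V 3\<^esub> ext_prod V 2 1 (a', b))),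
      one := (wedge V [], \<zero>\<^bsub>Ext V 1\<^esub>, \<zero>\<^bsub>Ext V 2\<^esub>, covolume V \<omega>)\<rparr>"

definition Zorn_idempotent ::
  "('k::field, 'v) module \<Rightarrow> ('k, 'v \<Rightarrow> 'k) ext \<Rightarrow> ('k, 'v) zorn" where
  "Zorn_idempotent V \<omega> = (\<zero>\<^bsub>Ext V 0\<^esub>, \<zero>\<^bsub>Ext V 1\<^esub>, \<zero>\<^bsub>Ext V 2\<^esub>, covolume V \<omega>)"


section \<open>The two categories and the Zorn functor\<close>

text \<open>The elements of the spaces and algebras are drawn from a type, which serves as the universe
  of the category. The target of the functor is instantiated at the type of elements of
  Zorn algebras over the universe \<open>'v\<close>.\<close>

type_synonym ('k, 'v) vol_space = "('k, 'v) module \<times> ('k, 'v \<Rightarrow> 'k) ext"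

definition vol_cat :: "(('k::field, 'v) vol_space, 'v \<Rightarrow> 'v) cat" where
  "vol_cat = \<lparr>
     ob = {(V, \<omega>). vectorspace class_ring V \<and> vectorspace.fin_dim class_ring V \<and>
                   vectorspace.dim class_ring V = 3 \<and> \<omega> \<in> volume_forms V},
     hom_set = (\<lambda>(V, \<omega>) (V', \<omega>'). {f \<in> linear_maps V V'. pullback V V' f \<omega>' = \<omega>}),
     idn = (\<lambda>(V, \<omega>). \<lambda>v \<in> carrier V. v),
     cmp = (\<lambda>(V, _) _ _ g f. compose (carrier V) g f)\<rparr>"

type_synonym ('k, 'a) pointed_algebra = "('k, 'a) module \<times> 'a"

definition oct_cat :: "(('k::field, 'a) pointed_algebra, 'a \<Rightarrow> 'a) cat" where
  "oct_cat = \<lparr>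
     ob = {(A, p). is_algebra A \<and> algebra_isos A split_octonions \<noteq> {} \<and>
                   p \<in> nontrivial_idempotents A},
     hom_set = (\<lambda>(A, p) (B, q). {h \<in> algebra_isos A B. h p = q}),
     idn = (\<lambda>(A, p). \<lambda>x \<in> carrier A. x),
     cmp = (\<lambda>(A, _) _ _ g f. compose (carrier A) g f)\<rparr>"

type_synonym ('k, 'v) vol_oct_functor =
  "(('k, 'v) vol_space, 'v \<Rightarrow> 'v,
    ('k, ('k, 'v) zorn) pointed_algebra, ('k, 'v) zorn \<Rightarrow> ('k, 'v) zorn) fnctr"

definition Zorn_functor :: "('k::field, 'v) vol_oct_functor" where
  "Zorn_functor = \<lparr>
     omap = (\<lambda>(V, \<omega>). (Zorn V \<omega>, Zorn_idempotent V \<omega>)),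
     amap = (\<lambda>(V, \<omega>) (V', \<omega>') f. restrict
       (\<lambda>(\<alpha>, a, a', \<alpha>').
          (ext_map V V' 0 f \<alpha>, ext_map V V' 1 f a, ext_map V V' 2 f a', ext_map V V' 3 f \<alpha>'))
       (carrier (Zorn V \<omega>)))\<rparr>"

end

theory Submission
  imports Defs
begin

text \<open>
  Everything becomes visible in coordinates. Let \<open>V\<close> be three-dimensional with volume form \<open>\<omega>\<close>, and call
  a basis \<open>e\<^sub>1, e\<^sub>2, e\<^sub>3\<close> unimodular if \<open>\<omega>(e\<^sub>1, e\<^sub>2, e\<^sub>3) = 1\<close>. Such a basis gives the bases \<open>1\<close>; \<open>e\<^sub>i\<close>;
  \<open>e\<^sub>2 \<and> e\<^sub>3, e\<^sub>3 \<and> e\<^sub>1, e\<^sub>1 \<and> e\<^sub>2\<close>; \<open>e\<^sub>1 \<and> e\<^sub>2 \<and> e\<^sub>3\<close> of the four exterior powers of \<open>V\<close>, and the dual basis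
  does the same for the exterior powers of the dual space. In the resulting Pluecker coordinates the exterior
  product is scalar multiplication, cross product or dot product, the pairing of the exterior powers is the dot
  product (Cauchy-Binet, \<open>pairing_eq\<close>), and the star operator is the identity (\<open>pluecker_star\<close>). Hence
  the regressive product has the same coordinates as the exterior product in complementary degrees, and the
  coordinates are an isomorphism from the Zorn algebra to the split octonions that takes the idempotent
  \<open>\<pi> = e\<^sub>1 \<and> e\<^sub>2 \<and> e\<^sub>3\<close> to \<open>p = (0, 0, 0, 1)\<close> (\<open>zorn_coord_iso\<close>, \<open>zorn_coord_idem\<close>).

  A volume-preserving map \<open>f\<close> takes a unimodular basis to a unimodular basis (\<open>matching_coords\<close>). In
  coordinates for these two bases \<open>f\<close> is the identity, and so is the map that it induces on Zorn algebras. The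
  latter is therefore an isomorphism of algebras with idempotent, and one has a functor
  (\<open>is_functor_Zorn\<close>).

  The functor is faithful because \<open>V\<close> is the degree \<open>1\<close> part of its Zorn algebra. It is full because an
  isomorphism \<open>h\<close> that preserves the idempotent preserves the Peirce components, hence acts on the vectors of
  degree \<open>1\<close> by a linear map \<open>f\<close>; since \<open>(e\<^sub>1 e\<^sub>2) e\<^sub>3 = \<pi>\<close> for a basis precisely if it is unimodular, \<open>f\<close>
  preserves the volume form; and \<open>h\<close> is induced by \<open>f\<close> because the degree \<open>1\<close> part, the unit and the
  idempotent generate the algebra (\<open>Zorn_full\<close>). It is essentially surjective because the automorphisms of
  the split octonions act transitively on the nontrivial idempotents. Explicit automorphisms moving a given
  idempotent to \<open>p\<close> are compositions of an exchange of rows and columns with unipotent shears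
  (\<open>octonion_idempotent_normal_form\<close>). The injection of \<open>k\<^sup>3\<close> into the universe enters here: it provides an
  object of the source category.

  The exterior powers are quotients of free vector spaces. They are used only through three properties: the
  wedge product is alternating (\<open>wedge_alternating\<close>), decomposable elements span (\<open>Ext_induct\<close>), and
  alternating functions extend to linear maps (\<open>Ext_universal\<close>).
\<close>

section \<open>Linear maps and quotients\<close>

abbreviation vspace :: "('k::field, 'a) module \<Rightarrow> bool" where
  "vspace V \<equiv> vectorspace class_ring V"

abbreviation homs ::
  "('k::field, 'a) module \<Rightarrow> ('k, 'b) module \<Rightarrow> ('a \<Rightarrow> 'b) set" where
  "homs V W \<equiv> LinearCombinations.module_hom class_ring V W"

text \<open>Scalars are elements of a type, so the laws of a vector space are restated with the operations of
  its type class. Negatives and differences are rewritten to multiples by \<open>-1\<close>, which linear maps and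
  coset computations handle without further rules.\<close>

lemma vspaceI:
  fixes M :: "('k::field, 'a) module"
  assumes "\<zero>\<^bsub>M\<^esub> \<in> carrier M"
    and "\<And>x y. x \<in> carrier M \<Longrightarrow> y \<in> carrier M \<Longrightarrow> x \<oplus>\<^bsub>M\<^esub> y \<in> carrier M"
    and "\<And>c x. x \<in> carrier M \<Longrightarrow> c \<odot>\<^bsub>M\<^esub> x \<in> carrier M"
    and "\<And>x y. x \<in> carrier M \<Longrightarrow> y \<in> carrier M \<Longrightarrow> x \<oplus>\<^bsub>M\<^esub> y = y \<oplus>\<^bsub>M\<^esub> x"
    and "\<And>x y z. x \<in> carrier M \<Longrightarrow> y \<in> carrier M \<Longrightarrow> z \<in> carrier M
           \<Longrightarrow> (x \<oplus>\<^bsub>M\<^esub> y) \<oplus>\<^bsub>M\<^esub> z = x \<oplus>\<^bsub>M\<^esub> (y \<oplus>\<^bsub>M\<^esub> z)"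
    and "\<And>x. x \<in> carrier M \<Longrightarrow> x \<oplus>\<^bsub>M\<^esub> \<zero>\<^bsub>M\<^esub> = x"
    and "\<And>x. x \<in> carrier M \<Longrightarrow> x \<oplus>\<^bsub>M\<^esub> ((-1) \<odot>\<^bsub>M\<^esub> x) = \<zero>\<^bsub>M\<^esub>"
    and "\<And>x. x \<in> carrier M \<Longrightarrow> 1 \<odot>\<^bsub>M\<^esub> x = x"
    and "\<And>a b x. x \<in> carrier M \<Longrightarrow> (a * b) \<odot>\<^bsub>M\<^esub> x = a \<odot>\<^bsub>M\<^esub> (b \<odot>\<^bsub>M\<^esub> x)"
    and "\<And>a b x. x \<in> carrier M \<Longrightarrow> (a + b) \<odot>\<^bsub>M\<^esub> x = a \<odot>\<^bsub>M\<^esub> x \<oplus>\<^bsub>M\<^esub> b \<odot>\<^bsub>M\<^esub> x"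
    and "\<And>a x y. x \<in> carrier M \<Longrightarrow> y \<in> carrier M
           \<Longrightarrow> a \<odot>\<^bsub>M\<^esub> (x \<oplus>\<^bsub>M\<^esub> y) = a \<odot>\<^bsub>M\<^esub> x \<oplus>\<^bsub>M\<^esub> a \<odot>\<^bsub>M\<^esub> y"
  shows "vspace M"
proof -
  have "abelian_group M"
  proof (rule abelian_groupI)
    show "\<And>x. x \<in> carrier M \<Longrightarrow> \<exists>y\<in>carrier M. y \<oplus>\<^bsub>M\<^esub> x = \<zero>\<^bsub>M\<^esub>"
      using assms(3,4,7) by metis
    show "\<And>x. x \<in> carrier M \<Longrightarrow> \<zero>\<^bsub>M\<^esub> \<oplus>\<^bsub>M\<^esub> x = x"
      using assms(1,4,6) by metis
  qed (fact assms)+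
  then have "module class_ring M"
    by (intro moduleI class_cring.is_cring) (simp_all only: ring.simps partial_object.simps monoid.simps assms)
  then show ?thesis
    by (intro vectorspace.intro class_field)
qed

lemma vspace_simps:
  fixes V :: "('k::field, 'a) module"
  assumes "vspace V"
  shows "\<zero>\<^bsub>V\<^esub> \<in> carrier V"
    and "x \<in> carrier V \<Longrightarrow> y \<in> carrier V \<Longrightarrow> x \<oplus>\<^bsub>V\<^esub> y \<in> carrier V"
    and "x \<in> carrier V \<Longrightarrow> c \<odot>\<^bsub>V\<^esub> x \<in> carrier V"
    and "x \<in> carrier V \<Longrightarrow> \<zero>\<^bsub>V\<^esub> \<oplus>\<^bsub>V\<^esub> x = x"
    and "x \<in> carrier V \<Longrightarrow> x \<oplus>\<^bsub>V\<^esub> \<zero>\<^bsub>V\<^esub> = x"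
    and "x \<in> carrier V \<Longrightarrow> 1 \<odot>\<^bsub>V\<^esub> x = x"
    and "x \<in> carrier V \<Longrightarrow> 0 \<odot>\<^bsub>V\<^esub> x = \<zero>\<^bsub>V\<^esub>"
    and "c \<odot>\<^bsub>V\<^esub> \<zero>\<^bsub>V\<^esub> = \<zero>\<^bsub>V\<^esub>"
    and "x \<in> carrier V \<Longrightarrow> \<ominus>\<^bsub>V\<^esub> x = (-1) \<odot>\<^bsub>V\<^esub> x"
    and "x \<in> carrier V \<Longrightarrow> y \<in> carrier V \<Longrightarrow> x \<ominus>\<^bsub>V\<^esub> y = x \<oplus>\<^bsub>V\<^esub> (-1) \<odot>\<^bsub>V\<^esub> y"
    and "x \<in> carrier V \<Longrightarrow> x \<oplus>\<^bsub>V\<^esub> (-1) \<odot>\<^bsub>V\<^esub> x = \<zero>\<^bsub>V\<^esub>"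
proof -
  interpret vectorspace class_ring V by fact
  show neg: "\<ominus>\<^bsub>V\<^esub> x = (-1) \<odot>\<^bsub>V\<^esub> x" if "x \<in> carrier V" for x
    using smult_l_minus[of 1 x] smult_one[of x] that by (simp add: class_ring_simps)
  then show "x \<in> carrier V \<Longrightarrow> y \<in> carrier V \<Longrightarrow> x \<ominus>\<^bsub>V\<^esub> y = x \<oplus>\<^bsub>V\<^esub> (-1) \<odot>\<^bsub>V\<^esub> y"
    by (simp add: a_minus_def)
  show "x \<in> carrier V \<Longrightarrow> x \<oplus>\<^bsub>V\<^esub> (-1) \<odot>\<^bsub>V\<^esub> x = \<zero>\<^bsub>V\<^esub>"
    using neg r_neg[of x] by simp
  show "x \<in> carrier V \<Longrightarrow> 1 \<odot>\<^bsub>V\<^esub> x = x" using smult_one[of x] by simp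
  show "x \<in> carrier V \<Longrightarrow> 0 \<odot>\<^bsub>V\<^esub> x = \<zero>\<^bsub>V\<^esub>" using smult_l_null[of x] by simp
  show "c \<odot>\<^bsub>V\<^esub> \<zero>\<^bsub>V\<^esub> = \<zero>\<^bsub>V\<^esub>" using smult_r_null[of c] by simp
  show "x \<in> carrier V \<Longrightarrow> c \<odot>\<^bsub>V\<^esub> x \<in> carrier V" "\<zero>\<^bsub>V\<^esub> \<in> carrier V"
    "x \<in> carrier V \<Longrightarrow> y \<in> carrier V \<Longrightarrow> x \<oplus>\<^bsub>V\<^esub> y \<in> carrier V"
    "x \<in> carrier V \<Longrightarrow> \<zero>\<^bsub>V\<^esub> \<oplus>\<^bsub>V\<^esub> x = x" "x \<in> carrier V \<Longrightarrow> x \<oplus>\<^bsub>V\<^esub> \<zero>\<^bsub>V\<^esub> = x"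
    by simp_all
qed

lemma vspace_distrib:
  fixes V :: "('k::field, 'a) module"
  assumes "vspace V"
  shows "x \<in> carrier V \<Longrightarrow> (a + b) \<odot>\<^bsub>V\<^esub> x = a \<odot>\<^bsub>V\<^esub> x \<oplus>\<^bsub>V\<^esub> b \<odot>\<^bsub>V\<^esub> x"
    and "x \<in> carrier V \<Longrightarrow> y \<in> carrier V \<Longrightarrow> a \<odot>\<^bsub>V\<^esub> (x \<oplus>\<^bsub>V\<^esub> y) = a \<odot>\<^bsub>V\<^esub> x \<oplus>\<^bsub>V\<^esub> a \<odot>\<^bsub>V\<^esub> y"
    and "x \<in> carrier V \<Longrightarrow> a \<odot>\<^bsub>V\<^esub> (b \<odot>\<^bsub>V\<^esub> x) = (a * b) \<odot>\<^bsub>V\<^esub> x"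
proof -
  interpret vectorspace class_ring V by fact
  show "x \<in> carrier V \<Longrightarrow> (a + b) \<odot>\<^bsub>V\<^esub> x = a \<odot>\<^bsub>V\<^esub> x \<oplus>\<^bsub>V\<^esub> b \<odot>\<^bsub>V\<^esub> x"
    using smult_l_distr[of a b x] by simp
  show "x \<in> carrier V \<Longrightarrow> a \<odot>\<^bsub>V\<^esub> (b \<odot>\<^bsub>V\<^esub> x) = (a * b) \<odot>\<^bsub>V\<^esub> x"
    using smult_assoc1[of a b x] by simp
  show "x \<in> carrier V \<Longrightarrow> y \<in> carrier V \<Longrightarrow> a \<odot>\<^bsub>V\<^esub> (x \<oplus>\<^bsub>V\<^esub> y) = a \<odot>\<^bsub>V\<^esub> x \<oplus>\<^bsub>V\<^esub> a \<odot>\<^bsub>V\<^esub> y"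
    by (simp add: smult_r_distr)
qed

lemma vspace_add_ac:
  fixes V :: "('k::field, 'a) module"
  assumes "vspace V"
  shows "x \<in> carrier V \<Longrightarrow> y \<in> carrier V \<Longrightarrow> z \<in> carrier V
      \<Longrightarrow> (x \<oplus>\<^bsub>V\<^esub> y) \<oplus>\<^bsub>V\<^esub> z = x \<oplus>\<^bsub>V\<^esub> (y \<oplus>\<^bsub>V\<^esub> z)"
    and "x \<in> carrier V \<Longrightarrow> y \<in> carrier V \<Longrightarrow> x \<oplus>\<^bsub>V\<^esub> y = y \<oplus>\<^bsub>V\<^esub> x"
    and "x \<in> carrier V \<Longrightarrow> y \<in> carrier V \<Longrightarrow> z \<in> carrier V
      \<Longrightarrow> x \<oplus>\<^bsub>V\<^esub> (y \<oplus>\<^bsub>V\<^esub> z) = y \<oplus>\<^bsub>V\<^esub> (x \<oplus>\<^bsub>V\<^esub> z)"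
proof -
  interpret vectorspace class_ring V by fact
  show "x \<in> carrier V \<Longrightarrow> y \<in> carrier V \<Longrightarrow> z \<in> carrier V
      \<Longrightarrow> (x \<oplus>\<^bsub>V\<^esub> y) \<oplus>\<^bsub>V\<^esub> z = x \<oplus>\<^bsub>V\<^esub> (y \<oplus>\<^bsub>V\<^esub> z)" by (rule a_assoc)
  show "x \<in> carrier V \<Longrightarrow> y \<in> carrier V \<Longrightarrow> x \<oplus>\<^bsub>V\<^esub> y = y \<oplus>\<^bsub>V\<^esub> x" by (rule a_comm)
  show "x \<in> carrier V \<Longrightarrow> y \<in> carrier V \<Longrightarrow> z \<in> carrier V
      \<Longrightarrow> x \<oplus>\<^bsub>V\<^esub> (y \<oplus>\<^bsub>V\<^esub> z) = y \<oplus>\<^bsub>V\<^esub> (x \<oplus>\<^bsub>V\<^esub> z)" by (rule a_lcomm)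
qed

lemma homsI:
  assumes "\<And>x. x \<in> carrier V \<Longrightarrow> f x \<in> carrier W"
    and "\<And>x y. x \<in> carrier V \<Longrightarrow> y \<in> carrier V \<Longrightarrow> f (x \<oplus>\<^bsub>V\<^esub> y) = f x \<oplus>\<^bsub>W\<^esub> f y"
    and "\<And>c x. x \<in> carrier V \<Longrightarrow> f (c \<odot>\<^bsub>V\<^esub> x) = c \<odot>\<^bsub>W\<^esub> f x"
  shows "f \<in> homs V W"
  using assms by (auto simp: LinearCombinations.module_hom_def)

lemma homsD:
  assumes "f \<in> homs V W"
  shows "x \<in> carrier V \<Longrightarrow> f x \<in> carrier W"
    and "x \<in> carrier V \<Longrightarrow> y \<in> carrier V \<Longrightarrow> f (x \<oplus>\<^bsub>V\<^esub> y) = f x \<oplus>\<^bsub>W\<^esub> f y"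
    and "x \<in> carrier V \<Longrightarrow> f (c \<odot>\<^bsub>V\<^esub> x) = c \<odot>\<^bsub>W\<^esub> f x"
  using assms by (auto simp: LinearCombinations.module_hom_def)

lemma homs_zero:
  assumes "f \<in> homs V W" "vspace V" "vspace W"
  shows "f \<zero>\<^bsub>V\<^esub> = \<zero>\<^bsub>W\<^esub>"
proof -
  interpret V: vectorspace class_ring V by fact
  interpret W: vectorspace class_ring W by fact
  have "mod_hom class_ring V W f"
    using assms(1) by unfold_locales
  then show ?thesis by (rule mod_hom.f0_is_0)
qed

lemma homs_minus:
  assumes "f \<in> homs V W" "vspace V" "vspace W" "x \<in> carrier V" "y \<in> carrier V"
  shows "f (x \<ominus>\<^bsub>V\<^esub> y) = f x \<ominus>\<^bsub>W\<^esub> f y"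
proof -
  interpret V: vectorspace class_ring V by fact
  interpret W: vectorspace class_ring W by fact
  have "mod_hom class_ring V W f"
    using assms(1) by unfold_locales
  then show ?thesis using assms(4,5) by (rule mod_hom.f_minus)
qed

lemma homs_inv_into:
  assumes f: "f \<in> homs V W" and bij: "bij_betw f (carrier V) (carrier W)" and V: "vspace V"
  shows "inv_into (carrier V) f \<in> homs W V"
proof -
  interpret V: vectorspace class_ring V by fact
  let ?g = "inv_into (carrier V) f"
  have g: "?g y \<in> carrier V" "f (?g y) = y" if "y \<in> carrier W" for y
    using that bij by (metis bij_betw_imp_surj_on inv_into_into, metis bij_betw_imp_surj_on f_inv_into_f)
  have eq: "?g y = x" if "x \<in> carrier V" "f x = y" for x y
    using that bij by (metis bij_betw_imp_inj_on inv_into_f_f)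
  show ?thesis
  proof (rule homsI)
    fix x y assume "x \<in> carrier W" "y \<in> carrier W"
    then show "?g (x \<oplus>\<^bsub>W\<^esub> y) = ?g x \<oplus>\<^bsub>V\<^esub> ?g y"
      by (intro eq) (simp_all add: g homsD[OF f])
  next
    fix c x assume "x \<in> carrier W"
    then show "?g (c \<odot>\<^bsub>W\<^esub> x) = c \<odot>\<^bsub>V\<^esub> ?g x"
      by (intro eq) (simp_all add: g homsD[OF f])
  qed (rule g)
qed

lemma homs_comp:
  assumes "f \<in> homs U V" "g \<in> homs V W"
  shows "(\<lambda>x. g (f x)) \<in> homs U W"
  using assms by (intro homsI) (simp_all add: homsD)

lemma homs_cong:
  assumes "f \<in> homs V W" "vspace V" "\<And>x. x \<in> carrier V \<Longrightarrow> f x = g x"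
  shows "g \<in> homs V W"
proof -
  interpret V: vectorspace class_ring V by fact
  show ?thesis
    by (intro homsI) (simp_all add: assms(3)[symmetric] homsD[OF assms(1)])
qed

lemma linear_maps_restrict:
  assumes "f \<in> homs V W" "vspace V"
  shows "restrict f (carrier V) \<in> linear_maps V W"
  unfolding linear_maps_def by (intro IntI homs_cong[OF assms]) auto

lemma linear_maps_homs: "f \<in> linear_maps V W \<Longrightarrow> f \<in> homs V W"
  by (simp add: linear_maps_def)

lemma linear_maps_eqI:
  assumes "f \<in> linear_maps V W" "g \<in> linear_maps V W" "\<And>x. x \<in> carrier V \<Longrightarrow> f x = g x"
  shows "f = g"
  using assms by (auto simp: linear_maps_def intro: extensionalityI)

lemma linear_maps_id: "vspace V \<Longrightarrow> (\<lambda>x \<in> carrier V. x) \<in> linear_maps V V"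
  by (rule linear_maps_restrict) (auto intro: homsI)

lemma linear_maps_compose:
  assumes "f \<in> linear_maps U V" "g \<in> linear_maps V W" "vspace U"
  shows "compose (carrier U) g f \<in> linear_maps U W"
  unfolding compose_def
  by (rule linear_maps_restrict[OF homs_comp[OF assms(1,2)[THEN linear_maps_homs]] assms(3)])

text \<open>The vanishing of a linear map on a set passes to its span because its kernel is a subspace.\<close>

lemma homs_vanish_on_span:
  assumes f: "f \<in> homs V W" and "vspace V" "vspace W" and S: "S \<subseteq> carrier V"
    and 0: "\<And>x. x \<in> S \<Longrightarrow> f x = \<zero>\<^bsub>W\<^esub>"
    and x: "x \<in> LinearCombinations.module.span class_ring V S"
  shows "f x = \<zero>\<^bsub>W\<^esub>"
proof -
  interpret V: vectorspace class_ring V by fact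
  interpret W: vectorspace class_ring W by fact
  interpret f: mod_hom class_ring V W f
    using f by unfold_locales
  have "V.span S \<subseteq> f.ker"
    by (rule V.span_is_subset[OF _ f.ker_is_submodule]) (use S 0 in \<open>auto simp: f.ker_def\<close>)
  then show ?thesis using x by (auto simp: f.ker_def)
qed

context
  fixes M :: "('k::field, 'a) module" and N
  assumes M: "vspace M" and N: "LinearCombinations.submodule class_ring N M"
begin

interpretation M: vectorspace class_ring M by (fact M)

lemma quotient_abelian_subgroup: "abelian_subgroup N M"
proof (rule abelian_subgroupI3[OF additive_subgroup.intro])
  show "subgroup N (add_monoid M)"
  proof (rule subgroup.intro)
    fix x assume x: "x \<in> N"
    then have "x \<in> carrier M" "(-1) \<odot>\<^bsub>M\<^esub> x \<in> N"
      using N by (auto simp: LinearCombinations.submodule_def)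
    then show "inv\<^bsub>add_monoid M\<^esub> x \<in> N"
      by (simp add: a_inv_def[symmetric] vspace_simps[OF M])
  qed (use N in \<open>auto simp: LinearCombinations.submodule_def\<close>)
qed (rule M.abelian_group_axioms)

interpretation N: abelian_subgroup N M by (rule quotient_abelian_subgroup)

lemma coset_self: "x \<in> carrier M \<Longrightarrow> x \<in> N +>\<^bsub>M\<^esub> x"
  by (rule N.a_rcos_self)

lemma quotient_coset_eq:
  assumes "x \<in> carrier M" "y \<in> carrier M"
  shows "N +>\<^bsub>M\<^esub> x = N +>\<^bsub>M\<^esub> y \<longleftrightarrow> x \<ominus>\<^bsub>M\<^esub> y \<in> N"
  using assms N.a_rcos_module[of y x] N.a_repr_independence'[of x y] coset_self[of x]
  by (auto simp: a_minus_def)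

lemma quotient_carrier:
  "carrier (quotient_space M N) = (\<lambda>x. N +>\<^bsub>M\<^esub> x) ` carrier M"
  by (auto simp: quotient_space_def A_RCOSETS_def')

lemma quotient_zero: "\<zero>\<^bsub>quotient_space M N\<^esub> = N +>\<^bsub>M\<^esub> \<zero>\<^bsub>M\<^esub>"
  using N.a_subset by (simp add: quotient_space_def)

lemma quotient_add:
  "x \<in> carrier M \<Longrightarrow> y \<in> carrier M \<Longrightarrow>
    (N +>\<^bsub>M\<^esub> x) \<oplus>\<^bsub>quotient_space M N\<^esub> (N +>\<^bsub>M\<^esub> y) = N +>\<^bsub>M\<^esub> (x \<oplus>\<^bsub>M\<^esub> y)"
  by (simp add: quotient_space_def N.a_rcos_sum)

lemma quotient_smult:
  assumes x: "x \<in> carrier M"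
  shows "c \<odot>\<^bsub>quotient_space M N\<^esub> (N +>\<^bsub>M\<^esub> x) = N +>\<^bsub>M\<^esub> (c \<odot>\<^bsub>M\<^esub> x)"
proof -
  have "N +>\<^bsub>M\<^esub> (c \<odot>\<^bsub>M\<^esub> y) = N +>\<^bsub>M\<^esub> (c \<odot>\<^bsub>M\<^esub> x)" if y: "y \<in> N +>\<^bsub>M\<^esub> x" for y
  proof -
    have yc: "y \<in> carrier M" using x y by (rule N.a_elemrcos_carrier)
    have "y \<ominus>\<^bsub>M\<^esub> x \<in> N" using N.a_rcos_module_imp[OF x y] by (simp add: a_minus_def)
    then have "c \<odot>\<^bsub>M\<^esub> (y \<ominus>\<^bsub>M\<^esub> x) \<in> N"
      using N by (auto simp: LinearCombinations.submodule_def)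
    then have "c \<odot>\<^bsub>M\<^esub> y \<ominus>\<^bsub>M\<^esub> c \<odot>\<^bsub>M\<^esub> x \<in> N"
      using x yc by (simp add: a_minus_def M.smult_r_distr M.smult_r_minus)
    then show ?thesis using x yc by (subst quotient_coset_eq) auto
  qed
  then have "(\<Union>y\<in>N +>\<^bsub>M\<^esub> x. N +>\<^bsub>M\<^esub> (c \<odot>\<^bsub>M\<^esub> y)) = (\<Union>y\<in>N +>\<^bsub>M\<^esub> x. N +>\<^bsub>M\<^esub> (c \<odot>\<^bsub>M\<^esub> x))"
    by (rule SUP_cong[OF refl])
  also have "\<dots> = N +>\<^bsub>M\<^esub> (c \<odot>\<^bsub>M\<^esub> x)"
    using coset_self[OF x] by blast
  finally show ?thesis by (simp add: quotient_space_def)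
qed

lemma vs_quotient: "vspace (quotient_space M N)"
proof (rule vspaceI, unfold quotient_carrier)
  show "\<zero>\<^bsub>quotient_space M N\<^esub> \<in> (\<lambda>x. N +>\<^bsub>M\<^esub> x) ` carrier M"
    by (simp only: quotient_zero vspace_simps(1)[OF M] imageI)
qed (elim imageE; simp add: quotient_add quotient_smult quotient_zero
    vspace_simps(1-8,11)[OF M] vspace_distrib[OF M] vspace_add_ac[OF M])+

text \<open>The induced map takes a coset to the value at a chosen representative. The choice does not matter
  because two representatives differ by an element of the subspace.\<close>

lemma quotient_factor:
  assumes W: "vspace W" and f: "f \<in> homs M W" and 0: "\<And>x. x \<in> N \<Longrightarrow> f x = \<zero>\<^bsub>W\<^esub>"
  obtains h where "h \<in> linear_maps (quotient_space M N) W"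
    "\<And>x. x \<in> carrier M \<Longrightarrow> h (N +>\<^bsub>M\<^esub> x) = f x"
proof -
  interpret W: vectorspace class_ring W by fact
  \<comment> \<open>This makes the choice of representatives below irrelevant.\<close>
  have eq: "f x = f y" if "x \<in> carrier M" "y \<in> carrier M" "N +>\<^bsub>M\<^esub> x = N +>\<^bsub>M\<^esub> y" for x y
  proof -
    have "f (x \<ominus>\<^bsub>M\<^esub> y) = \<zero>\<^bsub>W\<^esub>"
      using that by (intro 0) (simp add: quotient_coset_eq)
    then show ?thesis using that by (simp add: homs_minus[OF f M W] homsD[OF f])
  qed
  define g where "g X = f (SOME x. x \<in> carrier M \<and> X = N +>\<^bsub>M\<^esub> x)" for X
  have g: "g (N +>\<^bsub>M\<^esub> x) = f x" if "x \<in> carrier M" for x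
    unfolding g_def by (rule someI2[of _ x]) (use that in \<open>auto intro: eq\<close>)
  have "g \<in> homs (quotient_space M N) W"
    by (rule homsI) (auto simp: quotient_carrier quotient_add quotient_smult g homsD[OF f])
  then show thesis
    using that[of "restrict g (carrier (quotient_space M N))"] linear_maps_restrict[OF _ vs_quotient] g
    by (auto simp: quotient_carrier)
qed

end

lemma homs_add_fun:
  assumes "f \<in> homs V W" "g \<in> homs V W" and W: "vspace W"
  shows "(\<lambda>x. f x \<oplus>\<^bsub>W\<^esub> g x) \<in> homs V W"
  using assms(1,2)
  by (intro homsI) (simp_all add: homsD vspace_simps(1-3)[OF W] vspace_distrib[OF W] vspace_add_ac[OF W])

lemma homs_smult_fun:
  assumes "f \<in> homs V W" and W: "vspace W"
  shows "(\<lambda>x. c \<odot>\<^bsub>W\<^esub> f x) \<in> homs V W"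
  using assms(1)
  by (intro homsI) (simp_all add: homsD vspace_simps(1-3)[OF W] vspace_distrib[OF W] mult.commute)

lemma homs_zero_fun:
  assumes W: "vspace W"
  shows "(\<lambda>x. \<zero>\<^bsub>W\<^esub>) \<in> homs V W"
  by (intro homsI) (simp_all add: vspace_simps(1-8)[OF W])

section \<open>Exterior powers\<close>

lemma lookup_map_times [simp]:
  "Poly_Mapping.lookup (Poly_Mapping.map ((*) (c::'k::field)) p) w = c * Poly_Mapping.lookup p w"
  by (simp add: Poly_Mapping.map.rep_eq when_def)

lemma word_carrier_iff:
  "p \<in> carrier (word_space V i) \<longleftrightarrow> (\<forall>w. Poly_Mapping.lookup p w \<noteq> 0 \<longrightarrow> w \<in> tuples V i)"
  by (auto simp: word_space_def tuples_def in_keys_iff)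

lemma word_carrier_closed:
  fixes p q :: "'v list \<Rightarrow>\<^sub>0 'k::field"
  shows "(0 :: 'v list \<Rightarrow>\<^sub>0 'k) \<in> carrier (word_space V i)"
    and "w \<in> tuples V i \<Longrightarrow> Poly_Mapping.single w c \<in> carrier (word_space V i)"
    and "p \<in> carrier (word_space V i) \<Longrightarrow> q \<in> carrier (word_space V i)
      \<Longrightarrow> p + q \<in> carrier (word_space V i)"
    and "p \<in> carrier (word_space V i) \<Longrightarrow> q \<in> carrier (word_space V i)
      \<Longrightarrow> p - q \<in> carrier (word_space V i)"
    and "p \<in> carrier (word_space V i) \<Longrightarrow> Poly_Mapping.map ((*) c) p \<in> carrier (word_space V i)"
proof -
  show "p + q \<in> carrier (word_space V i)"
    if "p \<in> carrier (word_space V i)" "q \<in> carrier (word_space V i)"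
    unfolding word_carrier_iff
  proof (intro allI impI)
    fix w assume "Poly_Mapping.lookup (p + q) w \<noteq> 0"
    then have "Poly_Mapping.lookup p w \<noteq> 0 \<or> Poly_Mapping.lookup q w \<noteq> 0" by (auto simp: lookup_add)
    then show "w \<in> tuples V i" using that by (auto simp: word_carrier_iff)
  qed
  show "p - q \<in> carrier (word_space V i)"
    if "p \<in> carrier (word_space V i)" "q \<in> carrier (word_space V i)"
    unfolding word_carrier_iff
  proof (intro allI impI)
    fix w assume "Poly_Mapping.lookup (p - q) w \<noteq> 0"
    then have "Poly_Mapping.lookup p w \<noteq> 0 \<or> Poly_Mapping.lookup q w \<noteq> 0" by (auto simp: lookup_minus)
    then show "w \<in> tuples V i" using that by (auto simp: word_carrier_iff)
  qed
qed (auto simp: word_carrier_iff lookup_single when_def)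

lemma word_ops:
  "\<zero>\<^bsub>word_space V i\<^esub> = 0"
  "p \<oplus>\<^bsub>word_space V i\<^esub> q = p + q"
  "c \<odot>\<^bsub>word_space V i\<^esub> p = Poly_Mapping.map ((*) c) p"
  by (simp_all add: word_space_def)

lemma vspace_word_space: "vspace (word_space V i)"
  by (rule vspaceI) (simp_all add: word_ops word_carrier_closed,
      (rule poly_mapping_eqI, simp add: lookup_add algebra_simps)+)

lemma word_minus:
  assumes "p \<in> carrier (word_space V i)" "q \<in> carrier (word_space V i)"
  shows "p \<ominus>\<^bsub>word_space V i\<^esub> q = p - q"
  using assms unfolding vspace_simps(10)[OF vspace_word_space assms]
  by (simp add: word_ops) (rule poly_mapping_eqI, simp add: lookup_add lookup_minus)

lemma word_relations_carrier:
  assumes "vspace V"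
  shows "word_relations V i \<subseteq> carrier (word_space V i)"
  unfolding word_relations_def
  by (auto intro!: word_carrier_closed simp: tuples_def vspace_simps[OF assms])

lemma word_ideal_submodule:
  assumes "vspace V"
  shows "LinearCombinations.submodule class_ring (word_ideal V i) (word_space V i)"
proof -
  interpret word: vectorspace class_ring "word_space V i" by (rule vspace_word_space)
  show ?thesis
    unfolding word_ideal_def by (rule word.span_is_submodule[OF word_relations_carrier[OF assms]])
qed

lemma vspace_Ext: "vspace V \<Longrightarrow> vspace (Ext V i)"
  unfolding Ext_def by (intro vs_quotient vspace_word_space word_ideal_submodule)

text \<open>The linear extension of a function on words to the free vector space on them.\<close>

definition word_eval ::
  "('k::field, 'w) module \<Rightarrow> ('v list \<Rightarrow> 'w) \<Rightarrow> ('v list \<Rightarrow>\<^sub>0 'k) \<Rightarrow> 'w" where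
  "word_eval W \<phi> p = (\<Oplus>\<^bsub>W\<^esub>w\<in>Poly_Mapping.keys p. Poly_Mapping.lookup p w \<odot>\<^bsub>W\<^esub> \<phi> w)"

lemma word_eval_superset:
  assumes W: "vspace W" and "finite S" "Poly_Mapping.keys p \<subseteq> S" and \<phi>: "\<And>w. w \<in> S \<Longrightarrow> \<phi> w \<in> carrier W"
  shows "word_eval W \<phi> p = (\<Oplus>\<^bsub>W\<^esub>w\<in>S. Poly_Mapping.lookup p w \<odot>\<^bsub>W\<^esub> \<phi> w)"
proof -
  interpret W: vectorspace class_ring W by fact
  show ?thesis
    unfolding word_eval_def using assms(2-4)
    by (intro W.add.finprod_mono_neutral_cong_left) (auto simp: in_keys_iff vspace_simps(3,7)[OF W])
qed

lemma word_eval_homs: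
  assumes W: "vspace W" and \<phi>: "\<And>w. w \<in> tuples V i \<Longrightarrow> \<phi> w \<in> carrier W"
  shows "word_eval W \<phi> \<in> homs (word_space V i) W"
proof (rule homsI)
  interpret W: vectorspace class_ring W by fact
  have keys: "\<phi> w \<in> carrier W" if "p \<in> carrier (word_space V i)" "w \<in> Poly_Mapping.keys p" for p w
    using that by (intro \<phi>) (auto simp: word_carrier_iff in_keys_iff)
  show "word_eval W \<phi> p \<in> carrier W" if "p \<in> carrier (word_space V i)" for p
    unfolding word_eval_def using keys[OF that] by (intro W.finsum_closed) (auto simp: vspace_simps(3)[OF W])
  show "word_eval W \<phi> (p \<oplus>\<^bsub>word_space V i\<^esub> q) = word_eval W \<phi> p \<oplus>\<^bsub>W\<^esub> word_eval W \<phi> q"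
    if "p \<in> carrier (word_space V i)" "q \<in> carrier (word_space V i)" for p q
  proof -
    let ?S = "Poly_Mapping.keys p \<union> Poly_Mapping.keys q"
    have S: "finite ?S" "\<And>w. w \<in> ?S \<Longrightarrow> \<phi> w \<in> carrier W" using keys that by auto
    have sub: "Poly_Mapping.keys (p + q) \<subseteq> ?S" "Poly_Mapping.keys p \<subseteq> ?S" "Poly_Mapping.keys q \<subseteq> ?S"
      using keys_add[of p q] by auto
    note eval = sub[THEN word_eval_superset[OF W S(1) _ S(2)]]
    have "(\<Oplus>\<^bsub>W\<^esub>w\<in>?S. Poly_Mapping.lookup (p + q) w \<odot>\<^bsub>W\<^esub> \<phi> w) =
      (\<Oplus>\<^bsub>W\<^esub>w\<in>?S. Poly_Mapping.lookup p w \<odot>\<^bsub>W\<^esub> \<phi> w \<oplus>\<^bsub>W\<^esub> Poly_Mapping.lookup q w \<odot>\<^bsub>W\<^esub> \<phi> w)"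
      using S(2) by (intro W.finsum_cong') (auto simp: lookup_add vspace_simps(2,3)[OF W] vspace_distrib[OF W])
    also have "\<dots> = (\<Oplus>\<^bsub>W\<^esub>w\<in>?S. Poly_Mapping.lookup p w \<odot>\<^bsub>W\<^esub> \<phi> w) \<oplus>\<^bsub>W\<^esub>
      (\<Oplus>\<^bsub>W\<^esub>w\<in>?S. Poly_Mapping.lookup q w \<odot>\<^bsub>W\<^esub> \<phi> w)"
      using S(2) by (intro W.finsum_addf) (auto simp: vspace_simps(3)[OF W])
    finally show ?thesis by (simp only: word_ops eval)
  qed
  show "word_eval W \<phi> (c \<odot>\<^bsub>word_space V i\<^esub> p) = c \<odot>\<^bsub>W\<^esub> word_eval W \<phi> p"
    if "p \<in> carrier (word_space V i)" for c p
  proof -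
    let ?S = "Poly_Mapping.keys p"
    have S: "finite ?S" "\<And>w. w \<in> ?S \<Longrightarrow> \<phi> w \<in> carrier W" using keys that by auto
    have sub: "Poly_Mapping.keys (Poly_Mapping.map ((*) c) p) \<subseteq> ?S" "?S \<subseteq> ?S"
      by (auto simp: in_keys_iff)
    note eval = sub[THEN word_eval_superset[OF W S(1) _ S(2)]]
    have "(\<Oplus>\<^bsub>W\<^esub>w\<in>?S. Poly_Mapping.lookup (Poly_Mapping.map ((*) c) p) w \<odot>\<^bsub>W\<^esub> \<phi> w) =
      (\<Oplus>\<^bsub>W\<^esub>w\<in>?S. c \<odot>\<^bsub>W\<^esub> (Poly_Mapping.lookup p w \<odot>\<^bsub>W\<^esub> \<phi> w))"
      using S(2) by (intro W.finsum_cong') (auto simp: vspace_simps(2,3)[OF W] vspace_distrib[OF W])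
    also have "\<dots> = c \<odot>\<^bsub>W\<^esub> (\<Oplus>\<^bsub>W\<^esub>w\<in>?S. Poly_Mapping.lookup p w \<odot>\<^bsub>W\<^esub> \<phi> w)"
      using S by (intro W.finsum_smult_ldistr[symmetric]) (auto simp: vspace_simps(3)[OF W])
    finally show ?thesis by (simp only: word_ops eval)
  qed
qed

lemma word_eval_single:
  assumes W: "vspace W" and "\<phi> w \<in> carrier W"
  shows "word_eval W \<phi> (Poly_Mapping.single w c) = c \<odot>\<^bsub>W\<^esub> \<phi> w"
proof -
  interpret W: vectorspace class_ring W by fact
  show ?thesis
    using word_eval_superset[OF W, of "{w}" "Poly_Mapping.single w c" \<phi>] assms(2)
    by (simp add: vspace_simps(3)[OF W])
qed

text \<open>A position in the list of arguments is given by splitting the list there, so that the last three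
  clauses match the three families of relations between words.\<close>

definition alternating ::
  "('k::field, 'v) module \<Rightarrow> nat \<Rightarrow> ('k, 'w) module \<Rightarrow> ('v list \<Rightarrow> 'w) \<Rightarrow> bool" where
  "alternating V i W \<phi> \<longleftrightarrow>
     (\<forall>ws \<in> tuples V i. \<phi> ws \<in> carrier W) \<and>
     (\<forall>us x y vs. us @ x # vs \<in> tuples V i \<and> y \<in> carrier V \<longrightarrow>
        \<phi> (us @ (x \<oplus>\<^bsub>V\<^esub> y) # vs) = \<phi> (us @ x # vs) \<oplus>\<^bsub>W\<^esub> \<phi> (us @ y # vs)) \<and>
     (\<forall>us c x vs. us @ x # vs \<in> tuples V i \<longrightarrow>
        \<phi> (us @ (c \<odot>\<^bsub>V\<^esub> x) # vs) = c \<odot>\<^bsub>W\<^esub> \<phi> (us @ x # vs)) \<and>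
     (\<forall>us vs ws x. us @ x # vs @ x # ws \<in> tuples V i \<longrightarrow> \<phi> (us @ x # vs @ x # ws) = \<zero>\<^bsub>W\<^esub>)"

lemma alternatingD:
  assumes "alternating V i W \<phi>"
  shows "ws \<in> tuples V i \<Longrightarrow> \<phi> ws \<in> carrier W"
    and "us @ x # vs \<in> tuples V i \<Longrightarrow> y \<in> carrier V \<Longrightarrow>
        \<phi> (us @ (x \<oplus>\<^bsub>V\<^esub> y) # vs) = \<phi> (us @ x # vs) \<oplus>\<^bsub>W\<^esub> \<phi> (us @ y # vs)"
    and "us @ x # vs \<in> tuples V i \<Longrightarrow> \<phi> (us @ (c \<odot>\<^bsub>V\<^esub> x) # vs) = c \<odot>\<^bsub>W\<^esub> \<phi> (us @ x # vs)"
    and "us @ x # vs @ x # ws \<in> tuples V i \<Longrightarrow> \<phi> (us @ x # vs @ x # ws) = \<zero>\<^bsub>W\<^esub>"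
  using assms unfolding alternating_def by blast+

lemma alternatingI:
  assumes "\<And>ws. ws \<in> tuples V i \<Longrightarrow> \<phi> ws \<in> carrier W"
    and "\<And>us x y vs. us @ x # vs \<in> tuples V i \<Longrightarrow> y \<in> carrier V \<Longrightarrow>
        \<phi> (us @ (x \<oplus>\<^bsub>V\<^esub> y) # vs) = \<phi> (us @ x # vs) \<oplus>\<^bsub>W\<^esub> \<phi> (us @ y # vs)"
    and "\<And>us c x vs. us @ x # vs \<in> tuples V i \<Longrightarrow>
        \<phi> (us @ (c \<odot>\<^bsub>V\<^esub> x) # vs) = c \<odot>\<^bsub>W\<^esub> \<phi> (us @ x # vs)"
    and "\<And>us vs ws x. us @ x # vs @ x # ws \<in> tuples V i \<Longrightarrow> \<phi> (us @ x # vs @ x # ws) = \<zero>\<^bsub>W\<^esub>"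
  shows "alternating V i W \<phi>"
  using assms unfolding alternating_def by blast

lemma wedge_eq: "ws \<in> tuples V i \<Longrightarrow>
    wedge V ws = word_ideal V i +>\<^bsub>word_space V i\<^esub> Poly_Mapping.single ws 1"
  by (auto simp: wedge_def tuples_def)

lemma wedge_carrier:
  assumes "vspace V" "ws \<in> tuples V i"
  shows "wedge V ws \<in> carrier (Ext V i)"
  using assms
  by (simp add: wedge_eq Ext_def quotient_carrier[OF vspace_word_space word_ideal_submodule]
      word_carrier_closed)

text \<open>The three families of relations that are divided out say that the wedge product is additive
  and homogeneous in each vector and vanishes when a vector is repeated.\<close>

lemma wedge_alternating:
  fixes V :: "('k::field, 'v) module"
  assumes V: "vspace V"
  shows "alternating V i (Ext V i) (wedge V)"
proof -
  let ?N = "word_ideal V i" and ?M = "word_space V i"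
  interpret word: vectorspace class_ring ?M by (rule vspace_word_space)
  note quot = vspace_word_space[of V i] word_ideal_submodule[OF V, of i]
  have rel: "p \<in> ?N" if "p \<in> word_relations V i" for p
    unfolding word_ideal_def
    using word.in_own_span[OF word_relations_carrier[OF V]] that by blast
  have eq: "?N +>\<^bsub>?M\<^esub> p = ?N +>\<^bsub>?M\<^esub> q"
    if "p \<in> carrier ?M" "q \<in> carrier ?M" "p - q \<in> word_relations V i" for p q
    using that rel by (simp add: quotient_coset_eq[OF quot] word_minus)
  show ?thesis
  proof (rule alternatingI)
    fix us x y ws assume *: "us @ x # ws \<in> tuples V i" "y \<in> carrier V"
    then have t: "us @ y # ws \<in> tuples V i" "us @ (x \<oplus>\<^bsub>V\<^esub> y) # ws \<in> tuples V i"
      by (auto simp: tuples_def vspace_simps[OF V])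
    have "Poly_Mapping.single (us @ (x \<oplus>\<^bsub>V\<^esub> y) # ws) 1 -
      (Poly_Mapping.single (us @ x # ws) 1 + Poly_Mapping.single (us @ y # ws) (1::'k))
      \<in> word_relations V i"
      using * unfolding word_relations_def diff_diff_eq[symmetric]
      by (intro UnI1) (auto simp: tuples_def)
    then show "wedge V (us @ (x \<oplus>\<^bsub>V\<^esub> y) # ws) = wedge V (us @ x # ws) \<oplus>\<^bsub>Ext V i\<^esub> wedge V (us @ y # ws)"
      using * t
      by (simp add: wedge_eq Ext_def quotient_add[OF quot] word_carrier_closed word_ops eq)
  next
    fix us c x ws assume *: "us @ x # ws \<in> tuples V i"
    then have t: "us @ (c \<odot>\<^bsub>V\<^esub> x) # ws \<in> tuples V i"
      by (auto simp: tuples_def vspace_simps[OF V])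
    have "Poly_Mapping.single (us @ (c \<odot>\<^bsub>V\<^esub> x) # ws) 1 - Poly_Mapping.single (us @ x # ws) c
      \<in> word_relations V i"
      using * unfolding word_relations_def
      by (intro UnI1 UnI2) (auto simp: tuples_def)
    moreover have "Poly_Mapping.map ((*) c) (Poly_Mapping.single (us @ x # ws) 1) =
      Poly_Mapping.single (us @ x # ws) c"
      by (rule poly_mapping_eqI) (simp add: lookup_single when_def)
    ultimately show "wedge V (us @ (c \<odot>\<^bsub>V\<^esub> x) # ws) = c \<odot>\<^bsub>Ext V i\<^esub> wedge V (us @ x # ws)"
      using * t
      by (simp add: wedge_eq Ext_def quotient_smult[OF quot] word_carrier_closed word_ops eq)
  next
    fix us ys ws x assume *: "us @ x # ys @ x # ws \<in> tuples V i"
    have "Poly_Mapping.single (us @ x # ys @ x # ws) 1 - (0 :: 'v list \<Rightarrow>\<^sub>0 'k) \<in> word_relations V i"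
      using * unfolding word_relations_def tuples_def
      by (intro UnI2 CollectI exI[of _ us] exI[of _ ys] exI[of _ ws] exI[of _ x]) auto
    then show "wedge V (us @ x # ys @ x # ws) = \<zero>\<^bsub>Ext V i\<^esub>"
      using *
      by (simp add: wedge_eq Ext_def quotient_zero[OF quot] word_carrier_closed word_ops eq)
  qed (simp add: wedge_carrier[OF V])
qed

text \<open>The universal property of exterior powers. The linear extension of an alternating function to words
  vanishes on the relations, hence on their span, and so factors through the quotient.\<close>

lemma Ext_universal:
  fixes V :: "('k::field, 'v) module"
  assumes V: "vspace V" and W: "vspace W" and \<phi>: "alternating V i W \<phi>"
  obtains h where "h \<in> linear_maps (Ext V i) W" "\<And>ws. ws \<in> tuples V i \<Longrightarrow> h (wedge V ws) = \<phi> ws"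
proof -
  let ?M = "word_space V i"
  have eval: "word_eval W \<phi> \<in> homs ?M W" by (rule word_eval_homs[OF W alternatingD(1)[OF \<phi>]])
  interpret W: vectorspace class_ring W by fact
  have single: "word_eval W \<phi> (Poly_Mapping.single ws c) = c \<odot>\<^bsub>W\<^esub> \<phi> ws" if "ws \<in> tuples V i" for ws c
    using word_eval_single[OF W] alternatingD(1)[OF \<phi> that] by blast
  have diff: "word_eval W \<phi> (p - q) = word_eval W \<phi> p \<ominus>\<^bsub>W\<^esub> word_eval W \<phi> q"
    if "p \<in> carrier ?M" "q \<in> carrier ?M" for p q
    using homs_minus[OF eval vspace_word_space W that] that by (simp add: word_minus)
  have "word_eval W \<phi> p = \<zero>\<^bsub>W\<^esub>" if "p \<in> word_relations V i" for p
    using that unfolding word_relations_def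
  proof (elim UnE CollectE exE conjE)
    fix us ws x y
    assume p: "p = Poly_Mapping.single (us @ (x \<oplus>\<^bsub>V\<^esub> y) # ws) 1
        - Poly_Mapping.single (us @ x # ws) 1 - Poly_Mapping.single (us @ y # ws) 1"
      and "set us \<subseteq> carrier V" "set ws \<subseteq> carrier V" "x \<in> carrier V" and y: "y \<in> carrier V"
      and "length us + length ws + 1 = i"
    then have t: "us @ y # ws \<in> tuples V i" "us @ x # ws \<in> tuples V i"
      "us @ (x \<oplus>\<^bsub>V\<^esub> y) # ws \<in> tuples V i"
      by (auto simp: tuples_def vspace_simps[OF V])
    note c = alternatingD(1)[OF \<phi>, OF t(1)] alternatingD(1)[OF \<phi>, OF t(2)]
    have "a \<oplus>\<^bsub>W\<^esub> b \<ominus>\<^bsub>W\<^esub> a \<ominus>\<^bsub>W\<^esub> b = \<zero>\<^bsub>W\<^esub>" if "a \<in> carrier W" "b \<in> carrier W" for a b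
    proof -
      have "a \<oplus>\<^bsub>W\<^esub> b \<ominus>\<^bsub>W\<^esub> a \<ominus>\<^bsub>W\<^esub> b = (a \<oplus>\<^bsub>W\<^esub> b) \<oplus>\<^bsub>W\<^esub> (\<ominus>\<^bsub>W\<^esub> (a \<oplus>\<^bsub>W\<^esub> b))"
        using that by (simp add: a_minus_def W.minus_add W.a_assoc)
      then show ?thesis using that by (simp add: W.r_neg)
    qed
    then show ?thesis
      using t c by (simp add: p diff word_carrier_closed single alternatingD(2)[OF \<phi> _ y]
        vspace_simps(6)[OF W])
  next
    fix us ws c x
    assume p: "p = Poly_Mapping.single (us @ (c \<odot>\<^bsub>V\<^esub> x) # ws) 1 - Poly_Mapping.single (us @ x # ws) c"
      and "set us \<subseteq> carrier V" "set ws \<subseteq> carrier V" "x \<in> carrier V"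
      and "length us + length ws + 1 = i"
    then have t: "us @ x # ws \<in> tuples V i" "us @ (c \<odot>\<^bsub>V\<^esub> x) # ws \<in> tuples V i"
      by (auto simp: tuples_def vspace_simps[OF V])
    show ?thesis
      using t alternatingD(1)[OF \<phi>, OF t(1)]
      by (simp add: p diff word_carrier_closed single alternatingD(3)[OF \<phi>]
        vspace_simps(3,6)[OF W] W.r_neg a_minus_def)
  next
    fix us ys ws x
    assume p: "p = Poly_Mapping.single (us @ x # ys @ x # ws) 1"
      and "set us \<subseteq> carrier V" "set ys \<subseteq> carrier V" "set ws \<subseteq> carrier V" "x \<in> carrier V"
      and "length us + length ys + length ws + 2 = i"
    then have t: "us @ x # ys @ x # ws \<in> tuples V i" by (auto simp: tuples_def)
    then show ?thesis
      by (simp add: p single alternatingD(4)[OF \<phi>] vspace_simps(8)[OF W])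
  qed
  then have "word_eval W \<phi> p = \<zero>\<^bsub>W\<^esub>" if "p \<in> word_ideal V i" for p
    using homs_vanish_on_span[OF eval vspace_word_space W word_relations_carrier[OF V]] that
    unfolding word_ideal_def by blast
  from quotient_factor[OF vspace_word_space word_ideal_submodule[OF V] W eval this]
  obtain h where h: "h \<in> linear_maps (Ext V i) W"
    "\<And>p. p \<in> carrier ?M \<Longrightarrow> h (word_ideal V i +>\<^bsub>?M\<^esub> p) = word_eval W \<phi> p"
    unfolding Ext_def by blast
  have "h (wedge V ws) = \<phi> ws" if "ws \<in> tuples V i" for ws
    using that alternatingD(1)[OF \<phi> that]
    by (simp add: wedge_eq h(2) word_carrier_closed single vspace_simps(6)[OF W])
  then show thesis using that h(1) by blast
qed

lemma replicate_zero_tuples: "vspace V \<Longrightarrow> replicate i \<zero>\<^bsub>V\<^esub> \<in> tuples V i"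
  by (auto simp: tuples_def vspace_simps)

text \<open>Decomposable elements span: a finite combination of words is taken apart one word at a time. The
  empty combination is covered because zero is a multiple of a decomposable element.\<close>

lemma Ext_induct [consumes 2, case_names wedge add smult]:
  fixes V :: "('k::field, 'v) module"
  assumes V: "vspace V" and x: "x \<in> carrier (Ext V i)"
    and wedge: "\<And>ws. ws \<in> tuples V i \<Longrightarrow> P (wedge V ws)"
    and add: "\<And>x y. x \<in> carrier (Ext V i) \<Longrightarrow> y \<in> carrier (Ext V i) \<Longrightarrow> P x \<Longrightarrow> P y
      \<Longrightarrow> P (x \<oplus>\<^bsub>Ext V i\<^esub> y)"
    and smult: "\<And>c x. x \<in> carrier (Ext V i) \<Longrightarrow> P x \<Longrightarrow> P (c \<odot>\<^bsub>Ext V i\<^esub> x)"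
  shows "P x"
proof -
  let ?N = "word_ideal V i" and ?M = "word_space V i"
  note quot = vspace_word_space[of V i] word_ideal_submodule[OF V, of i]
  note E = vspace_Ext[OF V, of i]
  have carr: "?N +>\<^bsub>?M\<^esub> p \<in> carrier (Ext V i)" if "p \<in> carrier ?M" for p
    using that by (simp add: Ext_def quotient_carrier[OF quot])
  have zero: "P \<zero>\<^bsub>Ext V i\<^esub>"
    using smult[of "wedge V (replicate i \<zero>\<^bsub>V\<^esub>)" 0] wedge[OF replicate_zero_tuples[OF V]]
      wedge_carrier[OF V replicate_zero_tuples[OF V]] vspace_simps(7)[OF E] by simp
  have P: "P (?N +>\<^bsub>?M\<^esub> p)"
    if "finite K" "Poly_Mapping.keys p \<subseteq> K" "p \<in> carrier ?M" for p K
    using that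
  proof (induction K arbitrary: p rule: finite_induct)
    case empty
    then show ?case using zero by (simp add: Ext_def quotient_zero[OF quot] word_ops)
  next
    case (insert w K)
    let ?c = "Poly_Mapping.lookup p w"
    let ?q = "p - Poly_Mapping.single w ?c"
    show ?case
    proof (cases "?c = 0")
      case True
      then have "Poly_Mapping.keys p \<subseteq> K" using insert.prems(1) by (auto simp: in_keys_iff)
      then show ?thesis using insert by blast
    next
      case False
      then have w: "w \<in> tuples V i" using insert.prems(2) by (auto simp: word_carrier_iff)
      have q: "?q \<in> carrier ?M" by (simp add: w word_carrier_closed insert.prems(2))
      have "Poly_Mapping.keys ?q \<subseteq> K"
        using insert.prems(1) by (auto simp: in_keys_iff lookup_minus lookup_single when_def split: if_splits)
      then have Pq: "P (?N +>\<^bsub>?M\<^esub> ?q)" using insert.IH q by blast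
      have "?c \<odot>\<^bsub>Ext V i\<^esub> wedge V w = ?N +>\<^bsub>?M\<^esub> Poly_Mapping.map ((*) ?c) (Poly_Mapping.single w 1)"
        by (simp add: wedge_eq[OF w] Ext_def quotient_smult[OF quot] word_carrier_closed w word_ops)
      also have "Poly_Mapping.map ((*) ?c) (Poly_Mapping.single w 1) = Poly_Mapping.single w ?c"
        by (rule poly_mapping_eqI) (simp add: lookup_single when_def)
      finally have Pw: "P (?N +>\<^bsub>?M\<^esub> Poly_Mapping.single w ?c)"
        using smult[OF wedge_carrier[OF V w] wedge[OF w], of ?c] by simp
      have "(?N +>\<^bsub>?M\<^esub> ?q) \<oplus>\<^bsub>Ext V i\<^esub> (?N +>\<^bsub>?M\<^esub> Poly_Mapping.single w ?c) = ?N +>\<^bsub>?M\<^esub> p"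
        by (simp add: Ext_def quotient_add[OF quot] q w word_carrier_closed word_ops)
      then show ?thesis
        using add[OF carr carr Pq Pw] q w by (simp add: word_carrier_closed)
    qed
  qed
  from x obtain p where "p \<in> carrier ?M" "x = ?N +>\<^bsub>?M\<^esub> p"
    by (auto simp: Ext_def quotient_carrier[OF quot])
  then show ?thesis using P[of "Poly_Mapping.keys p" p] by simp
qed

lemma Ext_homs_eq:
  assumes V: "vspace V" and f: "f \<in> homs (Ext V i) W" and g: "g \<in> homs (Ext V i) W"
    and eq: "\<And>ws. ws \<in> tuples V i \<Longrightarrow> f (wedge V ws) = g (wedge V ws)"
    and x: "x \<in> carrier (Ext V i)"
  shows "f x = g x"
  using V x by (induction x rule: Ext_induct) (simp_all add: eq homsD[OF f] homsD[OF g])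

lemma Ext_linear_maps_eq:
  assumes V: "vspace V" and "f \<in> linear_maps (Ext V i) W" "g \<in> linear_maps (Ext V i) W"
    and "\<And>ws. ws \<in> tuples V i \<Longrightarrow> f (wedge V ws) = g (wedge V ws)"
  shows "f = g"
  using assms(2,3) Ext_homs_eq[OF V assms(2,3)[THEN linear_maps_homs] assms(4)]
  by (rule linear_maps_eqI)

lemma map_tuples: "f \<in> homs V W \<Longrightarrow> ws \<in> tuples V i \<Longrightarrow> map f ws \<in> tuples W i"
  by (auto simp: tuples_def homsD)

lemma alternating_map:
  assumes f: "f \<in> homs V W" and \<phi>: "alternating W i U \<phi>"
  shows "alternating V i U (\<lambda>ws. \<phi> (map f ws))"
proof (rule alternatingI)
  fix us x y ws assume *: "us @ x # ws \<in> tuples V i" "y \<in> carrier V"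
  then have "x \<in> carrier V" by (simp add: tuples_def)
  with * show "\<phi> (map f (us @ (x \<oplus>\<^bsub>V\<^esub> y) # ws)) =
    \<phi> (map f (us @ x # ws)) \<oplus>\<^bsub>U\<^esub> \<phi> (map f (us @ y # ws))"
    using map_tuples[OF f *(1)] by (simp add: homsD[OF f] alternatingD(2)[OF \<phi>])
next
  fix us c x ws assume *: "us @ x # ws \<in> tuples V i"
  then have "x \<in> carrier V" by (simp add: tuples_def)
  with * show "\<phi> (map f (us @ (c \<odot>\<^bsub>V\<^esub> x) # ws)) = c \<odot>\<^bsub>U\<^esub> \<phi> (map f (us @ x # ws))"
    using map_tuples[OF f *(1)] by (simp add: homsD[OF f] alternatingD(3)[OF \<phi>])
next
  fix us ys ws x assume *: "us @ x # ys @ x # ws \<in> tuples V i"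
  then show "\<phi> (map f (us @ x # ys @ x # ws)) = \<zero>\<^bsub>U\<^esub>"
    using map_tuples[OF f *(1)] by (simp add: alternatingD(4)[OF \<phi>])
qed (simp add: alternatingD(1)[OF \<phi>] map_tuples[OF f])

lemma ext_map:
  assumes V: "vspace V" and W: "vspace W" and f: "f \<in> homs V W"
  shows "ext_map V W i f \<in> linear_maps (Ext V i) (Ext W i)"
    and "ws \<in> tuples V i \<Longrightarrow> ext_map V W i f (wedge V ws) = wedge W (map f ws)"
proof -
  from Ext_universal[OF V vspace_Ext[OF W] alternating_map[OF f wedge_alternating[OF W]]]
  obtain h where "h \<in> linear_maps (Ext V i) (Ext W i)"
    "\<And>ws. ws \<in> tuples V i \<Longrightarrow> h (wedge V ws) = wedge W (map f ws)" by blast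
  then have "\<exists>!h. h \<in> linear_maps (Ext V i) (Ext W i) \<and>
     (\<forall>ws \<in> tuples V i. h (wedge V ws) = wedge W (map f ws))"
    by (intro ex1I[of _ h]) (auto intro: Ext_linear_maps_eq[OF V])
  from theI'[OF this] show "ext_map V W i f \<in> linear_maps (Ext V i) (Ext W i)"
    and "ws \<in> tuples V i \<Longrightarrow> ext_map V W i f (wedge V ws) = wedge W (map f ws)"
    unfolding ext_map_def by auto
qed

lemma bilinear_maps_homs:
  assumes "B \<in> bilinear_maps U V W"
  shows "x \<in> carrier U \<Longrightarrow> (\<lambda>y. B (x, y)) \<in> homs V W"
    and "y \<in> carrier V \<Longrightarrow> (\<lambda>x. B (x, y)) \<in> homs U W"
  using assms by (auto simp: bilinear_maps_def)

lemma bilinear_maps_restrictI: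
  assumes U: "vspace U" and V: "vspace V"
    and right: "\<And>x. x \<in> carrier U \<Longrightarrow> (\<lambda>y. m x y) \<in> homs V W"
    and left: "\<And>y. y \<in> carrier V \<Longrightarrow> (\<lambda>x. m x y) \<in> homs U W"
  shows "(\<lambda>(x, y) \<in> carrier U \<times> carrier V. m x y) \<in> bilinear_maps U V W"
  unfolding bilinear_maps_def
proof (intro CollectI conjI ballI)
  fix x assume x: "x \<in> carrier U"
  show "(\<lambda>y. (\<lambda>(x, y) \<in> carrier U \<times> carrier V. m x y) (x, y)) \<in> homs V W"
    by (rule homs_cong[OF right[OF x] V]) (simp add: x)
next
  fix y assume y: "y \<in> carrier V"
  show "(\<lambda>x. (\<lambda>(x, y) \<in> carrier U \<times> carrier V. m x y) (x, y)) \<in> homs U W"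
    by (rule homs_cong[OF left[OF y] U]) (simp add: y)
qed simp

lemma Ext_bilinear_eq:
  assumes V: "vspace V" and V': "vspace V'"
    and B: "B \<in> bilinear_maps (Ext V i) (Ext V' j) W" and C: "C \<in> bilinear_maps (Ext V i) (Ext V' j) W"
    and eq: "\<And>us ws. us \<in> tuples V i \<Longrightarrow> ws \<in> tuples V' j \<Longrightarrow>
      B (wedge V us, wedge V' ws) = C (wedge V us, wedge V' ws)"
  shows "B = C"
proof (rule extensionalityI)
  show "B \<in> extensional (carrier (Ext V i) \<times> carrier (Ext V' j))"
    "C \<in> extensional (carrier (Ext V i) \<times> carrier (Ext V' j))"
    using B C by (auto simp: bilinear_maps_def)
  have *: "B (x, wedge V' ws) = C (x, wedge V' ws)"
    if "x \<in> carrier (Ext V i)" "ws \<in> tuples V' j" for x ws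
    using Ext_homs_eq[OF V bilinear_maps_homs(2)[OF B] bilinear_maps_homs(2)[OF C] _ that(1)]
      that(2) wedge_carrier[OF V'] eq by blast
  show "B z = C z" if "z \<in> carrier (Ext V i) \<times> carrier (Ext V' j)" for z
    using that Ext_homs_eq[OF V' bilinear_maps_homs(1)[OF B] bilinear_maps_homs(1)[OF C] *] by auto
qed

lemma append_tuples: "us \<in> tuples V i \<Longrightarrow> ws \<in> tuples V j \<Longrightarrow> us @ ws \<in> tuples V (i + j)"
  by (auto simp: tuples_def)

text \<open>The exterior product exists because \<open>us @ ws\<close> wedges to an alternating function of \<open>us\<close>
  and of \<open>ws\<close> separately: the universal property is applied first in the right and then in the left
  argument.\<close>

lemma ext_prod:
  fixes V :: "('k::field, 'v) module"
  assumes V: "vspace V"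
  shows "ext_prod V i j \<in> bilinear_maps (Ext V i) (Ext V j) (Ext V (i + j))"
    and "us \<in> tuples V i \<Longrightarrow> ws \<in> tuples V j
      \<Longrightarrow> ext_prod V i j (wedge V us, wedge V ws) = wedge V (us @ ws)"
proof -
  let ?W = "Ext V (i + j)"
  note W = vspace_Ext[OF V, of "i + j"]
  note alt = wedge_alternating[OF V, of "i + j"]
  have "\<exists>h. h \<in> linear_maps (Ext V j) ?W \<and> (\<forall>ws \<in> tuples V j. h (wedge V ws) = wedge V (us @ ws))"
    if us: "us \<in> tuples V i" for us
  proof -
    have "alternating V j ?W (\<lambda>ws. wedge V (us @ ws))"
      using append_tuples[OF us] alternatingD[OF alt, of "us @ _", simplified]
      by (intro alternatingI) (simp_all add: alternatingD(1)[OF alt])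
    then show ?thesis by (metis Ext_universal[OF V W])
  qed
  then obtain R where R: "\<And>us. us \<in> tuples V i \<Longrightarrow> R us \<in> homs (Ext V j) ?W"
    "\<And>us ws. us \<in> tuples V i \<Longrightarrow> ws \<in> tuples V j \<Longrightarrow> R us (wedge V ws) = wedge V (us @ ws)"
    using linear_maps_homs by metis
  have "\<exists>h. h \<in> linear_maps (Ext V i) ?W \<and> (\<forall>us \<in> tuples V i. h (wedge V us) = R us y)"
    if y: "y \<in> carrier (Ext V j)" for y
  proof -
    have "alternating V i ?W (\<lambda>us. R us y)"
    proof (rule alternatingI)
      fix us x x' us' assume *: "us @ x # us' \<in> tuples V i" "x' \<in> carrier V"
      then have t: "us @ x' # us' \<in> tuples V i" "us @ (x \<oplus>\<^bsub>V\<^esub> x') # us' \<in> tuples V i"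
        by (auto simp: tuples_def vspace_simps[OF V])
      show "R (us @ (x \<oplus>\<^bsub>V\<^esub> x') # us') y = R (us @ x # us') y \<oplus>\<^bsub>?W\<^esub> R (us @ x' # us') y"
      proof (rule Ext_homs_eq[OF V R(1)[OF t(2)] homs_add_fun[OF R(1)[OF *(1)] R(1)[OF t(1)] W] _ y])
        fix ws assume ws: "ws \<in> tuples V j"
        show "R (us @ (x \<oplus>\<^bsub>V\<^esub> x') # us') (wedge V ws) =
          R (us @ x # us') (wedge V ws) \<oplus>\<^bsub>?W\<^esub> R (us @ x' # us') (wedge V ws)"
          using alternatingD(2)[OF alt _ *(2), of us x "us' @ ws"] append_tuples[OF *(1) ws]
          by (simp add: R(2)[OF _ ws] t *)
      qed
    next
      fix us c x us' assume *: "us @ x # us' \<in> tuples V i"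
      then have t: "us @ (c \<odot>\<^bsub>V\<^esub> x) # us' \<in> tuples V i"
        by (auto simp: tuples_def vspace_simps[OF V])
      show "R (us @ (c \<odot>\<^bsub>V\<^esub> x) # us') y = c \<odot>\<^bsub>?W\<^esub> R (us @ x # us') y"
      proof (rule Ext_homs_eq[OF V R(1)[OF t] homs_smult_fun[OF R(1)[OF *] W] _ y])
        fix ws assume ws: "ws \<in> tuples V j"
        show "R (us @ (c \<odot>\<^bsub>V\<^esub> x) # us') (wedge V ws) = c \<odot>\<^bsub>?W\<^esub> R (us @ x # us') (wedge V ws)"
          using alternatingD(3)[OF alt, of us x "us' @ ws"] append_tuples[OF * ws]
          by (simp add: R(2)[OF _ ws] t *)
      qed
    next
      fix us ys us' x assume *: "us @ x # ys @ x # us' \<in> tuples V i"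
      show "R (us @ x # ys @ x # us') y = \<zero>\<^bsub>?W\<^esub>"
      proof (rule Ext_homs_eq[OF V R(1)[OF *] homs_zero_fun[OF W] _ y])
        fix ws assume ws: "ws \<in> tuples V j"
        show "R (us @ x # ys @ x # us') (wedge V ws) = \<zero>\<^bsub>?W\<^esub>"
          using alternatingD(4)[OF alt, of us x ys "us' @ ws"] append_tuples[OF * ws]
          by (simp add: R(2)[OF _ ws] *)
      qed
    qed (simp add: homsD(1)[OF R(1)] y)
    then show ?thesis by (metis Ext_universal[OF V W])
  qed
  then obtain L where L: "\<And>y. y \<in> carrier (Ext V j) \<Longrightarrow> L y \<in> homs (Ext V i) ?W"
    "\<And>y us. y \<in> carrier (Ext V j) \<Longrightarrow> us \<in> tuples V i \<Longrightarrow> L y (wedge V us) = R us y"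
    using linear_maps_homs by metis
  note Ej = vspace_Ext[OF V, of j]
  have L_hom: "(\<lambda>y. L y x) \<in> homs (Ext V j) ?W" if x: "x \<in> carrier (Ext V i)" for x
  proof (rule homsI)
    fix y y' assume y: "y \<in> carrier (Ext V j)" "y' \<in> carrier (Ext V j)"
    then have yy: "y \<oplus>\<^bsub>Ext V j\<^esub> y' \<in> carrier (Ext V j)" by (simp add: vspace_simps(2)[OF Ej])
    show "L (y \<oplus>\<^bsub>Ext V j\<^esub> y') x = L y x \<oplus>\<^bsub>?W\<^esub> L y' x"
      by (rule Ext_homs_eq[OF V L(1)[OF yy] homs_add_fun[OF L(1)[OF y(1)] L(1)[OF y(2)] W] _ x])
        (simp add: L(2) y yy homsD(2)[OF R(1)])
  next
    fix c y assume y: "y \<in> carrier (Ext V j)"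
    then have cy: "c \<odot>\<^bsub>Ext V j\<^esub> y \<in> carrier (Ext V j)" by (simp add: vspace_simps(3)[OF Ej])
    show "L (c \<odot>\<^bsub>Ext V j\<^esub> y) x = c \<odot>\<^bsub>?W\<^esub> L y x"
      by (rule Ext_homs_eq[OF V L(1)[OF cy] homs_smult_fun[OF L(1)[OF y] W] _ x])
        (simp add: L(2) y cy homsD(3)[OF R(1)])
  qed (simp add: homsD[OF L(1)] x)
  define B where "B = (\<lambda>(x, y) \<in> carrier (Ext V i) \<times> carrier (Ext V j). L y x)"
  have "B \<in> bilinear_maps (Ext V i) (Ext V j) ?W"
    unfolding B_def by (rule bilinear_maps_restrictI[OF vspace_Ext[OF V] Ej L_hom L(1)])
  moreover have "B (wedge V us, wedge V ws) = wedge V (us @ ws)"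
    if "us \<in> tuples V i" "ws \<in> tuples V j" for us ws
    using that by (simp add: B_def wedge_carrier[OF V] L R)
  ultimately have "\<exists>!B. B \<in> bilinear_maps (Ext V i) (Ext V j) ?W \<and>
     (\<forall>us \<in> tuples V i. \<forall>ws \<in> tuples V j. B (wedge V us, wedge V ws) = wedge V (us @ ws))"
    by (intro ex1I[of _ B]) (auto intro: Ext_bilinear_eq[OF V V])
  from theI'[OF this] show "ext_prod V i j \<in> bilinear_maps (Ext V i) (Ext V j) ?W"
    and "us \<in> tuples V i \<Longrightarrow> ws \<in> tuples V j
      \<Longrightarrow> ext_prod V i j (wedge V us, wedge V ws) = wedge V (us @ ws)"
    unfolding ext_prod_def by auto
qed

section \<open>Coordinates on the exterior powers of a three-dimensional space\<close>

lemma ground_space_simps [simp]: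
  "carrier ground_space = UNIV" "\<zero>\<^bsub>ground_space\<^esub> = 0"
  "x \<oplus>\<^bsub>ground_space\<^esub> y = x + y" "x \<odot>\<^bsub>ground_space\<^esub> y = x * y"
  by (simp_all add: ground_space_def)

lemma direct_sum_simps [simp]:
  "carrier (direct_sum A B) = carrier A \<times> carrier B"
  "\<zero>\<^bsub>direct_sum A B\<^esub> = (\<zero>\<^bsub>A\<^esub>, \<zero>\<^bsub>B\<^esub>)"
  "x \<oplus>\<^bsub>direct_sum A B\<^esub> y = (fst x \<oplus>\<^bsub>A\<^esub> fst y, snd x \<oplus>\<^bsub>B\<^esub> snd y)"
  "c \<odot>\<^bsub>direct_sum A B\<^esub> x = (c \<odot>\<^bsub>A\<^esub> fst x, c \<odot>\<^bsub>B\<^esub> snd x)"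
  by (simp_all add: direct_sum_def)

lemma vspace_ground_space: "vspace ground_space"
  by (rule vspaceI) (simp_all add: algebra_simps)

lemma vspace_space3: "vspace space3"
  by (intro direct_sum_is_vs vspace_ground_space)

lemma dot3_eq: "dot3 x y = fst x * fst y + fst (snd x) * fst (snd y) + snd (snd x) * snd (snd y)"
  by (cases x; cases y) auto

lemma cross3_eq: "cross3 x y =
    (fst (snd x) * snd (snd y) - snd (snd x) * fst (snd y),
     snd (snd x) * fst y - fst x * snd (snd y),
     fst x * fst (snd y) - fst (snd x) * fst y)"
  by (cases x; cases y) auto

lemmas vec3_simps = dot3_eq cross3_eq prod_eq_iff

text \<open>The Pluecker coordinates of a wedge product of vectors of \<open>k\<^sup>3\<close>. Scalars, for the degrees
  \<open>0\<close> and \<open>3\<close>, are embedded in \<open>k\<^sup>3\<close> as the first axis, so that all degrees are treated alike.\<close>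

fun wedge3 :: "'k::field vec3 list \<Rightarrow> 'k vec3" where
  "wedge3 [] = (1, 0, 0)"
| "wedge3 [u] = u"
| "wedge3 [u, v] = cross3 u v"
| "wedge3 [u, v, w] = (dot3 (cross3 u v) w, 0, 0)"
| "wedge3 (u # v # w # x # ws) = (0, 0, 0)"

lemma wedge3_alternating: "alternating space3 i space3 wedge3"
proof (rule alternatingI)
  fix us ws :: "'k::field vec3 list" and x y :: "'k vec3"
  show "wedge3 (us @ (x \<oplus>\<^bsub>space3\<^esub> y) # ws) =
    wedge3 (us @ x # ws) \<oplus>\<^bsub>space3\<^esub> wedge3 (us @ y # ws)"
    by (cases us rule: wedge3.cases; cases ws rule: wedge3.cases) (simp_all add: vec3_simps algebra_simps)
next
  fix us ws :: "'k::field vec3 list" and x :: "'k vec3" and c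
  show "wedge3 (us @ (c \<odot>\<^bsub>space3\<^esub> x) # ws) = c \<odot>\<^bsub>space3\<^esub> wedge3 (us @ x # ws)"
    by (cases us rule: wedge3.cases; cases ws rule: wedge3.cases) (simp_all add: vec3_simps algebra_simps)
next
  fix us ys ws :: "'k::field vec3 list" and x :: "'k vec3"
  show "wedge3 (us @ x # ys @ x # ws) = \<zero>\<^bsub>space3\<^esub>"
    by (cases us rule: wedge3.cases; cases ys rule: wedge3.cases; cases ws rule: wedge3.cases)
      (simp_all add: vec3_simps algebra_simps)
qed simp

definition pluecker_range :: "nat \<Rightarrow> 'k::field vec3 set" where
  "pluecker_range i = (if i = 0 \<or> i = 3 then {a. snd a = (0, 0)} else UNIV)"

lemma wedge3_range: "wedge3 ws \<in> pluecker_range (length ws)"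
  by (cases ws rule: wedge3.cases) (auto simp: pluecker_range_def)

lemma le_3_cases: "i \<le> 3 \<longleftrightarrow> i = 0 \<or> i = Suc 0 \<or> i = 2 \<or> i = (3::nat)"
  by auto

text \<open>A coordinate system carries the same information as an ordered basis, but the dual space, the
  images under isomorphisms and the equality of vectors are easier to describe in terms of it.\<close>

locale coords =
  fixes V :: "('k::field, 'v) module" and c :: "'v \<Rightarrow> 'k vec3"
  assumes V: "vspace V" and c: "c \<in> homs V space3" and bij: "bij_betw c (carrier V) UNIV"
begin

definition vec :: "'k vec3 \<Rightarrow> 'v" where
  "vec = inv_into (carrier V) c"

lemma vec_carrier [simp]: "vec a \<in> carrier V"
  unfolding vec_def using bij by (metis UNIV_I bij_betw_imp_surj_on inv_into_into)

lemma c_vec [simp]: "c (vec a) = a"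
  unfolding vec_def using bij by (metis UNIV_I bij_betw_imp_surj_on f_inv_into_f)

lemma vec_c: "v \<in> carrier V \<Longrightarrow> vec (c v) = v"
  unfolding vec_def using bij by (metis bij_betw_imp_inj_on inv_into_f_f)

lemma vec_homs: "vec \<in> homs space3 V"
  using homs_inv_into[OF c _ V] bij by (simp add: vec_def)

abbreviation "e1 \<equiv> vec (1, 0, 0)"
abbreviation "e2 \<equiv> vec (0, 1, 0)"
abbreviation "e3 \<equiv> vec (0, 0, 1)"

lemma vec_expand: "vec a = fst a \<odot>\<^bsub>V\<^esub> e1 \<oplus>\<^bsub>V\<^esub> (fst (snd a) \<odot>\<^bsub>V\<^esub> e2 \<oplus>\<^bsub>V\<^esub> snd (snd a) \<odot>\<^bsub>V\<^esub> e3)"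
proof -
  have "a = fst a \<odot>\<^bsub>space3\<^esub> (1, 0, 0) \<oplus>\<^bsub>space3\<^esub> (fst (snd a) \<odot>\<^bsub>space3\<^esub> (0, 1, 0) \<oplus>\<^bsub>space3\<^esub> snd (snd a) \<odot>\<^bsub>space3\<^esub> (0, 0, 1))"
    by simp
  also have "vec \<dots> = fst a \<odot>\<^bsub>V\<^esub> e1 \<oplus>\<^bsub>V\<^esub> (fst (snd a) \<odot>\<^bsub>V\<^esub> e2 \<oplus>\<^bsub>V\<^esub> snd (snd a) \<odot>\<^bsub>V\<^esub> e3)"
    by (simp only: homsD(2,3)[OF vec_homs] direct_sum_simps(1) ground_space_simps(1) UNIV_Times_UNIV UNIV_I)
  finally show ?thesis .
qed

lemma homs_eqI:
  assumes f: "f \<in> homs V W" and g: "g \<in> homs V W"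
    and "f e1 = g e1" "f e2 = g e2" "f e3 = g e3" and v: "v \<in> carrier V"
  shows "f v = g v"
proof -
  have "f (vec a) = g (vec a)" for a
    unfolding vec_expand[of a] by (simp add: homsD[OF f] homsD[OF g] vspace_simps(2,3)[OF V] assms)
  then show ?thesis using vec_c[OF v] by metis
qed

text \<open>An alternating function is determined by its values on lists of basis vectors: the arguments
  are replaced by basis vectors one at a time, from the right.\<close>

lemma alternating_eqI:
  assumes \<phi>: "alternating V i W \<phi>" and \<psi>: "alternating V i W \<psi>"
    and eq: "\<And>ws. length ws = i \<Longrightarrow> set ws \<subseteq> {e1, e2, e3} \<Longrightarrow> \<phi> ws = \<psi> ws"
    and ws: "ws \<in> tuples V i"
  shows "\<phi> ws = \<psi> ws"
proof -
  have "\<phi> (us @ bs) = \<psi> (us @ bs)"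
    if "set us \<subseteq> carrier V" "set bs \<subseteq> {e1, e2, e3}" "length us + length bs = i" for us bs
    using that
  proof (induction us arbitrary: bs rule: rev_induct)
    case Nil
    then show ?case using eq by simp
  next
    case (snoc x us)
    have bs: "set bs \<subseteq> carrier V" using snoc.prems(2) by auto
    have t: "us @ y # bs \<in> tuples V i" if "y \<in> carrier V" for y
      using snoc.prems bs that by (auto simp: tuples_def)
    have hom: "(\<lambda>y. \<chi> (us @ y # bs)) \<in> homs V W" if \<chi>: "alternating V i W \<chi>" for \<chi>
      by (intro homsI alternatingD(1)[OF \<chi>] alternatingD(2)[OF \<chi>] alternatingD(3)[OF \<chi>] t)
    have "\<phi> (us @ x # bs) = \<psi> (us @ x # bs)"
      by (rule homs_eqI[OF hom[OF \<phi>] hom[OF \<psi>]]) (use snoc.IH[of "_ # bs"] snoc.prems in auto)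
    then show ?case by simp
  qed
  from this[of ws "[]"] show ?thesis using ws by (auto simp: tuples_def)
qed

definition pluecker :: "nat \<Rightarrow> ('k, 'v) ext \<Rightarrow> 'k vec3" where
  "pluecker i = (SOME h. h \<in> linear_maps (Ext V i) space3 \<and>
     (\<forall>ws \<in> tuples V i. h (wedge V ws) = wedge3 (map c ws)))"

text \<open>The choice defining \<open>pluecker\<close> is possible by the universal property, since \<open>wedge3\<close> is alternating.\<close>

lemma pluecker: "pluecker i \<in> homs (Ext V i) space3"
  and pluecker_wedge: "ws \<in> tuples V i \<Longrightarrow> pluecker i (wedge V ws) = wedge3 (map c ws)"
proof -
  have "\<exists>h. h \<in> linear_maps (Ext V i) space3 \<and>
     (\<forall>ws \<in> tuples V i. h (wedge V ws) = wedge3 (map c ws))"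
    by (rule Ext_universal[OF V vspace_space3 alternating_map[OF c wedge3_alternating]]) blast
  from someI_ex[OF this, folded pluecker_def]
  show "pluecker i \<in> homs (Ext V i) space3"
    and "ws \<in> tuples V i \<Longrightarrow> pluecker i (wedge V ws) = wedge3 (map c ws)"
    by (auto dest: linear_maps_homs)
qed

text \<open>The inverse of \<open>pluecker\<close> for \<open>i \<le> 3\<close>. In degree \<open>2\<close> the basis vectors are taken in cyclic order
  because the coordinates are those of the cross product.\<close>

definition from_pluecker :: "nat \<Rightarrow> 'k vec3 \<Rightarrow> ('k, 'v) ext" where
  "from_pluecker i a =
     (if i = 0 then fst a \<odot>\<^bsub>Ext V i\<^esub> wedge V []
      else if i = 1 then wedge V [vec a]
      else if i = 2 then fst a \<odot>\<^bsub>Ext V i\<^esub> wedge V [e2, e3] \<oplus>\<^bsub>Ext V i\<^esub>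
        (fst (snd a) \<odot>\<^bsub>Ext V i\<^esub> wedge V [e3, e1] \<oplus>\<^bsub>Ext V i\<^esub> snd (snd a) \<odot>\<^bsub>Ext V i\<^esub> wedge V [e1, e2])
      else fst a \<odot>\<^bsub>Ext V i\<^esub> wedge V [e1, e2, e3])"

lemma basis_wedge_carrier:
  "wedge V [] \<in> carrier (Ext V 0)" "v \<in> carrier V \<Longrightarrow> wedge V [v] \<in> carrier (Ext V (Suc 0))"
  "u \<in> carrier V \<Longrightarrow> v \<in> carrier V \<Longrightarrow> wedge V [u, v] \<in> carrier (Ext V 2)"
  "u \<in> carrier V \<Longrightarrow> v \<in> carrier V \<Longrightarrow> w \<in> carrier V \<Longrightarrow> wedge V [u, v, w] \<in> carrier (Ext V 3)"
  by (rule wedge_carrier[OF V], simp add: tuples_def)+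

lemma from_pluecker_homs:
  assumes "i \<le> 3"
  shows "from_pluecker i \<in> homs space3 (Ext V i)"
proof -
  note E = vspace_Ext[OF V, of i]
  note alt = alternatingD(2)[OF wedge_alternating[OF V, of "Suc 0"], of "[]" _ "[]", simplified]
    alternatingD(3)[OF wedge_alternating[OF V, of "Suc 0"], of "[]" _ "[]", simplified]
  show ?thesis
    using assms unfolding le_3_cases
    by (elim disjE; intro homsI)
      (use E in \<open>simp_all add: from_pluecker_def basis_wedge_carrier vspace_simps vspace_distrib vspace_add_ac
        homsD(2,3)[OF vec_homs, simplified] alt tuples_def\<close>)
qed

lemma pluecker_from_pluecker:
  assumes "i \<le> 3" "a \<in> pluecker_range i"
  shows "pluecker i (from_pluecker i a) = a"
proof -
  obtain a1 a2 a3 where a: "a = (a1, a2, a3)" by (cases a) auto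
  note simps = a from_pluecker_def homsD(2,3)[OF pluecker] basis_wedge_carrier
    vspace_simps(2,3)[OF vspace_Ext[OF V]] pluecker_wedge tuples_def
  show ?thesis
    using assms unfolding le_3_cases
    by (elim disjE) (simp_all add: simps, simp_all add: pluecker_range_def)
qed

lemma pluecker_in_range:
  assumes "i \<le> 3" and x: "x \<in> carrier (Ext V i)"
  shows "pluecker i x \<in> pluecker_range i"
  using V x
proof (induction x rule: Ext_induct)
  case (wedge ws)
  then have "length (map c ws) = i" by (simp add: tuples_def)
  then show ?case
    using wedge3_range[of "map c ws"] by (simp only: pluecker_wedge[OF wedge])
next
  case (add x y)
  then show ?case
    unfolding homsD(2)[OF pluecker add(1,2)]
    by (auto simp: pluecker_range_def split: if_splits)
next
  case (smult c x)
  then show ?case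
    unfolding homsD(3)[OF pluecker smult(1)]
    by (auto simp: pluecker_range_def split: if_splits)
qed

text \<open>This follows from expanding \<open>(x + y) \<and> (x + y) = 0\<close>.\<close>

lemma wedge_swap:
  assumes "us @ x # y # ws \<in> tuples V i"
  shows "wedge V (us @ y # x # ws) = (-1) \<odot>\<^bsub>Ext V i\<^esub> wedge V (us @ x # y # ws)"
proof -
  note E = vspace_Ext[OF V, of i]
  interpret E: vectorspace class_ring "Ext V i" by (rule E)
  note alt = wedge_alternating[OF V, of i]
  let ?w = "\<lambda>a b. wedge V (us @ a # b # ws)"
  have xy: "x \<in> carrier V" "y \<in> carrier V" using assms by (auto simp: tuples_def)
  have t: "us @ a # b # ws \<in> tuples V i" if "a \<in> carrier V" "b \<in> carrier V" for a b
    using that assms by (auto simp: tuples_def)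
  note cl = wedge_carrier[OF V t]
  note add1 = alternatingD(2)[OF alt, of us _ "_ # ws"]
  have add2: "?w a (b \<oplus>\<^bsub>V\<^esub> b') = ?w a b \<oplus>\<^bsub>Ext V i\<^esub> ?w a b'"
    if "a \<in> carrier V" "b \<in> carrier V" "b' \<in> carrier V" for a b b'
    using alternatingD(2)[OF alt, of "us @ [a]" b ws b'] t that by simp
  have rep: "?w a a = \<zero>\<^bsub>Ext V i\<^esub>" if "a \<in> carrier V" for a
    using alternatingD(4)[OF alt, of us a "[]" ws] t that by simp
  have "\<zero>\<^bsub>Ext V i\<^esub> = ?w (x \<oplus>\<^bsub>V\<^esub> y) (x \<oplus>\<^bsub>V\<^esub> y)"
    using xy by (simp add: rep vspace_simps(2)[OF V])
  also have "\<dots> = ?w x (x \<oplus>\<^bsub>V\<^esub> y) \<oplus>\<^bsub>Ext V i\<^esub> ?w y (x \<oplus>\<^bsub>V\<^esub> y)"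
    using xy by (intro add1 t) (simp_all add: vspace_simps(2)[OF V])
  also have "\<dots> = ?w x y \<oplus>\<^bsub>Ext V i\<^esub> ?w y x"
    using xy by (simp add: add2 cl rep)
  finally have "?w x y \<oplus>\<^bsub>Ext V i\<^esub> ?w y x = \<zero>\<^bsub>Ext V i\<^esub>" ..
  then have "?w y x = \<ominus>\<^bsub>Ext V i\<^esub> ?w x y"
    using cl xy by (metis E.minus_equality E.a_comm)
  then show ?thesis using cl xy by (simp add: vspace_simps(9)[OF E])
qed

text \<open>Both sides are linear, so it suffices to compare them on decomposable elements, and there both are
  alternating, so it suffices to compare them on lists of basis vectors. These are sorted by \<open>wedge_swap\<close> or
  have a repeated entry.\<close>

lemma from_pluecker_pluecker:
  assumes i: "i \<le> 3" and x: "x \<in> carrier (Ext V i)"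
  shows "from_pluecker i (pluecker i x) = x"
proof -
  note E = vspace_Ext[OF V, of i]
  note fp = from_pluecker_homs[OF i]
  have id: "(\<lambda>x. x) \<in> homs (Ext V i) (Ext V i)" by (rule homsI) simp_all
  have alt: "alternating V i (Ext V i) (\<lambda>ws. from_pluecker i (wedge3 (map c ws)))"
  proof -
    note wc = alternating_map[OF c wedge3_alternating, of i]
    show ?thesis
      by (rule alternatingI)
        (simp_all only: alternatingD[OF wc] homsD[OF fp] homs_zero[OF fp vspace_space3 E]
          direct_sum_simps(1) ground_space_simps(1) UNIV_Times_UNIV UNIV_I)
  qed
  show ?thesis
  proof (rule Ext_homs_eq[OF V homs_comp[OF pluecker fp] id _ x])
    fix ws assume ws: "ws \<in> tuples V i"
    have "from_pluecker i (wedge3 (map c ws)) = wedge V ws"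
    proof (rule alternating_eqI[OF alt wedge_alternating[OF V] _ ws])
      fix bs assume bs: "length bs = i" "set bs \<subseteq> {e1, e2, e3}"
      have rep2: "wedge V [a, a] = \<zero>\<^bsub>Ext V 2\<^esub>" if "a \<in> carrier V" for a
        using that alternatingD(4)[OF wedge_alternating[OF V, of 2], of "[]" a "[]" "[]"]
        by (simp add: tuples_def)
      have rep: "wedge V [a, a, b] = \<zero>\<^bsub>Ext V 3\<^esub>"
        "wedge V [a, b, a] = \<zero>\<^bsub>Ext V 3\<^esub>" "wedge V [b, a, a] = \<zero>\<^bsub>Ext V 3\<^esub>"
        if "a \<in> carrier V" "b \<in> carrier V" for a b
        using that alternatingD(4)[OF wedge_alternating[OF V, of 3], of "[]" a "[]" "[b]"]
          alternatingD(4)[OF wedge_alternating[OF V, of 3], of "[]" a "[b]" "[]"]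
          alternatingD(4)[OF wedge_alternating[OF V, of 3], of "[b]" a "[]" "[]"]
        by (simp_all add: tuples_def)
      have swap: "wedge V [e2, e1] = (-1) \<odot>\<^bsub>Ext V 2\<^esub> wedge V [e1, e2]"
        "wedge V [e3, e2] = (-1) \<odot>\<^bsub>Ext V 2\<^esub> wedge V [e2, e3]"
        "wedge V [e1, e3] = (-1) \<odot>\<^bsub>Ext V 2\<^esub> wedge V [e3, e1]"
        "wedge V [e2, e1, e3] = (-1) \<odot>\<^bsub>Ext V 3\<^esub> wedge V [e1, e2, e3]"
        "wedge V [e1, e3, e2] = (-1) \<odot>\<^bsub>Ext V 3\<^esub> wedge V [e1, e2, e3]"
        "wedge V [e3, e1, e2] = (-1) \<odot>\<^bsub>Ext V 3\<^esub> wedge V [e1, e3, e2]"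
        "wedge V [e2, e3, e1] = (-1) \<odot>\<^bsub>Ext V 3\<^esub> wedge V [e2, e1, e3]"
        "wedge V [e3, e2, e1] = (-1) \<odot>\<^bsub>Ext V 3\<^esub> wedge V [e2, e3, e1]"
        using wedge_swap[of "[]" e1 e2 "[]" 2] wedge_swap[of "[]" e2 e3 "[]" 2]
          wedge_swap[of "[]" e3 e1 "[]" 2] wedge_swap[of "[]" e1 e2 "[e3]" 3]
          wedge_swap[of "[e1]" e2 e3 "[]" 3] wedge_swap[of "[]" e1 e3 "[e2]" 3]
          wedge_swap[of "[e2]" e1 e3 "[]" 3] wedge_swap[of "[]" e2 e3 "[e1]" 3]
        by (simp_all add: tuples_def)
      note simps = from_pluecker_def swap rep2 rep basis_wedge_carrier vspace_simps(1-8)[OF vspace_Ext[OF V]]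
        vspace_distrib(3)[OF vspace_Ext[OF V]]
      consider "i = 0" "bs = []" | u where "i = 1" "bs = [u]" | u v where "i = 2" "bs = [u, v]"
        | u v w where "i = 3" "bs = [u, v, w]"
        using bs(1) i unfolding le_3_cases by (auto simp: length_Suc_conv numeral_2_eq_2 numeral_3_eq_3)
      then show "from_pluecker i (wedge3 (map c bs)) = wedge V bs"
        by cases (use bs(2) in \<open>auto simp: simps\<close>)
    qed
    then show "from_pluecker i (pluecker i (wedge V ws)) = wedge V ws"
      by (simp add: pluecker_wedge ws)
  qed
qed

lemma pluecker_inj:
  assumes "i \<le> 3" "x \<in> carrier (Ext V i)" "y \<in> carrier (Ext V i)" "pluecker i x = pluecker i y"
  shows "x = y"
  using assms from_pluecker_pluecker by metis

end

section \<open>Duality, the pairing and the star operator in coordinates\<close>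

lemma dual_simps:
  fixes V :: "('k::field, 'v) module"
  shows "carrier (dual V) = linear_maps V ground_space"
    "\<zero>\<^bsub>dual V\<^esub> = (\<lambda>v \<in> carrier V. 0)"
    "f \<oplus>\<^bsub>dual V\<^esub> g = (\<lambda>v \<in> carrier V. f v + g v)"
    "a \<odot>\<^bsub>dual V\<^esub> f = (\<lambda>v \<in> carrier V. a * f v)"
  by (simp_all add: dual_def ring.func_space_def[OF class_ring.ring_axioms])

lemma vspace_dual:
  fixes V :: "('k::field, 'v) module"
  assumes V: "vspace V"
  shows "vspace (dual V)"
proof -
  have add: "(\<lambda>v \<in> carrier V. f v + g v) \<in> linear_maps V ground_space"
    if "f \<in> linear_maps V ground_space" "g \<in> linear_maps V ground_space" for f g
    using linear_maps_restrict[OF homs_add_fun[OF that[THEN linear_maps_homs] vspace_ground_space] V]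
    by simp
  have smult: "(\<lambda>v \<in> carrier V. a * f v) \<in> linear_maps V ground_space"
    if "f \<in> linear_maps V ground_space" for f a
    using linear_maps_restrict[OF homs_smult_fun[OF that[THEN linear_maps_homs] vspace_ground_space] V]
    by simp
  have zero: "(\<lambda>v \<in> carrier V. 0) \<in> linear_maps V (ground_space :: ('k, 'k) module)"
    using linear_maps_restrict[OF homs_zero_fun[OF vspace_ground_space] V] by simp
  have ext: "restrict f (carrier V) = f" if "f \<in> linear_maps V ground_space" for f
    using that by (intro extensional_restrict) (simp add: linear_maps_def)
  show ?thesis
    by (rule vspaceI, unfold dual_simps)
      (use add smult zero ext in \<open>simp_all add: algebra_simps cong: restrict_cong\<close>)
qed

lemma det_mat_1: "det (mat (Suc 0) (Suc 0) f) = f (0, 0)"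
  by (subst det_single) auto

lemma det_mat_2:
  "det (mat 2 2 f) = f (0, 0) * f (1, 1) - f (0, 1) * f (1, 0 :: nat)" for f :: "nat \<times> nat \<Rightarrow> 'k::comm_ring_1"
proof -
  have "det (mat 2 2 f) = (\<Sum>i<2. mat 2 2 f $$ (i, 0) * cofactor (mat 2 2 f) i 0)"
    by (rule laplace_expansion_column) auto
  then show ?thesis
    by (simp add: numeral_2_eq_2 cofactor_def mat_delete_def det_mat_1)
qed

lemma det_mat_3:
  "det (mat 3 3 f) =
     f (0, 0) * (f (1, 1) * f (2, 2) - f (1, 2) * f (2, 1))
   - f (1, 0) * (f (0, 1) * f (2, 2) - f (0, 2) * f (2, 1))
   + f (2, 0) * (f (0, 1) * f (1, 2) - f (0, 2) * f (1, 1))"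
  for f :: "nat \<times> nat \<Rightarrow> 'k::comm_ring_1"
proof -
  have "det (mat 3 3 f) = (\<Sum>i<3. mat 3 3 f $$ (i, 0) * cofactor (mat 3 3 f) i 0)"
    by (rule laplace_expansion_column) auto
  then show ?thesis
    by (simp add: eval_nat_numeral cofactor_def mat_delete_def
        det_mat_2[unfolded numeral_2_eq_2, simplified] algebra_simps)
qed

lemma homs_dot3:
  assumes "f \<in> homs U space3"
  shows "(\<lambda>x. dot3 a (f x)) \<in> homs U ground_space" "(\<lambda>x. dot3 (f x) a) \<in> homs U ground_space"
  by (intro homsI; simp add: homsD(2,3)[OF assms] dot3_eq algebra_simps)+

context coords
begin

definition dual_coord :: "('v \<Rightarrow> 'k) \<Rightarrow> 'k vec3" where
  "dual_coord f = (f e1, f e2, f e3)"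

lemma dual_eval:
  assumes "f \<in> carrier (dual V)" "v \<in> carrier V"
  shows "f v = dot3 (dual_coord f) (c v)"
proof (rule homs_eqI[OF _ homs_dot3(1)[OF c] _ _ _ assms(2)])
  show "f \<in> homs V ground_space" using assms(1) by (simp add: dual_simps linear_maps_homs)
qed (simp_all add: dual_coord_def)

lemma coords_dual: "coords (dual V) dual_coord"
proof (rule coords.intro)
  show "dual_coord \<in> homs (dual V) space3"
    by (rule homsI) (simp_all add: dual_simps dual_coord_def)
  define d where "d a = (\<lambda>v \<in> carrier V. dot3 a (c v))" for a
  have d: "d a \<in> carrier (dual V)" for a
    unfolding d_def dual_simps by (intro linear_maps_restrict homs_dot3 c V)
  show "bij_betw dual_coord (carrier (dual V)) UNIV"
  proof (rule bij_betw_byWitness[where f' = d])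
    show "\<forall>f\<in>carrier (dual V). d (dual_coord f) = f"
    proof
      fix f assume f: "f \<in> carrier (dual V)"
      show "d (dual_coord f) = f"
        by (rule linear_maps_eqI[of _ V ground_space])
          (use d f dual_eval[OF f] in \<open>auto simp: dual_simps d_def\<close>)
    qed
    show "\<forall>a\<in>UNIV. dual_coord (d a) = a"
      by (auto simp: d_def dual_coord_def)
  qed (use d in auto)
qed (rule vspace_dual[OF V])

interpretation D: coords "dual V" dual_coord by (rule coords_dual)

text \<open>The Cauchy-Binet formula for the product of an \<open>i \<times> 3\<close> by a \<open>3 \<times> i\<close> matrix, whose maximal minors are
  the Pluecker coordinates.\<close>

lemma dot3_wedge3:
  assumes "i \<le> 3" "fs \<in> tuples (dual V) i" "ws \<in> tuples V i"
  shows "dot3 (wedge3 (map dual_coord fs)) (wedge3 (map c ws)) =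
    det (mat i i (\<lambda>(p, q). (fs ! p) (ws ! q)))"
proof -
  have len: "length fs = i" "length ws = i"
    and carr: "set fs \<subseteq> carrier (dual V)" "set ws \<subseteq> carrier V"
    using assms by (auto simp: tuples_def)
  consider "i = 0" "fs = []" "ws = []" | f v where "i = 1" "fs = [f]" "ws = [v]"
    | f g u v where "i = 2" "fs = [f, g]" "ws = [u, v]"
    | f g h u v w where "i = 3" "fs = [f, g, h]" "ws = [u, v, w]"
    using len assms(1) unfolding le_3_cases
    by (auto simp: length_Suc_conv numeral_2_eq_2 numeral_3_eq_3)
  then show ?thesis
  proof cases
    case 1
    then show ?thesis by simp
  next
    case (2 f v)
    then show ?thesis using carr by (simp add: det_mat_1 dual_eval)
  next
    case (3 f g u v)
    then show ?thesis using carr by (simp add: det_mat_2 dual_eval vec3_simps algebra_simps)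
  next
    case (4 f g h u v w)
    then show ?thesis using carr by (simp add: det_mat_3 dual_eval vec3_simps algebra_simps)
  qed
qed

text \<open>The dot product of Pluecker coordinates is bilinear and by the Cauchy-Binet formula has the values on
  decomposable elements that define the pairing. A bilinear map is determined by these values.\<close>

lemma pairing:
  assumes i: "i \<le> 3"
  shows pairing_bilinear: "pairing V i \<in> bilinear_maps (Ext (dual V) i) (Ext V i) ground_space"
    and pairing_wedge: "fs \<in> tuples (dual V) i \<Longrightarrow> ws \<in> tuples V i \<Longrightarrow>
      pairing V i (wedge (dual V) fs, wedge V ws) = det (mat i i (\<lambda>(p, q). (fs ! p) (ws ! q)))"
    and pairing_eq: "\<xi> \<in> carrier (Ext (dual V) i) \<Longrightarrow> x \<in> carrier (Ext V i) \<Longrightarrow>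
      pairing V i (\<xi>, x) = dot3 (D.pluecker i \<xi>) (pluecker i x)"
proof -
  note E = vspace_Ext[OF V, of i] vspace_Ext[OF D.V, of i]
  define B where "B = (\<lambda>(\<xi>, x) \<in> carrier (Ext (dual V) i) \<times> carrier (Ext V i).
    dot3 (D.pluecker i \<xi>) (pluecker i x))"
  let ?P = "\<lambda>B. B \<in> bilinear_maps (Ext (dual V) i) (Ext V i) ground_space \<and>
     (\<forall>fs \<in> tuples (dual V) i. \<forall>vs \<in> tuples V i.
        B (wedge (dual V) fs, wedge V vs) = det (mat i i (\<lambda>(p, q). (fs ! p) (vs ! q))))"
  have "B \<in> bilinear_maps (Ext (dual V) i) (Ext V i) ground_space"
    unfolding B_def
    by (rule bilinear_maps_restrictI[OF E(2,1) homs_dot3(1)[OF pluecker] homs_dot3(2)[OF D.pluecker]])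
  then have B: "?P B"
    by (simp add: B_def wedge_carrier V D.V pluecker_wedge D.pluecker_wedge dot3_wedge3[OF i])
  have "pairing V i = B"
    unfolding pairing_def
    by (rule the_equality) (use B in \<open>auto intro: Ext_bilinear_eq[OF D.V V]\<close>)
  then show "pairing V i \<in> bilinear_maps (Ext (dual V) i) (Ext V i) ground_space"
    and "fs \<in> tuples (dual V) i \<Longrightarrow> ws \<in> tuples V i \<Longrightarrow>
      pairing V i (wedge (dual V) fs, wedge V ws) = det (mat i i (\<lambda>(p, q). (fs ! p) (ws ! q)))"
    and "\<xi> \<in> carrier (Ext (dual V) i) \<Longrightarrow> x \<in> carrier (Ext V i) \<Longrightarrow>
      pairing V i (\<xi>, x) = dot3 (D.pluecker i \<xi>) (pluecker i x)"
    using B by (auto simp: B_def)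
qed

text \<open>The exterior product in Pluecker coordinates, in the degrees that occur in Zorn algebras.\<close>

definition prod3 :: "nat \<Rightarrow> nat \<Rightarrow> 'k vec3 \<Rightarrow> 'k vec3 \<Rightarrow> 'k vec3" where
  "prod3 i j x y = (if i = 0 then fst x \<odot>\<^bsub>space3\<^esub> y else if j = 1 \<and> i = 1 then cross3 x y
     else (dot3 x y, 0, 0))"

lemma pluecker_ext_prod:
  assumes ij: "i = 0 \<and> j \<le> 3 \<or> i = 1 \<and> j = 1 \<or> i = 2 \<and> j = 1"
    and x: "x \<in> carrier (Ext V i)" and y: "y \<in> carrier (Ext V j)"
  shows "pluecker (i + j) (ext_prod V i j (x, y)) = prod3 i j (pluecker i x) (pluecker j y)"
proof -
  have h1: "(\<lambda>x. prod3 i j (pluecker i x) a) \<in> homs (Ext V i) space3" for a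
    by (rule homsI) (auto simp: prod3_def homsD(2,3)[OF pluecker] vec3_simps algebra_simps)
  have h2: "(\<lambda>y. prod3 i j a (pluecker j y)) \<in> homs (Ext V j) space3" for a
    by (rule homsI) (auto simp: prod3_def homsD(2,3)[OF pluecker] vec3_simps algebra_simps)
  note B = bilinear_maps_homs[OF ext_prod(1)[OF V, of i j]]
  have on_wedges: "pluecker (i + j) (ext_prod V i j (wedge V us, wedge V ws)) =
    prod3 i j (pluecker i (wedge V us)) (pluecker j (wedge V ws))"
    if us: "us \<in> tuples V i" and ws: "ws \<in> tuples V j" for us ws
  proof -
    have "wedge3 (as @ bs) = prod3 i j (wedge3 as) (wedge3 bs)"
      if "length as = i" "length bs = j" for as bs :: "'k vec3 list"
      using that ij
      by (cases as rule: wedge3.cases; cases bs rule: wedge3.cases) (auto simp: prod3_def)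
    from this[of "map c us" "map c ws"] show ?thesis
      using us ws append_tuples[OF us ws]
      by (simp add: ext_prod(2)[OF V] pluecker_wedge) (simp add: tuples_def)
  qed
  have on_wedge: "pluecker (i + j) (ext_prod V i j (x, wedge V ws)) =
    prod3 i j (pluecker i x) (pluecker j (wedge V ws))" if ws: "ws \<in> tuples V j" for ws
    by (rule Ext_homs_eq[OF V homs_comp[OF B(2)[OF wedge_carrier[OF V ws]] pluecker] h1 on_wedges[OF _ ws] x])
  show ?thesis
    by (rule Ext_homs_eq[OF V homs_comp[OF B(1)[OF x] pluecker] h2 on_wedge y])
qed

end

text \<open>Coordinates in which the volume form is the determinant.\<close>

locale unimodular_coords = coords V c for V :: "('k::field, 'v) module" and c +
  fixes \<omega>
  assumes \<omega>: "\<omega> \<in> carrier (Ext (dual V) 3)"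
    and \<omega>_basis: "pairing V 3 (\<omega>, wedge V [e1, e2, e3]) = 1"
begin

interpretation D: coords "dual V" dual_coord by (rule coords_dual)

lemma pluecker_volume: "D.pluecker 3 \<omega> = (1, 0, 0)"
  using \<omega>_basis pairing_eq[OF _ \<omega>, of "wedge V [e1, e2, e3]"] D.pluecker_in_range[OF _ \<omega>]
  by (simp add: basis_wedge_carrier pluecker_wedge tuples_def pluecker_range_def prod_eq_iff dot3_eq)

lemma volume_eq: "x \<in> carrier (Ext V 3) \<Longrightarrow> pairing V 3 (\<omega>, x) = fst (pluecker 3 x)"
  using pairing_eq[OF _ \<omega>, of x] by (simp add: pluecker_volume dot3_eq)

lemma pluecker_range_complement: "i \<le> 3 \<Longrightarrow> pluecker_range (3 - i) = pluecker_range i"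
  by (auto simp: pluecker_range_def)

lemma dot3_wedge3_complement:
  assumes "length us + length ws = 3"
  shows "dot3 (wedge3 us) (wedge3 ws) = fst (wedge3 (us @ ws))"
  using assms
  by (cases us rule: wedge3.cases; cases ws rule: wedge3.cases) (auto simp: vec3_simps algebra_simps)

text \<open>In unimodular coordinates the star operator is the identity on Pluecker coordinates: then both sides
  of its defining equation become the dot product of the Pluecker coordinates of the two factors. The
  equation determines the operator because the dot product is nondegenerate.\<close>

lemma star:
  assumes i: "i \<le> 3"
  shows star_homs: "star V \<omega> i \<in> homs (Ext V i) (Ext (dual V) (3 - i))"
    and star_bij: "bij_betw (star V \<omega> i) (carrier (Ext V i)) (carrier (Ext (dual V) (3 - i)))"
    and pluecker_star: "x \<in> carrier (Ext V i) \<Longrightarrow> D.pluecker (3 - i) (star V \<omega> i x) = pluecker i x"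
proof -
  let ?P = "\<lambda>s. s \<in> linear_maps (Ext V i) (Ext (dual V) (3 - i)) \<and>
     bij_betw s (carrier (Ext V i)) (carrier (Ext (dual V) (3 - i))) \<and>
     (\<forall>us \<in> tuples V i. \<forall>vs \<in> tuples V (3 - i).
        pairing V (3 - i) (s (wedge V us), wedge V vs) = pairing V 3 (\<omega>, wedge V (us @ vs)))"
  define s where "s = (\<lambda>x \<in> carrier (Ext V i). D.from_pluecker (3 - i) (pluecker i x))"
  have i': "3 - i \<le> 3" by simp
  have s: "s x \<in> carrier (Ext (dual V) (3 - i))" "D.pluecker (3 - i) (s x) = pluecker i x"
    if "x \<in> carrier (Ext V i)" for x
    using that pluecker_in_range[OF i that] i
    by (simp_all add: s_def D.pluecker_from_pluecker pluecker_range_complement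
        homsD(1)[OF D.from_pluecker_homs])
  have "s \<in> linear_maps (Ext V i) (Ext (dual V) (3 - i))"
    unfolding s_def
    by (rule linear_maps_restrict[OF homs_comp[OF pluecker D.from_pluecker_homs[OF i']] vspace_Ext[OF V]])
  moreover have "bij_betw s (carrier (Ext V i)) (carrier (Ext (dual V) (3 - i)))"
  proof (rule bij_betw_byWitness[where f' = "\<lambda>\<xi>. from_pluecker i (D.pluecker (3 - i) \<xi>)"])
    show "\<forall>x\<in>carrier (Ext V i). from_pluecker i (D.pluecker (3 - i) (s x)) = x"
      by (simp add: s from_pluecker_pluecker i)
    show "\<forall>\<xi>\<in>carrier (Ext (dual V) (3 - i)). s (from_pluecker i (D.pluecker (3 - i) \<xi>)) = \<xi>"
      using D.pluecker_in_range[OF i'] i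
      by (simp add: s_def homsD(1)[OF from_pluecker_homs] pluecker_from_pluecker
          pluecker_range_complement D.from_pluecker_pluecker)
  qed (use s i in \<open>auto simp: homsD(1)[OF from_pluecker_homs]\<close>)
  moreover have "pairing V (3 - i) (s (wedge V us), wedge V ws) = pairing V 3 (\<omega>, wedge V (us @ ws))"
    if us: "us \<in> tuples V i" and ws: "ws \<in> tuples V (3 - i)" for us ws
  proof -
    have t: "us @ ws \<in> tuples V 3" using append_tuples[OF us ws] i by simp
    have "pairing V (3 - i) (s (wedge V us), wedge V ws) =
      dot3 (wedge3 (map c us)) (wedge3 (map c ws))"
      by (simp add: pairing_eq s wedge_carrier[OF V] us ws pluecker_wedge)
    also have "\<dots> = fst (wedge3 (map c (us @ ws)))"
      using us ws i by (subst dot3_wedge3_complement) (auto simp: tuples_def)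
    also have "\<dots> = pairing V 3 (\<omega>, wedge V (us @ ws))"
      by (simp add: volume_eq wedge_carrier[OF V t] pluecker_wedge[OF t])
    finally show ?thesis .
  qed
  ultimately have Ps: "?P s" by blast
  have unique: "s' = s" if s': "?P s'" for s'
  proof (rule Ext_linear_maps_eq[OF V])
    fix us assume us: "us \<in> tuples V i"
    have hom: "(\<lambda>y. dot3 (D.pluecker (3 - i) \<xi>) (pluecker (3 - i) y)) \<in> homs (Ext V (3 - i)) ground_space" for \<xi>
      by (rule homs_dot3(1)[OF pluecker])
    have car: "s' (wedge V us) \<in> carrier (Ext (dual V) (3 - i))" "s (wedge V us) \<in> carrier (Ext (dual V) (3 - i))"
      using s' Ps us by (auto intro: homsD(1)[OF linear_maps_homs] wedge_carrier[OF V])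
    have "dot3 (D.pluecker (3 - i) (s' (wedge V us))) (pluecker (3 - i) y) =
      dot3 (D.pluecker (3 - i) (s (wedge V us))) (pluecker (3 - i) y)"
      if "y \<in> carrier (Ext V (3 - i))" for y
    proof (rule Ext_homs_eq[OF V hom hom _ that])
      fix ws assume ws: "ws \<in> tuples V (3 - i)"
      have "pairing V (3 - i) (s' (wedge V us), wedge V ws) = pairing V (3 - i) (s (wedge V us), wedge V ws)"
        using s' Ps us ws by simp
      then show "dot3 (D.pluecker (3 - i) (s' (wedge V us))) (pluecker (3 - i) (wedge V ws)) =
        dot3 (D.pluecker (3 - i) (s (wedge V us))) (pluecker (3 - i) (wedge V ws))"
        using car ws by (simp add: pairing_eq wedge_carrier[OF V])
    qed
    then have dot: "dot3 (D.pluecker (3 - i) (s' (wedge V us))) a = dot3 (D.pluecker (3 - i) (s (wedge V us))) a"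
      if "a \<in> pluecker_range (3 - i)" for a
      using pluecker_from_pluecker[OF i' that] homsD(1)[OF from_pluecker_homs[OF i'], of a] by simp metis
    have "D.pluecker (3 - i) (s' (wedge V us)) = D.pluecker (3 - i) (s (wedge V us))"
      using dot[of "(1, 0, 0)"] dot[of "(0, 1, 0)"] dot[of "(0, 0, 1)"]
        D.pluecker_in_range[OF i' car(1)] D.pluecker_in_range[OF i' car(2)]
      by (auto simp: pluecker_range_def dot3_eq prod_eq_iff split: if_splits)
    then show "s' (wedge V us) = s (wedge V us)"
      by (rule D.pluecker_inj[OF i' car])
  qed (use s' Ps in auto)
  have "star V \<omega> i = s"
    unfolding star_def using Ps unique by (rule the_equality)
  then show "star V \<omega> i \<in> homs (Ext V i) (Ext (dual V) (3 - i))"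
    and "bij_betw (star V \<omega> i) (carrier (Ext V i)) (carrier (Ext (dual V) (3 - i)))"
    and "x \<in> carrier (Ext V i) \<Longrightarrow> D.pluecker (3 - i) (star V \<omega> i x) = pluecker i x"
    using Ps s(2) by (blast intro: linear_maps_homs, blast, metis)
qed

text \<open>The regressive product is the exterior product of the dual space in complementary degrees, transported
  by the star operator; as that operator does not change coordinates, the formula for the exterior product
  carries over.\<close>

lemma pluecker_regr_prod:
  assumes ij: "(i, j) \<in> {(1, 2), (3, 1), (2, 2), (3, 2), (3, 3)}"
    and x: "x \<in> carrier (Ext V i)" and y: "y \<in> carrier (Ext V j)"
  shows "regr_prod V \<omega> i j (x, y) \<in> carrier (Ext V (i + j - 3))"
    and "pluecker (i + j - 3) (regr_prod V \<omega> i j (x, y)) =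
      prod3 (3 - i) (3 - j) (pluecker i x) (pluecker j y)"
proof -
  let ?l = "i + j - 3"
  have le: "i \<le> 3" "j \<le> 3" "?l \<le> 3" and sum: "3 - i + (3 - j) = 3 - ?l" using ij by auto
  define z where "z = ext_prod (dual V) (3 - i) (3 - j) (star V \<omega> i x, star V \<omega> j y)"
  have sx: "star V \<omega> i x \<in> carrier (Ext (dual V) (3 - i))" and sy: "star V \<omega> j y \<in> carrier (Ext (dual V) (3 - j))"
    using homsD(1)[OF star_homs] le x y by auto
  have z: "z \<in> carrier (Ext (dual V) (3 - ?l))"
    using homsD(1)[OF bilinear_maps_homs(1)[OF ext_prod(1)[OF D.V] sx] sy] unfolding z_def sum .
  have "D.pluecker (3 - ?l) z = D.prod3 (3 - i) (3 - j) (pluecker i x) (pluecker j y)"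
    using D.pluecker_ext_prod[OF _ sx sy] ij le x y
    unfolding sum z_def by (auto simp: pluecker_star)
  moreover have "regr_prod V \<omega> i j (x, y) = inv_into (carrier (Ext V ?l)) (star V \<omega> ?l) z"
    by (simp add: regr_prod_def z_def)
  moreover have "inv_into (carrier (Ext V ?l)) (star V \<omega> ?l) z \<in> carrier (Ext V ?l)"
    "star V \<omega> ?l (inv_into (carrier (Ext V ?l)) (star V \<omega> ?l) z) = z"
    using star_bij[OF le(3)] z
    by (metis bij_betw_imp_surj_on inv_into_into, metis bij_betw_imp_surj_on f_inv_into_f)
  ultimately show "regr_prod V \<omega> i j (x, y) \<in> carrier (Ext V ?l)"
    and "pluecker ?l (regr_prod V \<omega> i j (x, y)) = prod3 (3 - i) (3 - j) (pluecker i x) (pluecker j y)"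
    using pluecker_star[OF le(3), of "regr_prod V \<omega> i j (x, y)"] by (simp_all add: prod3_def D.prod3_def)
qed

lemma covolume: "covolume V \<omega> = wedge V [e1, e2, e3]"
  unfolding covolume_def
proof (rule the_equality)
  fix p assume p: "p \<in> carrier (Ext V 3) \<and> pairing V 3 (\<omega>, p) = 1"
  then have "fst (pluecker 3 p) = 1" using volume_eq by metis
  moreover have "pluecker 3 p \<in> pluecker_range 3"
    using p by (intro pluecker_in_range) auto
  ultimately have "pluecker 3 p = (1, 0, 0)"
    by (cases "pluecker 3 p") (simp add: pluecker_range_def)
  then show "p = wedge V [e1, e2, e3]"
    using p by (intro pluecker_inj[of 3]) (simp_all add: basis_wedge_carrier pluecker_wedge tuples_def)
qed (simp add: \<omega>_basis basis_wedge_carrier)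

end

section \<open>Algebras and their isomorphisms\<close>

lemma is_algebraD:
  assumes "is_algebra A"
  shows "vspace A"
    and "x \<in> carrier A \<Longrightarrow> y \<in> carrier A \<Longrightarrow> x \<otimes>\<^bsub>A\<^esub> y \<in> carrier A"
    and "\<one>\<^bsub>A\<^esub> \<in> carrier A"
proof -
  show "vspace A" "\<one>\<^bsub>A\<^esub> \<in> carrier A" using assms by (auto simp: is_algebra_def)
  assume xy: "x \<in> carrier A" "y \<in> carrier A"
  have "restrict (\<lambda>(x, y). x \<otimes>\<^bsub>A\<^esub> y) (carrier A \<times> carrier A) \<in> bilinear_maps A A A"
    using assms by (simp add: is_algebra_def)
  from homsD(1)[OF bilinear_maps_homs(1)[OF this xy(1)] xy(2)] xy
  show "x \<otimes>\<^bsub>A\<^esub> y \<in> carrier A" by simp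
qed

lemma algebra_isosD:
  assumes "h \<in> algebra_isos A B"
  shows "h \<in> linear_maps A B" "h \<in> homs A B" "bij_betw h (carrier A) (carrier B)"
    "h \<one>\<^bsub>A\<^esub> = \<one>\<^bsub>B\<^esub>"
    and "x \<in> carrier A \<Longrightarrow> y \<in> carrier A \<Longrightarrow> h (x \<otimes>\<^bsub>A\<^esub> y) = h x \<otimes>\<^bsub>B\<^esub> h y"
    and "x \<in> carrier A \<Longrightarrow> h x \<in> carrier B"
    and "x \<in> carrier A \<Longrightarrow> y \<in> carrier A \<Longrightarrow> h x = h y \<longleftrightarrow> x = y"
proof -
  show bij: "bij_betw h (carrier A) (carrier B)" and "h \<in> linear_maps A B" and "h \<in> homs A B"
    and "h \<one>\<^bsub>A\<^esub> = \<one>\<^bsub>B\<^esub>"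
    and "x \<in> carrier A \<Longrightarrow> y \<in> carrier A \<Longrightarrow> h (x \<otimes>\<^bsub>A\<^esub> y) = h x \<otimes>\<^bsub>B\<^esub> h y"
    using assms by (auto simp: algebra_isos_def linear_maps_homs)
  show "x \<in> carrier A \<Longrightarrow> h x \<in> carrier B"
    using bij by (auto simp: bij_betw_def)
  show "x \<in> carrier A \<Longrightarrow> y \<in> carrier A \<Longrightarrow> h x = h y \<longleftrightarrow> x = y"
    using bij by (auto simp: bij_betw_def inj_on_def)
qed

lemma algebra_isosI:
  assumes "h \<in> linear_maps A B" "bij_betw h (carrier A) (carrier B)"
    and "\<And>x y. x \<in> carrier A \<Longrightarrow> y \<in> carrier A \<Longrightarrow> h (x \<otimes>\<^bsub>A\<^esub> y) = h x \<otimes>\<^bsub>B\<^esub> h y"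
    and "h \<one>\<^bsub>A\<^esub> = \<one>\<^bsub>B\<^esub>"
  shows "h \<in> algebra_isos A B"
  using assms by (simp add: algebra_isos_def)

lemma algebra_isos_id:
  assumes A: "is_algebra A"
  shows "(\<lambda>x \<in> carrier A. x) \<in> algebra_isos A A"
  by (rule algebra_isosI[OF linear_maps_id[OF is_algebraD(1)[OF A]]])
    (auto simp: is_algebraD[OF A] bij_betw_def inj_on_def)

lemma algebra_isos_compose:
  assumes A: "is_algebra A" and f: "f \<in> algebra_isos A B" and g: "g \<in> algebra_isos B C"
  shows "compose (carrier A) g f \<in> algebra_isos A C"
proof (rule algebra_isosI)
  show "compose (carrier A) g f \<in> linear_maps A C"
    by (rule linear_maps_compose[OF algebra_isosD(1)[OF f] algebra_isosD(1)[OF g] is_algebraD(1)[OF A]])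
  show "bij_betw (compose (carrier A) g f) (carrier A) (carrier C)"
    by (rule bij_betw_compose[OF algebra_isosD(3)[OF f] algebra_isosD(3)[OF g]])
qed (simp_all add: compose_eq is_algebraD[OF A] algebra_isosD(4-6)[OF f] algebra_isosD(4-6)[OF g])

definition iso_inv :: "('k::field, 'a) module \<Rightarrow> ('k, 'b) module \<Rightarrow> ('a \<Rightarrow> 'b) \<Rightarrow> 'b \<Rightarrow> 'a" where
  "iso_inv A B f = restrict (inv_into (carrier A) f) (carrier B)"

lemma iso_inv_eq:
  assumes f: "f \<in> algebra_isos A B"
  shows "x \<in> carrier A \<Longrightarrow> iso_inv A B f (f x) = x"
    and "y \<in> carrier B \<Longrightarrow> f (iso_inv A B f y) = y"
    and "y \<in> carrier B \<Longrightarrow> iso_inv A B f y \<in> carrier A"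
proof -
  note bij = algebra_isosD(3)[OF f]
  show "x \<in> carrier A \<Longrightarrow> iso_inv A B f (f x) = x"
    using bij algebra_isosD(6)[OF f] unfolding iso_inv_def by (simp add: bij_betw_inv_into_left)
  show "y \<in> carrier B \<Longrightarrow> f (iso_inv A B f y) = y"
    using bij unfolding iso_inv_def by (simp add: bij_betw_inv_into_right)
  show "y \<in> carrier B \<Longrightarrow> iso_inv A B f y \<in> carrier A"
    using bij bij_betw_imp_surj_on[OF bij] unfolding iso_inv_def by (auto intro: inv_into_into)
qed

lemma algebra_isos_inv:
  assumes A: "is_algebra A" and B: "vspace B" and f: "f \<in> algebra_isos A B"
  shows "iso_inv A B f \<in> algebra_isos B A"
proof (rule algebra_isosI)
  let ?g = "iso_inv A B f"
  note g = iso_inv_eq[OF f]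
  show "?g \<in> linear_maps B A"
    unfolding iso_inv_def
    by (intro linear_maps_restrict homs_inv_into algebra_isosD(2,3)[OF f] is_algebraD(1)[OF A] B)
  show "bij_betw ?g (carrier B) (carrier A)"
    by (rule bij_betw_byWitness[where f' = f]) (auto simp: g algebra_isosD(6)[OF f])
  show "?g (x \<otimes>\<^bsub>B\<^esub> y) = ?g x \<otimes>\<^bsub>A\<^esub> ?g y" if "x \<in> carrier B" "y \<in> carrier B" for x y
    using g(1)[OF is_algebraD(2)[OF A, of "?g x" "?g y"]] that
    by (simp add: g algebra_isosD(5)[OF f])
  show "?g \<one>\<^bsub>B\<^esub> = \<one>\<^bsub>A\<^esub>"
    using g(1)[OF is_algebraD(3)[OF A]] by (simp add: algebra_isosD(4)[OF f])
qed

text \<open>If a map is the identity in coordinates given by two isomorphisms, then it is the composition of one of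
  them with the inverse of the other.\<close>

lemma algebra_isos_of_coordinates:
  assumes A: "is_algebra A" and B: "is_algebra B" and O: "is_algebra O'"
    and \<theta>: "\<theta> \<in> algebra_isos A O'" and \<theta>': "\<theta>' \<in> algebra_isos B O'"
    and h: "h \<in> extensional (carrier A)" "\<And>x. x \<in> carrier A \<Longrightarrow> h x \<in> carrier B"
      "\<And>x. x \<in> carrier A \<Longrightarrow> \<theta>' (h x) = \<theta> x"
  shows "h \<in> algebra_isos A B"
proof -
  have "compose (carrier A) (iso_inv B O' \<theta>') \<theta> \<in> algebra_isos A B"
    by (rule algebra_isos_compose[OF A \<theta> algebra_isos_inv[OF B is_algebraD(1)[OF O] \<theta>']])
  moreover have "compose (carrier A) (iso_inv B O' \<theta>') \<theta> = h"
  proof (rule extensionalityI)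
    fix x assume "x \<in> carrier A"
    then show "compose (carrier A) (iso_inv B O' \<theta>') \<theta> x = h x"
      using iso_inv_eq(1)[OF \<theta>' h(2)] h(3) by (simp add: compose_eq)
  qed (use h(1) in \<open>auto simp: compose_def\<close>)
  ultimately show ?thesis by simp
qed

lemma fin_dim_surj:
  assumes V: "vspace V" and W: "vspace W" and f: "f \<in> homs V W" and surj: "f ` carrier V = carrier W"
    and fin: "vectorspace.fin_dim class_ring V"
  shows "vectorspace.fin_dim class_ring W"
proof -
  interpret V: vectorspace class_ring V by fact
  interpret W: vectorspace class_ring W by fact
  interpret linear_map class_ring V W f
    using f by unfold_locales
  show ?thesis by (rule surj_fin_dim[OF fin surj])
qed

text \<open>Bilinearity is inherited because multiplication by \<open>x\<close> on one side is the composition of \<open>h\<close>,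
  multiplication by \<open>h x\<close> and the inverse of \<open>h\<close>.\<close>

lemma is_algebra_transport:
  assumes A: "vspace A" and B: "is_algebra B" and h: "h \<in> algebra_isos A B"
    and mult: "\<And>x y. x \<in> carrier A \<Longrightarrow> y \<in> carrier A \<Longrightarrow> x \<otimes>\<^bsub>A\<^esub> y \<in> carrier A"
    and one: "\<one>\<^bsub>A\<^esub> \<in> carrier A"
  shows "is_algebra A"
proof -
  note hD = homsD[OF algebra_isosD(2)[OF h]] algebra_isosD(4,5)[OF h]
  have inj: "x = y" if "x \<in> carrier A" "y \<in> carrier A" "h x = h y" for x y
    using algebra_isosD(7)[OF h] that by blast
  let ?g = "inv_into (carrier A) h"
  have g: "?g \<in> homs B A" by (rule homs_inv_into[OF algebra_isosD(2,3)[OF h] A])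
  have mult_eq: "?g (h x \<otimes>\<^bsub>B\<^esub> h y) = x \<otimes>\<^bsub>A\<^esub> y" if "x \<in> carrier A" "y \<in> carrier A" for x y
    using bij_betw_inv_into_left[OF algebra_isosD(3)[OF h] mult[OF that]] that by (simp add: hD)
  have bil: "(\<lambda>(x, y) \<in> carrier B \<times> carrier B. x \<otimes>\<^bsub>B\<^esub> y) \<in> bilinear_maps B B B"
    using B by (simp add: is_algebra_def)
  have B_homs: "(\<lambda>y. x \<otimes>\<^bsub>B\<^esub> y) \<in> homs B B" "(\<lambda>y. y \<otimes>\<^bsub>B\<^esub> x) \<in> homs B B" if x: "x \<in> carrier B" for x
    by (rule homs_cong[OF bilinear_maps_homs(1)[OF bil x] is_algebraD(1)[OF B]], simp add: x,
        rule homs_cong[OF bilinear_maps_homs(2)[OF bil x] is_algebraD(1)[OF B]], simp add: x)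
  have A_homs: "(\<lambda>y. x \<otimes>\<^bsub>A\<^esub> y) \<in> homs A A" "(\<lambda>y. y \<otimes>\<^bsub>A\<^esub> x) \<in> homs A A" if x: "x \<in> carrier A" for x
    by (rule homs_cong[OF homs_comp[OF homs_comp[OF algebra_isosD(2)[OF h] B_homs(1)[OF hD(1)[OF x]]] g] A],
        simp add: mult_eq x,
        rule homs_cong[OF homs_comp[OF homs_comp[OF algebra_isosD(2)[OF h] B_homs(2)[OF hD(1)[OF x]]] g] A],
        simp add: mult_eq x)
  have unit: "\<one>\<^bsub>B\<^esub> \<otimes>\<^bsub>B\<^esub> x = x" "x \<otimes>\<^bsub>B\<^esub> \<one>\<^bsub>B\<^esub> = x" if "x \<in> carrier B" for x
    using B that by (auto simp: is_algebra_def)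
  have "(\<lambda>(x, y) \<in> carrier A \<times> carrier A. x \<otimes>\<^bsub>A\<^esub> y) \<in> bilinear_maps A A A"
    by (rule bilinear_maps_restrictI[OF A A A_homs])
  moreover have "vectorspace.fin_dim class_ring A"
  proof (rule fin_dim_surj[OF is_algebraD(1)[OF B] A g])
    show "?g ` carrier B = carrier A"
      using algebra_isosD(3)[OF h] by (metis bij_betw_def bij_betw_inv_into)
    show "vectorspace.fin_dim class_ring B" using B by (simp add: is_algebra_def)
  qed
  moreover have "\<one>\<^bsub>A\<^esub> \<otimes>\<^bsub>A\<^esub> x = x" "x \<otimes>\<^bsub>A\<^esub> \<one>\<^bsub>A\<^esub> = x" if "x \<in> carrier A" for x
    by (rule inj; simp add: mult one that hD unit)+
  ultimately show ?thesis
    unfolding is_algebra_def using A one by blast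
qed

section \<open>Split octonions\<close>

type_synonym 'k octonion = "'k \<times> 'k vec3 \<times> 'k vec3 \<times> 'k"

lemma octonion_simps [simp]:
  fixes x y :: "'k::field octonion"
  shows "carrier (split_octonions :: ('k, _) module) = UNIV"
    "\<zero>\<^bsub>split_octonions\<^esub> = (0 :: 'k, (0, 0, 0), (0, 0, 0), 0)"
    "\<one>\<^bsub>split_octonions\<^esub> = (1 :: 'k, (0, 0, 0), (0, 0, 0), 1)"
    "x \<oplus>\<^bsub>split_octonions\<^esub> y =
      (fst x + fst y, fst (snd x) \<oplus>\<^bsub>space3\<^esub> fst (snd y),
       fst (snd (snd x)) \<oplus>\<^bsub>space3\<^esub> fst (snd (snd y)), snd (snd (snd x)) + snd (snd (snd y)))"
    "c \<odot>\<^bsub>split_octonions\<^esub> x =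
      (c * fst x, c \<odot>\<^bsub>space3\<^esub> fst (snd x), c \<odot>\<^bsub>space3\<^esub> fst (snd (snd x)), c * snd (snd (snd x)))"
  by (simp_all add: split_octonions_def)

lemma space3_minus: "x \<ominus>\<^bsub>space3\<^esub> y = (fst x - fst y, fst (snd x) - fst (snd y), snd (snd x) - snd (snd y))"
  using vspace_simps(10)[OF vspace_space3, of x y] by simp

lemma octonion_mult [simp]:
  "(\<alpha>, (a1, a2, a3), (b1, b2, b3), \<beta>) \<otimes>\<^bsub>split_octonions\<^esub> (\<gamma>, (c1, c2, c3), (d1, d2, d3), \<delta>) =
    (\<alpha> * \<gamma> + (a1 * d1 + a2 * d2 + a3 * d3),
     (\<alpha> * c1 + \<delta> * a1 - (b2 * d3 - b3 * d2),
      \<alpha> * c2 + \<delta> * a2 - (b3 * d1 - b1 * d3),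
      \<alpha> * c3 + \<delta> * a3 - (b1 * d2 - b2 * d1)),
     (\<gamma> * b1 + \<beta> * d1 + (a2 * c3 - a3 * c2),
      \<gamma> * b2 + \<beta> * d2 + (a3 * c1 - a1 * c3),
      \<gamma> * b3 + \<beta> * d3 + (a1 * c2 - a2 * c1)),
     b1 * c1 + b2 * c2 + b3 * c3 + \<beta> * \<delta>)"
  by (simp add: split_octonions_def space3_minus)

lemma octonion_cases:
  obtains \<alpha> a1 a2 a3 b1 b2 b3 \<beta> where "x = (\<alpha>, (a1, a2, a3), (b1, b2, b3), \<beta>)"
  by (cases x) auto

lemma vspace_octonions: "vspace split_octonions"
  by (rule vspaceI) (auto simp: algebra_simps)

lemma is_algebra_octonions: "is_algebra (split_octonions :: ('k::field, _) module)"
proof -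
  let ?O = "split_octonions :: ('k, _) module"
  interpret O: vectorspace class_ring ?O by (rule vspace_octonions)
  have mult_homs: "(\<lambda>y. x \<otimes>\<^bsub>?O\<^esub> y) \<in> homs ?O ?O" "(\<lambda>y. y \<otimes>\<^bsub>?O\<^esub> x) \<in> homs ?O ?O" for x
    by (cases x rule: octonion_cases; rule homsI; auto simp: algebra_simps)+
  let ?S = "{(1, (0, 0, 0), (0, 0, 0), 0), (0, (1, 0, 0), (0, 0, 0), 0), (0, (0, 1, 0), (0, 0, 0), 0),
    (0, (0, 0, 1), (0, 0, 0), 0), (0, (0, 0, 0), (1, 0, 0), 0), (0, (0, 0, 0), (0, 1, 0), 0),
    (0, (0, 0, 0), (0, 0, 1), 0), (0, (0, 0, 0), (0, 0, 0), 1)} :: 'k octonion set"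
  have sub: "LinearCombinations.submodule class_ring (O.span ?S) ?O"
    by (rule O.span_is_submodule) simp
  have gen: "s \<in> ?S \<Longrightarrow> s \<in> O.span ?S" for s
    using O.in_own_span[of ?S] by auto
  note add = LinearCombinations.submodule.m_closed[OF sub]
  have smult: "c \<odot>\<^bsub>?O\<^esub> s \<in> O.span ?S" if "s \<in> ?S" for c s
    using LinearCombinations.submodule.smult_closed[OF sub, of c s] gen[OF that] by simp
  have "x \<in> O.span ?S" for x
  proof -
    obtain \<alpha> a1 a2 a3 b1 b2 b3 \<beta> where x: "x = (\<alpha>, (a1, a2, a3), (b1, b2, b3), \<beta>)"
      by (rule octonion_cases)
    have "\<alpha> \<odot>\<^bsub>?O\<^esub> (1, (0, 0, 0), (0, 0, 0), 0) \<oplus>\<^bsub>?O\<^esub> (a1 \<odot>\<^bsub>?O\<^esub> (0, (1, 0, 0), (0, 0, 0), 0) \<oplus>\<^bsub>?O\<^esub>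
      (a2 \<odot>\<^bsub>?O\<^esub> (0, (0, 1, 0), (0, 0, 0), 0) \<oplus>\<^bsub>?O\<^esub> (a3 \<odot>\<^bsub>?O\<^esub> (0, (0, 0, 1), (0, 0, 0), 0) \<oplus>\<^bsub>?O\<^esub>
      (b1 \<odot>\<^bsub>?O\<^esub> (0, (0, 0, 0), (1, 0, 0), 0) \<oplus>\<^bsub>?O\<^esub> (b2 \<odot>\<^bsub>?O\<^esub> (0, (0, 0, 0), (0, 1, 0), 0) \<oplus>\<^bsub>?O\<^esub>
      (b3 \<odot>\<^bsub>?O\<^esub> (0, (0, 0, 0), (0, 0, 1), 0) \<oplus>\<^bsub>?O\<^esub> \<beta> \<odot>\<^bsub>?O\<^esub> (0, (0, 0, 0), (0, 0, 0), 1))))))) \<in> O.span ?S"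
      by (intro add smult) blast+
    then show ?thesis by (simp add: x)
  qed
  then have "O.fin_dim"
    unfolding O.fin_dim_def by (intro exI[of _ ?S]) auto
  moreover have "restrict (\<lambda>(x, y). x \<otimes>\<^bsub>?O\<^esub> y) (carrier ?O \<times> carrier ?O) \<in> bilinear_maps ?O ?O ?O"
    by (rule bilinear_maps_restrictI[OF vspace_octonions vspace_octonions mult_homs])
  ultimately show ?thesis
    unfolding is_algebra_def using vspace_octonions by (auto elim!: octonion_cases)
qed

abbreviation octonion_idem :: "'k::field octonion" where
  "octonion_idem \<equiv> (0, (0, 0, 0), (0, 0, 0), 1)"

text \<open>An automorphism that fixes \<open>p = (0, 0, 0, 1)\<close> preserves the Peirce component of all \<open>x\<close> with
  \<open>p x = 0\<close> and \<open>x p = x\<close>, which consists of the elements \<open>(0, a, 0, 0)\<close>.\<close>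

lemma octonion_auto_vector_part:
  fixes g :: "'k::field octonion \<Rightarrow> _"
  assumes g: "g \<in> algebra_isos split_octonions split_octonions" and p: "g octonion_idem = octonion_idem"
  obtains M where "M \<in> homs space3 space3" "\<And>a. g (0, a, (0, 0, 0), 0) = (0, M a, (0, 0, 0), 0)"
proof -
  let ?O = "split_octonions :: ('k, _) module"
  note mult = algebra_isosD(5)[OF g, simplified]
  note hom = homsD[OF algebra_isosD(2)[OF g], simplified]
  define M where "M a = fst (snd (g (0, a, (0, 0, 0), 0)))" for a
  have M: "g (0, a, (0, 0, 0), 0) = (0, M a, (0, 0, 0), 0)" for a
  proof -
    obtain \<alpha> a1 a2 a3 b1 b2 b3 \<beta> where x: "g (0, a, (0, 0, 0), 0) = (\<alpha>, (a1, a2, a3), (b1, b2, b3), \<beta>)"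
      by (rule octonion_cases)
    obtain x1 x2 x3 where a: "a = (x1, x2, x3)" by (cases a) auto
    have "g (octonion_idem \<otimes>\<^bsub>?O\<^esub> (0, a, (0, 0, 0), 0)) = octonion_idem \<otimes>\<^bsub>?O\<^esub> g (0, a, (0, 0, 0), 0)"
      by (simp only: mult p)
    moreover have "g (0, (0, 0, 0), (0, 0, 0), 0) = (0, (0, 0, 0), (0, 0, 0), 0)"
      using homs_zero[OF algebra_isosD(2)[OF g] vspace_octonions vspace_octonions] by simp
    moreover have "g ((0, a, (0, 0, 0), 0) \<otimes>\<^bsub>?O\<^esub> octonion_idem) = g (0, a, (0, 0, 0), 0) \<otimes>\<^bsub>?O\<^esub> octonion_idem"
      by (simp only: mult p)
    ultimately show ?thesis using x by (simp add: a M_def)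
  qed
  have "M \<in> homs space3 space3"
  proof (rule homsI)
    fix a b show "M (a \<oplus>\<^bsub>space3\<^esub> b) = M a \<oplus>\<^bsub>space3\<^esub> M b"
      using homsD(2)[OF algebra_isosD(2)[OF g], of "(0, a, (0, 0, 0), 0)" "(0, b, (0, 0, 0), 0)"] M
      by simp
  next
    fix c a show "M (c \<odot>\<^bsub>space3\<^esub> a) = c \<odot>\<^bsub>space3\<^esub> M a"
      using homsD(3)[OF algebra_isosD(2)[OF g], of "(0, a, (0, 0, 0), 0)" c] M by simp
  qed simp
  then show thesis using that M by blast
qed

text \<open>The unit, the idempotent and the elements \<open>(0, a, 0, 0)\<close> generate the split octonions, because products
  of two elements of the latter kind give the cross products in the lower left entry.\<close>

lemma octonion_auto_eqI:
  fixes g :: "'k::field octonion \<Rightarrow> _"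
  assumes g: "g \<in> algebra_isos split_octonions split_octonions" "g octonion_idem = octonion_idem"
    and h: "h \<in> algebra_isos split_octonions split_octonions" "h octonion_idem = octonion_idem"
    and eq: "\<And>a. g (0, a, (0, 0, 0), 0) = h (0, a, (0, 0, 0), 0)"
  shows "g = h"
proof
  fix x :: "'k octonion"
  let ?O = "split_octonions :: ('k, _) module"
  obtain \<alpha> a1 a2 a3 b1 b2 b3 \<beta> where x: "x = (\<alpha>, (a1, a2, a3), (b1, b2, b3), \<beta>)"
    by (rule octonion_cases)
  have "f x = (\<alpha> \<odot>\<^bsub>?O\<^esub> \<one>\<^bsub>?O\<^esub> \<oplus>\<^bsub>?O\<^esub> (\<beta> - \<alpha>) \<odot>\<^bsub>?O\<^esub> octonion_idem) \<oplus>\<^bsub>?O\<^esub> (f (0, (a1, a2, a3), (0, 0, 0), 0) \<oplus>\<^bsub>?O\<^esub>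
     (f (0, (0, b1, 0), (0, 0, 0), 0) \<otimes>\<^bsub>?O\<^esub> f (0, (0, 0, 1), (0, 0, 0), 0) \<oplus>\<^bsub>?O\<^esub>
     (f (0, (0, 0, b2), (0, 0, 0), 0) \<otimes>\<^bsub>?O\<^esub> f (0, (1, 0, 0), (0, 0, 0), 0) \<oplus>\<^bsub>?O\<^esub>
      f (0, (b3, 0, 0), (0, 0, 0), 0) \<otimes>\<^bsub>?O\<^esub> f (0, (0, 1, 0), (0, 0, 0), 0))))"
    if f: "f \<in> algebra_isos ?O ?O" "f octonion_idem = octonion_idem" for f
  proof -
    have x': "x = (\<alpha> \<odot>\<^bsub>?O\<^esub> \<one>\<^bsub>?O\<^esub> \<oplus>\<^bsub>?O\<^esub> (\<beta> - \<alpha>) \<odot>\<^bsub>?O\<^esub> octonion_idem) \<oplus>\<^bsub>?O\<^esub> ((0, (a1, a2, a3), (0, 0, 0), 0) \<oplus>\<^bsub>?O\<^esub>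
     ((0, (0, b1, 0), (0, 0, 0), 0) \<otimes>\<^bsub>?O\<^esub> (0, (0, 0, 1), (0, 0, 0), 0) \<oplus>\<^bsub>?O\<^esub>
     ((0, (0, 0, b2), (0, 0, 0), 0) \<otimes>\<^bsub>?O\<^esub> (0, (1, 0, 0), (0, 0, 0), 0) \<oplus>\<^bsub>?O\<^esub>
      (0, (b3, 0, 0), (0, 0, 0), 0) \<otimes>\<^bsub>?O\<^esub> (0, (0, 1, 0), (0, 0, 0), 0))))"
      by (simp add: x)
    show ?thesis
      by (subst x') (simp only: homsD(2,3)[OF algebra_isosD(2)[OF f(1)]] algebra_isosD(4,5)[OF f(1)]
          f(2) octonion_simps(1) UNIV_I)
  qed
  from this[OF g] this[OF h] show "g x = h x" by (simp only: eq)
qed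

text \<open>The exchange of rows and columns comes with minus signs because the two cross products in the
  multiplication have opposite signs.\<close>

definition octonion_swap ::
  "'k::field octonion \<Rightarrow> 'k octonion" where
  "octonion_swap = (\<lambda>(\<alpha>, (a1, a2, a3), (b1, b2, b3), \<beta>). (\<beta>, (- b1, - b2, - b3), (- a1, - a2, - a3), \<alpha>))"

text \<open>The shear by \<open>c\<close> takes the idempotent \<open>(0, 0, 0, 1)\<close> to the idempotent \<open>q = (0, c, 0, 1)\<close>. The formula is
  found from the Peirce decomposition of \<open>q\<close>: the elements \<open>x\<close> with \<open>q x = 0\<close> and \<open>x q = x\<close> are
  \<open>(0, a, a \<times> c, 0)\<close>, and those with \<open>q x = x\<close> and \<open>x q = 0\<close> are \<open>(t, -t c, b, -t)\<close> with \<open>t = b \<cdot> c\<close>.\<close>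

definition octonion_shear ::
  "'k::field \<Rightarrow> 'k \<Rightarrow> 'k \<Rightarrow> 'k octonion \<Rightarrow> 'k octonion" where
  "octonion_shear c1 c2 c3 = (\<lambda>(\<alpha>, (a1, a2, a3), (b1, b2, b3), \<beta>).
     let t = b1 * c1 + b2 * c2 + b3 * c3 in
     (\<alpha> + t, (a1 + (\<beta> - \<alpha> - t) * c1, a2 + (\<beta> - \<alpha> - t) * c2, a3 + (\<beta> - \<alpha> - t) * c3),
      (b1 + (a2 * c3 - a3 * c2), b2 + (a3 * c1 - a1 * c3), b3 + (a1 * c2 - a2 * c1)), \<beta> - t))"

lemma octonion_swap_auto: "octonion_swap \<in> algebra_isos split_octonions split_octonions"
proof (rule algebra_isosI)
  show "octonion_swap \<in> linear_maps split_octonions split_octonions"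
    unfolding linear_maps_def by (intro IntI homsI) (auto simp: octonion_swap_def extensional_def)
  show "bij_betw octonion_swap (carrier split_octonions) (carrier split_octonions)"
    by (rule bij_betw_byWitness[where f' = octonion_swap]) (auto simp: octonion_swap_def)
  show "octonion_swap (x \<otimes>\<^bsub>split_octonions\<^esub> y) = octonion_swap x \<otimes>\<^bsub>split_octonions\<^esub> octonion_swap y" for x y :: "'a octonion"
    by (cases x rule: octonion_cases; cases y rule: octonion_cases) (simp add: octonion_swap_def algebra_simps)
qed (simp add: octonion_swap_def)

lemma octonion_shear_auto: "octonion_shear c1 c2 c3 \<in> algebra_isos split_octonions split_octonions"
proof (rule algebra_isosI)
  show "octonion_shear c1 c2 c3 \<in> linear_maps split_octonions split_octonions"
    unfolding linear_maps_def
    by (intro IntI homsI) (auto simp: octonion_shear_def extensional_def Let_def algebra_simps)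
  show "bij_betw (octonion_shear c1 c2 c3) (carrier split_octonions) (carrier split_octonions)"
    by (rule bij_betw_byWitness[where f' = "octonion_shear (- c1) (- c2) (- c3)"])
      (auto simp: octonion_shear_def Let_def algebra_simps)
  fix x y :: "'a octonion"
  obtain \<alpha> a1 a2 a3 b1 b2 b3 \<beta> where x: "x = (\<alpha>, (a1, a2, a3), (b1, b2, b3), \<beta>)"
    by (rule octonion_cases)
  obtain \<gamma> u1 u2 u3 v1 v2 v3 \<delta> where y: "y = (\<gamma>, (u1, u2, u3), (v1, v2, v3), \<delta>)"
    by (rule octonion_cases)
  show "octonion_shear c1 c2 c3 (x \<otimes>\<^bsub>split_octonions\<^esub> y) =
    octonion_shear c1 c2 c3 x \<otimes>\<^bsub>split_octonions\<^esub> octonion_shear c1 c2 c3 y"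
    unfolding x y octonion_shear_def Let_def octonion_mult prod.case prod.inject
    by (intro conjI; simp add: algebra_simps)
qed (simp add: octonion_shear_def)

text \<open>The split octonion with entries \<open>\<alpha>, a, b, \<beta>\<close> is a nontrivial idempotent only if \<open>\<alpha> + \<beta> = 1\<close> and
  \<open>a \<cdot> b = \<alpha> \<beta>\<close>. If \<open>b \<noteq> 0\<close>, the shear by a vector \<open>c\<close> with \<open>b \<cdot> c = -\<alpha>\<close> achieves \<open>\<alpha> = 0\<close>; if \<open>b = 0\<close>, then
  \<open>\<alpha>\<close> is \<open>0\<close> or \<open>1\<close>. In the case \<open>\<alpha> = 0\<close> the shear by \<open>-a\<close> removes \<open>a\<close>, and exchanging rows and columns leads to
  the case \<open>\<alpha> = 1\<close>, \<open>b = 0\<close>. There the shear by \<open>a\<close> gives \<open>(1, 0, 0, 0)\<close>, which the exchange takes to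
  \<open>(0, 0, 0, 1)\<close>.\<close>

lemma octonion_idempotent_normal_form:
  fixes q :: "'k::field octonion"
  assumes "q \<in> nontrivial_idempotents split_octonions"
  shows "\<exists>g \<in> algebra_isos split_octonions split_octonions. g q = octonion_idem"
proof -
  let ?O = "split_octonions :: ('k, _) module"
  define good where "good x \<longleftrightarrow> (\<exists>g \<in> algebra_isos ?O ?O. g x = octonion_idem)" for x
  have comp: "good x" if g: "g \<in> algebra_isos ?O ?O" and gx: "good (g x)" for g x
  proof -
    obtain h where h: "h \<in> algebra_isos ?O ?O" "h (g x) = octonion_idem"
      using gx by (auto simp: good_def)
    have "compose (carrier ?O) h g \<in> algebra_isos ?O ?O"
      by (rule algebra_isos_compose[OF is_algebra_octonions g h(1)])
    then show ?thesis using h(2) unfolding good_def by (intro bexI) (auto simp: compose_def)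
  qed
  have "(\<lambda>x \<in> carrier ?O. x) \<in> algebra_isos ?O ?O" by (rule algebra_isos_id[OF is_algebra_octonions])
  then have good_idem: "good octonion_idem" unfolding good_def by (intro bexI) auto
  have upper1: "good (1, (a1, a2, a3), (0, 0, 0), 0)" for a1 a2 a3
    by (rule comp[OF octonion_shear_auto[of a1 a2 a3]], rule comp[OF octonion_swap_auto])
      (simp add: octonion_shear_def octonion_swap_def good_idem)
  have lower: "good (0, (0, 0, 0), (b1, b2, b3), 1)" for b1 b2 b3
    by (rule comp[OF octonion_swap_auto]) (simp add: octonion_swap_def upper1)
  have first0: "good (0, (a1, a2, a3), (b1, b2, b3), 1)" if "a1 * b1 + a2 * b2 + a3 * b3 = 0"
    for a1 a2 a3 b1 b2 b3
  proof (rule comp[OF octonion_shear_auto[of "- a1" "- a2" "- a3"]])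
    have "b1 * - a1 + b2 * - a2 + b3 * - a3 = - (a1 * b1 + a2 * b2 + a3 * b3)"
      by (simp add: algebra_simps)
    also have "\<dots> = 0" using that by simp
    finally have t: "b1 * - a1 + b2 * - a2 + b3 * - a3 = 0" .
    have "octonion_shear (- a1) (- a2) (- a3) (0, (a1, a2, a3), (b1, b2, b3), 1) =
      (0, (0, 0, 0), (b1, b2, b3), 1)"
      unfolding octonion_shear_def prod.case Let_def t by simp
    then show "good (octonion_shear (- a1) (- a2) (- a3) (0, (a1, a2, a3), (b1, b2, b3), 1))"
      using lower by simp
  qed
  obtain \<alpha> a1 a2 a3 b1 b2 b3 \<beta> where q: "q = (\<alpha>, (a1, a2, a3), (b1, b2, b3), \<beta>)"
    by (rule octonion_cases)
  have idem: "\<alpha> * \<alpha> + (a1 * b1 + a2 * b2 + a3 * b3) = \<alpha>" "\<alpha> * a1 + \<beta> * a1 = a1" "\<alpha> * a2 + \<beta> * a2 = a2"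
    "\<alpha> * a3 + \<beta> * a3 = a3" "\<alpha> * b1 + \<beta> * b1 = b1" "\<alpha> * b2 + \<beta> * b2 = b2" "\<alpha> * b3 + \<beta> * b3 = b3"
    "b1 * a1 + b2 * a2 + b3 * a3 + \<beta> * \<beta> = \<beta>"
    and nontriv: "q \<noteq> (0, (0, 0, 0), (0, 0, 0), 0)" "q \<noteq> (1, (0, 0, 0), (0, 0, 0), 1)"
    using assms by (auto simp: nontrivial_idempotents_def q algebra_simps)
  have trace: "\<alpha> + \<beta> = 1"
  proof (rule ccontr)
    assume ne: "\<alpha> + \<beta> \<noteq> 1"
    have "x = 0" if "\<alpha> * x + \<beta> * x = x" for x
    proof -
      have "(\<alpha> + \<beta> - 1) * x = 0" using that by (simp add: algebra_simps)
      then show ?thesis using ne by simp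
    qed
    then have "a1 = 0" "a2 = 0" "a3 = 0" "b1 = 0" "b2 = 0" "b3 = 0" using idem by blast+
    moreover from this idem have "\<alpha> * (\<alpha> - 1) = 0" "\<beta> * (\<beta> - 1) = 0" by (simp_all add: algebra_simps)
    ultimately show False using ne nontriv by (auto simp: q)
  qed
  then have \<beta>: "\<beta> = 1 - \<alpha>" by (simp add: algebra_simps)
  have "good q"
  proof (cases "b1 = 0 \<and> b2 = 0 \<and> b3 = 0")
    case True
    then have "\<alpha> * (\<alpha> - 1) = 0" using idem(1) by (simp add: algebra_simps)
    then have "\<alpha> = 0 \<or> \<alpha> = 1" by simp
    then show ?thesis
      using True upper1 first0[of a1 0 a2 0 a3 0] by (auto simp: q \<beta>)
  next
    case False
    then consider "b1 \<noteq> 0" | "b2 \<noteq> 0" | "b3 \<noteq> 0" by blast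
    then have "\<exists>c1 c2 c3. b1 * c1 + b2 * c2 + b3 * c3 = - \<alpha>"
    proof cases
      case 1
      then show ?thesis by (intro exI[of _ "- \<alpha> / b1"] exI[of _ 0]) simp
    next
      case 2
      then show ?thesis by (intro exI[of _ 0] exI[of _ "- \<alpha> / b2"] exI[of _ 0]) simp
    next
      case 3
      then show ?thesis by (intro exI[of _ 0] exI[of _ 0] exI[of _ "- \<alpha> / b3"]) simp
    qed
    then obtain c1 c2 c3 where c: "b1 * c1 + b2 * c2 + b3 * c3 = - \<alpha>" by blast
    show ?thesis
    proof (rule comp[OF octonion_shear_auto[of c1 c2 c3]])
      have "(a1 + \<beta> * c1) * (b1 + (a2 * c3 - a3 * c2)) + (a2 + \<beta> * c2) * (b2 + (a3 * c1 - a1 * c3))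
        + (a3 + \<beta> * c3) * (b3 + (a1 * c2 - a2 * c1)) =
        (a1 * b1 + a2 * b2 + a3 * b3) + \<beta> * (b1 * c1 + b2 * c2 + b3 * c3)"
        by (simp add: algebra_simps)
      also have "\<dots> = (\<alpha> - \<alpha> * \<alpha>) + \<beta> * (- \<alpha>)"
        using idem(1) unfolding c by (simp add: algebra_simps)
      also have "\<dots> = 0" by (simp add: \<beta> algebra_simps)
      finally have orth: "(a1 + \<beta> * c1) * (b1 + (a2 * c3 - a3 * c2)) +
        (a2 + \<beta> * c2) * (b2 + (a3 * c1 - a1 * c3)) + (a3 + \<beta> * c3) * (b3 + (a1 * c2 - a2 * c1)) = 0" .
      have "octonion_shear c1 c2 c3 q = (0, (a1 + \<beta> * c1, a2 + \<beta> * c2, a3 + \<beta> * c3),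
        (b1 + (a2 * c3 - a3 * c2), b2 + (a3 * c1 - a1 * c3), b3 + (a1 * c2 - a2 * c1)), 1)"
        unfolding q octonion_shear_def prod.case Let_def c by (simp add: \<beta>)
      then show "good (octonion_shear c1 c2 c3 q)"
        using first0[OF orth] by simp
    qed
  qed
  then show ?thesis by (simp add: good_def)
qed

section \<open>Zorn algebras in coordinates\<close>

lemma Zorn_carrier:
  "carrier (Zorn V \<omega>) = carrier (Ext V 0) \<times> carrier (Ext V 1) \<times> carrier (Ext V 2) \<times> carrier (Ext V 3)"
  by (simp add: Zorn_def)

lemma vspace_Zorn: "vspace V \<Longrightarrow> vspace (Zorn V \<omega>)"
proof -
  assume V: "vspace V"
  let ?D = "direct_sum (Ext V 0) (direct_sum (Ext V 1) (direct_sum (Ext V 2) (Ext V 3)))"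
  have D: "vspace ?D" by (intro direct_sum_is_vs vspace_Ext[OF V])
  have "carrier (Zorn V \<omega>) = carrier ?D" "\<zero>\<^bsub>Zorn V \<omega>\<^esub> = \<zero>\<^bsub>?D\<^esub>"
    "add (Zorn V \<omega>) = add ?D" "smult (Zorn V \<omega>) = smult ?D"
    by (simp_all add: Zorn_def)
  note eq = this
  show ?thesis
    by (rule vspaceI; unfold eq; rule vspace_simps[OF D] vspace_distrib[OF D] vspace_distrib(3)[OF D, symmetric] vspace_add_ac(1,2)[OF D]; assumption)
qed

context unimodular_coords
begin

definition zorn_coord :: "('k, 'v) zorn \<Rightarrow> 'k octonion" where
  "zorn_coord = (\<lambda>(\<alpha>, a, a', \<alpha>') \<in> carrier (Zorn V \<omega>).
     (fst (pluecker 0 \<alpha>), pluecker 1 a, pluecker 2 a', fst (pluecker 3 \<alpha>')))"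

lemma scalar_pluecker:
  "x \<in> carrier (Ext V 0) \<Longrightarrow> pluecker 0 x = (fst (pluecker 0 x), 0, 0)"
  "x \<in> carrier (Ext V 3) \<Longrightarrow> pluecker 3 x = (fst (pluecker 3 x), 0, 0)"
  using pluecker_in_range[of 0 x] pluecker_in_range[of 3 x]
  by (simp_all add: pluecker_range_def prod_eq_iff)

lemma ext_prod_closed:
  "x \<in> carrier (Ext V i) \<Longrightarrow> y \<in> carrier (Ext V j) \<Longrightarrow> i + j = l \<Longrightarrow> ext_prod V i j (x, y) \<in> carrier (Ext V l)"
  using homsD(1)[OF bilinear_maps_homs(1)[OF ext_prod(1)[OF V]]] by blast

text \<open>In unimodular coordinates, the summands of the Zorn product are the entries of the octonion
  product.\<close>

lemma Zorn_summands:
  assumes "\<alpha> \<in> carrier (Ext V 0)" "a \<in> carrier (Ext V 1)" "a' \<in> carrier (Ext V 2)" "\<alpha>' \<in> carrier (Ext V 3)"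
    "\<beta> \<in> carrier (Ext V 0)" "b \<in> carrier (Ext V 1)" "b' \<in> carrier (Ext V 2)" "\<beta>' \<in> carrier (Ext V 3)"
  shows "ext_prod V 0 0 (\<alpha>, \<beta>) \<in> carrier (Ext V 0)"
    "pluecker 0 (ext_prod V 0 0 (\<alpha>, \<beta>)) = (fst (pluecker 0 \<alpha>) * fst (pluecker 0 \<beta>), 0, 0)"
    "regr_prod V \<omega> 1 2 (a, b') \<in> carrier (Ext V 0)"
    "pluecker 0 (regr_prod V \<omega> 1 2 (a, b')) = (dot3 (pluecker 1 a) (pluecker 2 b'), 0, 0)"
    "ext_prod V 0 1 (\<alpha>, b) \<in> carrier (Ext V 1)"
    "pluecker 1 (ext_prod V 0 1 (\<alpha>, b)) = fst (pluecker 0 \<alpha>) \<odot>\<^bsub>space3\<^esub> pluecker 1 b"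
    "regr_prod V \<omega> 3 1 (\<beta>', a) \<in> carrier (Ext V 1)"
    "pluecker 1 (regr_prod V \<omega> 3 1 (\<beta>', a)) = fst (pluecker 3 \<beta>') \<odot>\<^bsub>space3\<^esub> pluecker 1 a"
    "regr_prod V \<omega> 2 2 (a', b') \<in> carrier (Ext V 1)"
    "pluecker 1 (regr_prod V \<omega> 2 2 (a', b')) = cross3 (pluecker 2 a') (pluecker 2 b')"
    "regr_prod V \<omega> 3 2 (\<alpha>', b') \<in> carrier (Ext V 2)"
    "pluecker 2 (regr_prod V \<omega> 3 2 (\<alpha>', b')) = fst (pluecker 3 \<alpha>') \<odot>\<^bsub>space3\<^esub> pluecker 2 b'"
    "ext_prod V 0 2 (\<beta>, a') \<in> carrier (Ext V 2)"
    "pluecker 2 (ext_prod V 0 2 (\<beta>, a')) = fst (pluecker 0 \<beta>) \<odot>\<^bsub>space3\<^esub> pluecker 2 a'"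
    "ext_prod V 1 1 (a, b) \<in> carrier (Ext V 2)"
    "pluecker 2 (ext_prod V 1 1 (a, b)) = cross3 (pluecker 1 a) (pluecker 1 b)"
    "regr_prod V \<omega> 3 3 (\<alpha>', \<beta>') \<in> carrier (Ext V 3)"
    "pluecker 3 (regr_prod V \<omega> 3 3 (\<alpha>', \<beta>')) = (fst (pluecker 3 \<alpha>') * fst (pluecker 3 \<beta>'), 0, 0)"
    "ext_prod V 2 1 (a', b) \<in> carrier (Ext V 3)"
    "pluecker 3 (ext_prod V 2 1 (a', b)) = (dot3 (pluecker 2 a') (pluecker 1 b), 0, 0)"
proof -
  show "ext_prod V 0 0 (\<alpha>, \<beta>) \<in> carrier (Ext V 0)" "ext_prod V 0 1 (\<alpha>, b) \<in> carrier (Ext V 1)"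
    "ext_prod V 0 2 (\<beta>, a') \<in> carrier (Ext V 2)" "ext_prod V 1 1 (a, b) \<in> carrier (Ext V 2)"
    "ext_prod V 2 1 (a', b) \<in> carrier (Ext V 3)"
    by (rule ext_prod_closed, fact, fact, simp)+
  show "pluecker 0 (ext_prod V 0 0 (\<alpha>, \<beta>)) = (fst (pluecker 0 \<alpha>) * fst (pluecker 0 \<beta>), 0, 0)"
    using pluecker_ext_prod[of 0 0 \<alpha> \<beta>] scalar_pluecker(1)[OF assms(5)] assms
    by (simp add: prod3_def) (metis fst_conv mult_zero_right snd_conv)
  show "pluecker 1 (ext_prod V 0 1 (\<alpha>, b)) = fst (pluecker 0 \<alpha>) \<odot>\<^bsub>space3\<^esub> pluecker 1 b"
    using pluecker_ext_prod[of 0 1 \<alpha> b] assms by (simp add: prod3_def)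
  show "pluecker 2 (ext_prod V 0 2 (\<beta>, a')) = fst (pluecker 0 \<beta>) \<odot>\<^bsub>space3\<^esub> pluecker 2 a'"
    using pluecker_ext_prod[of 0 2 \<beta> a'] assms by (simp add: prod3_def numeral_2_eq_2)
  show "pluecker 2 (ext_prod V 1 1 (a, b)) = cross3 (pluecker 1 a) (pluecker 1 b)"
    using pluecker_ext_prod[of 1 1 a b] assms by (simp add: prod3_def numeral_2_eq_2)
  show "pluecker 3 (ext_prod V 2 1 (a', b)) = (dot3 (pluecker 2 a') (pluecker 1 b), 0, 0)"
    using pluecker_ext_prod[of 2 1 a' b] assms by (simp add: prod3_def numeral_3_eq_3)
  show "regr_prod V \<omega> 1 2 (a, b') \<in> carrier (Ext V 0)"
    "pluecker 0 (regr_prod V \<omega> 1 2 (a, b')) = (dot3 (pluecker 1 a) (pluecker 2 b'), 0, 0)"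
    using pluecker_regr_prod[of 1 2 a b'] assms by (simp_all add: prod3_def)
  show "regr_prod V \<omega> 3 1 (\<beta>', a) \<in> carrier (Ext V 1)"
    "pluecker 1 (regr_prod V \<omega> 3 1 (\<beta>', a)) = fst (pluecker 3 \<beta>') \<odot>\<^bsub>space3\<^esub> pluecker 1 a"
    using pluecker_regr_prod[of 3 1 \<beta>' a] assms by (simp_all add: prod3_def)
  show "regr_prod V \<omega> 2 2 (a', b') \<in> carrier (Ext V 1)"
    "pluecker 1 (regr_prod V \<omega> 2 2 (a', b')) = cross3 (pluecker 2 a') (pluecker 2 b')"
    using pluecker_regr_prod[of 2 2 a' b'] assms by (simp_all add: prod3_def)
  show "regr_prod V \<omega> 3 2 (\<alpha>', b') \<in> carrier (Ext V 2)"
    "pluecker 2 (regr_prod V \<omega> 3 2 (\<alpha>', b')) = fst (pluecker 3 \<alpha>') \<odot>\<^bsub>space3\<^esub> pluecker 2 b'"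
    using pluecker_regr_prod[of 3 2 \<alpha>' b'] assms by (simp_all add: prod3_def)
  show "regr_prod V \<omega> 3 3 (\<alpha>', \<beta>') \<in> carrier (Ext V 3)"
    "pluecker 3 (regr_prod V \<omega> 3 3 (\<alpha>', \<beta>')) = (fst (pluecker 3 \<alpha>') * fst (pluecker 3 \<beta>'), 0, 0)"
    using pluecker_regr_prod[of 3 3 \<alpha>' \<beta>'] assms scalar_pluecker(2)[OF assms(8)]
    by (simp_all add: prod3_def) (metis fst_conv mult_zero_right snd_conv)
qed

lemma Zorn_mult_closed:
  assumes "x \<in> carrier (Zorn V \<omega>)" "y \<in> carrier (Zorn V \<omega>)"
  shows "x \<otimes>\<^bsub>Zorn V \<omega>\<^esub> y \<in> carrier (Zorn V \<omega>)"
proof -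
  note E = vspace_Ext[OF V]
  obtain \<alpha> a a' \<alpha>' where x: "x = (\<alpha>, a, a', \<alpha>')" by (cases x) auto
  obtain \<beta> b b' \<beta>' where y: "y = (\<beta>, b, b', \<beta>')" by (cases y) auto
  have c: "\<alpha> \<in> carrier (Ext V 0)" "a \<in> carrier (Ext V 1)" "a' \<in> carrier (Ext V 2)" "\<alpha>' \<in> carrier (Ext V 3)"
    "\<beta> \<in> carrier (Ext V 0)" "b \<in> carrier (Ext V 1)" "b' \<in> carrier (Ext V 2)" "\<beta>' \<in> carrier (Ext V 3)"
    using assms by (auto simp: x y Zorn_carrier)
  show ?thesis
    unfolding x y Zorn_carrier using Zorn_summands[OF c]
    by (simp add: Zorn_def vspace_simps(2,3)[OF E] vspace_simps(10)[OF E])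
qed

lemma zorn_coord_mult:
  assumes "x \<in> carrier (Zorn V \<omega>)" "y \<in> carrier (Zorn V \<omega>)"
  shows "zorn_coord (x \<otimes>\<^bsub>Zorn V \<omega>\<^esub> y) = zorn_coord x \<otimes>\<^bsub>split_octonions\<^esub> zorn_coord y"
proof -
  note E = vspace_Ext[OF V]
  obtain \<alpha> a a' \<alpha>' where x: "x = (\<alpha>, a, a', \<alpha>')" by (cases x) auto
  obtain \<beta> b b' \<beta>' where y: "y = (\<beta>, b, b', \<beta>')" by (cases y) auto
  have c: "\<alpha> \<in> carrier (Ext V 0)" "a \<in> carrier (Ext V 1)" "a' \<in> carrier (Ext V 2)" "\<alpha>' \<in> carrier (Ext V 3)"
    "\<beta> \<in> carrier (Ext V 0)" "b \<in> carrier (Ext V 1)" "b' \<in> carrier (Ext V 2)" "\<beta>' \<in> carrier (Ext V 3)"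
    using assms by (auto simp: x y Zorn_carrier)
  note S = Zorn_summands[OF c]
  have "zorn_coord (x \<otimes>\<^bsub>Zorn V \<omega>\<^esub> y) = (case x \<otimes>\<^bsub>Zorn V \<omega>\<^esub> y of (\<alpha>, a, a', \<alpha>') \<Rightarrow>
     (fst (pluecker 0 \<alpha>), pluecker 1 a, pluecker 2 a', fst (pluecker 3 \<alpha>')))"
    using Zorn_mult_closed[OF assms] by (simp add: zorn_coord_def)
  also have "\<dots> = (fst (pluecker 0 \<alpha>), pluecker 1 a, pluecker 2 a', fst (pluecker 3 \<alpha>')) \<otimes>\<^bsub>split_octonions\<^esub>
    (fst (pluecker 0 \<beta>), pluecker 1 b, pluecker 2 b', fst (pluecker 3 \<beta>'))"
    unfolding x y
    by (simp add: Zorn_def split_octonions_def S vspace_simps(2,3,10)[OF E] vspace_simps(10)[OF vspace_space3]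
        homsD(2,3)[OF pluecker] del: One_nat_def)
  also have "\<dots> = zorn_coord x \<otimes>\<^bsub>split_octonions\<^esub> zorn_coord y"
    using assms by (simp add: zorn_coord_def x y)
  finally show ?thesis .
qed

lemma zorn_coord_one: "\<one>\<^bsub>Zorn V \<omega>\<^esub> \<in> carrier (Zorn V \<omega>)" "zorn_coord \<one>\<^bsub>Zorn V \<omega>\<^esub> = \<one>\<^bsub>split_octonions\<^esub>"
  and zorn_coord_idem: "Zorn_idempotent V \<omega> \<in> carrier (Zorn V \<omega>)"
    "zorn_coord (Zorn_idempotent V \<omega>) = octonion_idem"
proof -
  note E = vspace_Ext[OF V]
  show 1: "\<one>\<^bsub>Zorn V \<omega>\<^esub> \<in> carrier (Zorn V \<omega>)"
    by (simp add: Zorn_def vspace_simps(1)[OF E] basis_wedge_carrier covolume)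
  show 2: "Zorn_idempotent V \<omega> \<in> carrier (Zorn V \<omega>)"
    by (simp add: Zorn_carrier Zorn_idempotent_def vspace_simps(1)[OF E] basis_wedge_carrier covolume)
  have zero: "pluecker i \<zero>\<^bsub>Ext V i\<^esub> = (0, 0, 0)" for i
    using homs_zero[OF pluecker E vspace_space3] by simp
  have w: "pluecker 0 (wedge V []) = (1, 0, 0)" "pluecker 3 (wedge V [e1, e2, e3]) = (1, 0, 0)"
    by (simp_all add: pluecker_wedge tuples_def)
  show "zorn_coord \<one>\<^bsub>Zorn V \<omega>\<^esub> = \<one>\<^bsub>split_octonions\<^esub>"
    using 1 unfolding zorn_coord_def by (simp add: Zorn_def covolume zero w zero[of "Suc 0", simplified])
  show "zorn_coord (Zorn_idempotent V \<omega>) = octonion_idem"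
    using 2 unfolding zorn_coord_def by (simp add: Zorn_idempotent_def covolume zero w zero[of "Suc 0", simplified])
qed

lemma zorn_coord_iso: "zorn_coord \<in> algebra_isos (Zorn V \<omega>) split_octonions"
proof (rule algebra_isosI)
  note E = vspace_Ext[OF V]
  let ?Z = "Zorn V \<omega>"
  have car: "carrier ?Z = carrier (Ext V 0) \<times> carrier (Ext V (Suc 0)) \<times> carrier (Ext V 2) \<times> carrier (Ext V 3)"
    by (simp add: Zorn_carrier)
  have "(\<lambda>(\<alpha>, a, a', \<alpha>'). (fst (pluecker 0 \<alpha>), pluecker 1 a, pluecker 2 a', fst (pluecker 3 \<alpha>')))
    \<in> homs ?Z split_octonions"
    by (rule homsI) (auto simp: car Zorn_def homsD(2,3)[OF pluecker])
  then show "zorn_coord \<in> linear_maps ?Z split_octonions"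
    unfolding zorn_coord_def by (rule linear_maps_restrict[OF _ vspace_Zorn[OF V]])
  let ?inv = "\<lambda>(\<alpha>, a, a', \<alpha>'). (from_pluecker 0 (\<alpha>, 0, 0), from_pluecker 1 a, from_pluecker 2 a',
    from_pluecker 3 (\<alpha>', 0, 0))"
  show "bij_betw zorn_coord (carrier ?Z) (carrier split_octonions)"
  proof (rule bij_betw_byWitness[where f' = ?inv])
    show "\<forall>x\<in>carrier ?Z. ?inv (zorn_coord x) = x"
      using from_pluecker_pluecker[of "Suc 0"]
      by (auto simp: zorn_coord_def car scalar_pluecker[symmetric] from_pluecker_pluecker)
    show "?inv ` carrier split_octonions \<subseteq> carrier ?Z"
      using homsD(1)[OF from_pluecker_homs[of "Suc 0"]]
      by (auto simp: car homsD(1)[OF from_pluecker_homs])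
    then show "\<forall>x\<in>carrier split_octonions. zorn_coord (?inv x) = x"
      using pluecker_from_pluecker[of "Suc 0"]
      by (auto simp: zorn_coord_def pluecker_from_pluecker pluecker_range_def image_subset_iff)
  qed auto
qed (simp_all add: zorn_coord_mult zorn_coord_one)

lemma is_algebra_Zorn: "is_algebra (Zorn V \<omega>)"
  by (rule is_algebra_transport[OF vspace_Zorn[OF V] is_algebra_octonions zorn_coord_iso
        Zorn_mult_closed zorn_coord_one(1)])

lemma Zorn_object: "(Zorn V \<omega>, Zorn_idempotent V \<omega>) \<in> ob oct_cat"
proof -
  let ?Z = "Zorn V \<omega>" and ?p = "Zorn_idempotent V \<omega>"
  note iso = zorn_coord_iso
  have inj: "x = y" if "x \<in> carrier ?Z" "y \<in> carrier ?Z" "zorn_coord x = zorn_coord y" for x y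
    using algebra_isosD(7)[OF iso that(1,2)] that(3) by simp
  have zero: "zorn_coord \<zero>\<^bsub>?Z\<^esub> = (0, (0, 0, 0), (0, 0, 0), 0)"
    using homs_zero[OF algebra_isosD(2)[OF iso] vspace_Zorn[OF V] vspace_octonions] by simp
  have "?p \<otimes>\<^bsub>?Z\<^esub> ?p = ?p"
    by (rule inj) (simp_all add: zorn_coord_idem Zorn_mult_closed zorn_coord_mult)
  moreover have "?p \<noteq> \<zero>\<^bsub>?Z\<^esub>" "?p \<noteq> \<one>\<^bsub>?Z\<^esub>"
    using zero zorn_coord_idem(2) zorn_coord_one(2) by auto
  ultimately have "?p \<in> nontrivial_idempotents ?Z"
    by (simp add: nontrivial_idempotents_def zorn_coord_idem)
  then show ?thesis
    using is_algebra_Zorn iso by (auto simp: oct_cat_def)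
qed

end

section \<open>Volume forms and volume-preserving maps\<close>

context coords
begin

interpretation D: coords "dual V" dual_coord by (rule coords_dual)

text \<open>The space of volume forms has dimension \<open>1\<close>.\<close>

lemma volume_form_eqI:
  assumes "\<xi> \<in> carrier (Ext (dual V) 3)" "\<eta> \<in> carrier (Ext (dual V) 3)"
    and "pairing V 3 (\<xi>, wedge V [e1, e2, e3]) = pairing V 3 (\<eta>, wedge V [e1, e2, e3])"
  shows "\<xi> = \<eta>"
proof (rule D.pluecker_inj[OF _ assms(1,2)])
  have "pairing V 3 (\<zeta>, wedge V [e1, e2, e3]) = fst (D.pluecker 3 \<zeta>)" if "\<zeta> \<in> carrier (Ext (dual V) 3)" for \<zeta>
    using pairing_eq[OF _ that, of "wedge V [e1, e2, e3]"]
    by (simp add: basis_wedge_carrier pluecker_wedge tuples_def dot3_eq)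
  then show "D.pluecker 3 \<xi> = D.pluecker 3 \<eta>"
    using assms D.pluecker_in_range[of 3] by (simp add: pluecker_range_def prod_eq_iff)
qed simp

text \<open>Cramer's rule: three vectors of volume \<open>1\<close> are the basis of a unimodular coordinate system.\<close>

lemma unimodular_coords_of_volume:
  assumes \<omega>: "\<omega> \<in> carrier (Ext (dual V) 3)"
    and u: "u1 \<in> carrier V" "u2 \<in> carrier V" "u3 \<in> carrier V"
    and vol: "pairing V 3 (\<omega>, wedge V [u1, u2, u3]) = 1"
  obtains c' where "unimodular_coords V c' \<omega>" "c' u1 = (1, 0, 0)" "c' u2 = (0, 1, 0)" "c' u3 = (0, 0, 1)"
proof -
  \<comment> \<open>By Cauchy-Binet, \<open>t\<close> is the reciprocal of the determinant of the three vectors.\<close>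
  define t where "t = fst (D.pluecker 3 \<omega>)"
  have "wedge V [u1, u2, u3] \<in> carrier (Ext V 3)" using u by (simp add: basis_wedge_carrier)
  then have td: "t * dot3 (cross3 (c u1) (c u2)) (c u3) = 1"
    using vol pairing_eq[OF _ \<omega>, of "wedge V [u1, u2, u3]"] u
    by (simp add: pluecker_wedge tuples_def t_def dot3_eq)
  define c' where "c' v = (t * dot3 (c v) (cross3 (c u2) (c u3)), t * dot3 (c v) (cross3 (c u3) (c u1)),
    t * dot3 (c v) (cross3 (c u1) (c u2)))" for v
  have c'_homs: "c' \<in> homs V space3"
    by (rule homsI) (simp_all add: c'_def homsD(2,3)[OF c] dot3_eq algebra_simps)
  have basis: "c' u1 = (1, 0, 0)" "c' u2 = (0, 1, 0)" "c' u3 = (0, 0, 1)"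
    using td by (simp_all add: c'_def vec3_simps algebra_simps)
  define g where "g a = fst a \<odot>\<^bsub>V\<^esub> u1 \<oplus>\<^bsub>V\<^esub> (fst (snd a) \<odot>\<^bsub>V\<^esub> u2 \<oplus>\<^bsub>V\<^esub> snd (snd a) \<odot>\<^bsub>V\<^esub> u3)" for a
  have g: "g a \<in> carrier V" for a using u by (simp add: g_def vspace_simps(2,3)[OF V])
  have c'g: "c' (g a) = a" for a
    using u by (simp add: g_def homsD(2,3)[OF c'_homs] vspace_simps(2,3)[OF V] basis)
  have gc': "g (c' v) = v" if v: "v \<in> carrier V" for v
  proof -
    have "c (g (c' v)) = (t * dot3 (cross3 (c u1) (c u2)) (c u3)) \<odot>\<^bsub>space3\<^esub> c v"
      using u by (simp add: g_def homsD(2,3)[OF c] vspace_simps(2,3)[OF V])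
        (simp add: c'_def vec3_simps algebra_simps)
    then have "c (g (c' v)) = c v" by (simp add: td)
    then show ?thesis using bij v g by (metis bij_betw_imp_inj_on inj_onD)
  qed
  have "bij_betw c' (carrier V) UNIV"
    by (rule bij_betw_byWitness[where f' = g]) (auto simp: gc' c'g g)
  then have coords': "coords V c'" by (rule coords.intro[OF V c'_homs])
  interpret C: coords V c' by (rule coords')
  have "C.e1 = u1" "C.e2 = u2" "C.e3 = u3"
    using C.vec_c[OF u(1)] C.vec_c[OF u(2)] C.vec_c[OF u(3)] by (simp_all add: basis)
  then have "unimodular_coords V c' \<omega>"
    using \<omega> vol by unfold_locales auto
  then show thesis using that basis by blast
qed

text \<open>The first vector of any basis can be rescaled to make the basis unimodular.\<close>

lemma unimodular_coords_exist:
  assumes "\<omega> \<in> volume_forms V"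
  obtains c' where "unimodular_coords V c' \<omega>"
proof -
  have \<omega>: "\<omega> \<in> carrier (Ext (dual V) 3)" and nz: "\<omega> \<noteq> \<zero>\<^bsub>Ext (dual V) 3\<^esub>"
    using assms by (auto simp: volume_forms_def)
  define t where "t = fst (D.pluecker 3 \<omega>)"
  have t: "t \<noteq> 0"
  proof
    assume "t = 0"
    then have "D.pluecker 3 \<omega> = D.pluecker 3 \<zero>\<^bsub>Ext (dual V) 3\<^esub>"
      using D.pluecker_in_range[OF _ \<omega>] homs_zero[OF D.pluecker vspace_Ext[OF D.V] vspace_space3, of 3]
      by (simp add: t_def pluecker_range_def prod_eq_iff)
    then show False
      using nz D.pluecker_inj[OF _ \<omega> vspace_simps(1)[OF vspace_Ext[OF D.V]]] by simp
  qed
  let ?u = "vec (1 / t, 0, 0)"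
  have "pairing V 3 (\<omega>, wedge V [?u, e2, e3]) = 1"
    using pairing_eq[OF _ \<omega>, of "wedge V [?u, e2, e3]"] t
    by (simp add: basis_wedge_carrier pluecker_wedge tuples_def dot3_eq t_def)
  from unimodular_coords_of_volume[OF \<omega> _ _ _ this] that show thesis by auto
qed

lemma dim_3: "vectorspace.fin_dim class_ring V" "vectorspace.dim class_ring V = 3"
proof -
  interpret V: vectorspace class_ring V by (rule V)
  let ?S = "{e1, e2, e3}"
  have ne: "e1 \<noteq> e2" "e1 \<noteq> e3" "e2 \<noteq> e3"
    by (metis c_vec prod.inject zero_neq_one)+
  have sub: "?S \<subseteq> carrier V" by simp
  have comb: "V.lincomb a ?S = vec (a e1, a e2, a e3)" for a
    using ne unfolding V.lincomb_def vec_expand[of "(a e1, a e2, a e3)"]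
    by (simp add: vspace_simps(3,5)[OF V])
  have "V.span ?S = carrier V"
  proof
    show "V.span ?S \<subseteq> carrier V" by (rule V.span_is_subset2[OF sub])
    show "carrier V \<subseteq> V.span ?S"
    proof
      fix v assume v: "v \<in> carrier V"
      define a where "a w = (if w = e1 then fst (c v) else if w = e2 then fst (snd (c v)) else snd (snd (c v)))" for w
      have "V.lincomb a ?S = v" using ne vec_c[OF v] by (simp add: comb a_def)
      then show "v \<in> V.span ?S" unfolding V.span_def using ne by (intro CollectI exI[of _ a] exI[of _ ?S]) auto
    qed
  qed
  moreover have "V.lin_indpt ?S"
  proof (rule V.finite_lin_indpt2[OF _ sub])
    fix a assume "V.lincomb a ?S = \<zero>\<^bsub>V\<^esub>"
    then have "c (vec (a e1, a e2, a e3)) = c \<zero>\<^bsub>V\<^esub>" by (simp only: comb)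
    then show "\<forall>v\<in>?S. a v = \<zero>\<^bsub>class_ring\<^esub>"
      using homs_zero[OF c V vspace_space3] by simp
  qed simp
  ultimately show "V.fin_dim" "V.dim = 3"
    using V.dim_basis[of ?S] ne unfolding V.fin_dim_def V.basis_def by (auto intro: exI[of _ ?S])
qed

end

lemma coords_exist:
  fixes V :: "('k::field, 'v) module"
  assumes V: "vspace V" and fin: "vectorspace.fin_dim class_ring V" and dim: "vectorspace.dim class_ring V = 3"
  obtains c where "coords V c"
proof -
  interpret V: vectorspace class_ring V by (rule V)
  obtain S where S: "finite S" "V.basis S" using V.finite_basis_exists[OF fin] by blast
  then have "card S = 3" using V.dim_basis dim by simp
  then obtain b1 b2 b3 where b: "S = {b1, b2, b3}" "b1 \<noteq> b2" "b1 \<noteq> b3" "b2 \<noteq> b3"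
    by (auto simp: card_3_iff)
  have indep: "V.lin_indpt S" and gen: "V.span S = carrier V" and sub: "S \<subseteq> carrier V"
    using S(2) by (auto simp: V.basis_def)
  have bV: "b1 \<in> carrier V" "b2 \<in> carrier V" "b3 \<in> carrier V" using sub b by auto
  define g :: "'k vec3 \<Rightarrow> 'v" where
    "g a = fst a \<odot>\<^bsub>V\<^esub> b1 \<oplus>\<^bsub>V\<^esub> (fst (snd a) \<odot>\<^bsub>V\<^esub> b2 \<oplus>\<^bsub>V\<^esub> snd (snd a) \<odot>\<^bsub>V\<^esub> b3)" for a
  have comb: "V.lincomb a S = g (a b1, a b2, a b3)" for a
    using b bV unfolding V.lincomb_def g_def by (simp add: vspace_simps(3,5)[OF V])
  have g: "g \<in> homs space3 V"
    by (rule homsI) (simp_all add: g_def bV vspace_simps(2,3)[OF V] vspace_distrib[OF V] vspace_add_ac[OF V])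
  have "g ` UNIV = carrier V"
  proof
    show "g ` UNIV \<subseteq> carrier V" using homsD(1)[OF g] by auto
    show "carrier V \<subseteq> g ` UNIV"
      using V.finite_span[OF S(1) sub] gen comb by auto
  qed
  moreover have "inj g"
  proof (rule injI)
    fix x y assume eq: "g x = g y"
    obtain d1 d2 d3 where d: "x \<oplus>\<^bsub>space3\<^esub> (-1) \<odot>\<^bsub>space3\<^esub> y = (d1, d2, d3)"
      by (cases "x \<oplus>\<^bsub>space3\<^esub> (-1) \<odot>\<^bsub>space3\<^esub> y") auto
    have "g (x \<oplus>\<^bsub>space3\<^esub> (-1) \<odot>\<^bsub>space3\<^esub> y) = g x \<oplus>\<^bsub>V\<^esub> (-1) \<odot>\<^bsub>V\<^esub> g y"
      using homsD(2)[OF g, of x "(-1) \<odot>\<^bsub>space3\<^esub> y"] homsD(3)[OF g, of y "-1"] by simp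
    also have "\<dots> = \<zero>\<^bsub>V\<^esub>" using homsD(1)[OF g, of y] eq by (simp add: vspace_simps(11)[OF V])
    finally have 0: "g (d1, d2, d3) = \<zero>\<^bsub>V\<^esub>" by (simp only: d)
    define a where "a w = (if w = b1 then d1 else if w = b2 then d2 else d3)" for w
    have "(a b1, a b2, a b3) = (d1, d2, d3)" using b(2-4) by (auto simp: a_def)
    then have lc: "V.lincomb a S = \<zero>\<^bsub>V\<^esub>" using 0 by (simp only: comb)
    have "a w = 0" if "w \<in> S" for w
      using V.lin_dep_crit[OF S(1) subset_refl _ that _ lc] indep by (auto simp: class_ring_simps)
    from this[of b1] this[of b2] this[of b3] have "d1 = 0" "d2 = 0" "d3 = 0"
      using b by (auto simp: a_def)
    then show "x = y" using d by (auto simp: prod_eq_iff)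
  qed
  ultimately have bij: "bij_betw g UNIV (carrier V)" by (simp add: bij_betw_def)
  have "coords V (inv_into UNIV g)"
  proof (rule coords.intro[OF V])
    show "inv_into UNIV g \<in> homs V space3"
      using homs_inv_into[OF g _ vspace_space3] bij by simp
    show "bij_betw (inv_into UNIV g) (carrier V) UNIV" by (rule bij_betw_inv_into[OF bij])
  qed
  then show thesis using that by blast
qed

lemma vol_object_coords:
  assumes "(V, \<omega>) \<in> ob vol_cat"
  obtains c where "unimodular_coords V c \<omega>"
proof -
  have V: "vspace V" "vectorspace.fin_dim class_ring V" "vectorspace.dim class_ring V = 3" "\<omega> \<in> volume_forms V"
    using assms by (auto simp: vol_cat_def)
  obtain c where "coords V c" using coords_exist[OF V(1-3)] by blast
  from coords.unimodular_coords_exist[OF this V(4)] that show thesis by blast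
qed

lemma vol_objectD:
  assumes "(V, \<omega>) \<in> ob vol_cat"
  shows "vspace V" "\<omega> \<in> carrier (Ext (dual V) 3)"
  using assms by (auto simp: vol_cat_def volume_forms_def)

text \<open>Both sides of the adjunction are linear in the form, and for a decomposable form both are the same
  determinant.\<close>

lemma pullback_volume:
  assumes V: "coords V c" and W: "coords W d" and f: "f \<in> linear_maps V W" and \<xi>: "\<xi> \<in> carrier (Ext (dual W) 3)"
  shows "pullback V W f \<xi> \<in> carrier (Ext (dual V) 3)"
    and "ws \<in> tuples V 3 \<Longrightarrow>
      pairing V 3 (pullback V W f \<xi>, wedge V ws) = pairing W 3 (\<xi>, wedge W (map f ws))"
proof -
  interpret V: coords V c by fact
  interpret W: coords W d by fact
  note f' = linear_maps_homs[OF f]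
  have dm: "dual_map V W f \<in> homs (dual W) (dual V)"
  proof (rule homsI)
    fix g assume g: "g \<in> carrier (dual W)"
    have "restrict (\<lambda>v. g (f v)) (carrier V) \<in> linear_maps V ground_space"
      using g by (intro linear_maps_restrict[OF homs_comp[OF f' linear_maps_homs] V.V]) (simp add: dual_simps)
    with g show "dual_map V W f g \<in> carrier (dual V)" by (simp add: dual_map_def dual_simps)
  next
    fix g h assume gh: "g \<in> carrier (dual W)" "h \<in> carrier (dual W)"
    then have "g \<oplus>\<^bsub>dual W\<^esub> h \<in> carrier (dual W)" by (simp add: vspace_simps(2)[OF vspace_dual[OF W.V]])
    with gh show "dual_map V W f (g \<oplus>\<^bsub>dual W\<^esub> h) = dual_map V W f g \<oplus>\<^bsub>dual V\<^esub> dual_map V W f h"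
      by (auto simp: dual_map_def dual_simps homsD(1)[OF f'] restrict_def fun_eq_iff)
  next
    fix a g assume g: "g \<in> carrier (dual W)"
    then have "a \<odot>\<^bsub>dual W\<^esub> g \<in> carrier (dual W)" by (simp add: vspace_simps(3)[OF vspace_dual[OF W.V]])
    with g show "dual_map V W f (a \<odot>\<^bsub>dual W\<^esub> g) = a \<odot>\<^bsub>dual V\<^esub> dual_map V W f g"
      by (auto simp: dual_map_def dual_simps homsD(1)[OF f'] restrict_def fun_eq_iff)
  qed
  note dV = vspace_dual[OF V.V] and dW = vspace_dual[OF W.V]
  show "pullback V W f \<xi> \<in> carrier (Ext (dual V) 3)"
    using homsD(1)[OF linear_maps_homs[OF ext_map(1)[OF dW dV dm]] \<xi>] by (simp add: pullback_def)
  assume ws: "ws \<in> tuples V 3"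
  then have fws: "map f ws \<in> tuples W 3" by (rule map_tuples[OF f'])
  have 1: "(\<lambda>\<xi>. pairing V 3 (pullback V W f \<xi>, wedge V ws)) \<in> homs (Ext (dual W) 3) ground_space"
    using homs_comp[OF linear_maps_homs[OF ext_map(1)[OF dW dV dm]]
        bilinear_maps_homs(2)[OF V.pairing_bilinear[OF order_refl] wedge_carrier[OF V.V ws]]]
    by (simp add: pullback_def)
  have 2: "(\<lambda>\<xi>. pairing W 3 (\<xi>, wedge W (map f ws))) \<in> homs (Ext (dual W) 3) ground_space"
    by (rule bilinear_maps_homs(2)[OF W.pairing_bilinear[OF order_refl] wedge_carrier[OF W.V fws]])
  show "pairing V 3 (pullback V W f \<xi>, wedge V ws) = pairing W 3 (\<xi>, wedge W (map f ws))"
  proof (rule Ext_homs_eq[OF dW 1 2 _ \<xi>])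
    fix fs assume fs: "fs \<in> tuples (dual W) 3"
    then have dfs: "map (dual_map V W f) fs \<in> tuples (dual V) 3" by (rule map_tuples[OF dm])
    have "(map (dual_map V W f) fs ! p) (ws ! q) = (fs ! p) (map f ws ! q)" if "p < 3" "q < 3" for p q
    proof -
      have "fs ! p \<in> carrier (dual W)" "ws ! q \<in> carrier V" "length fs = 3" "length ws = 3"
        using fs ws that by (auto simp: tuples_def)
      then show ?thesis using that by (simp add: dual_map_def)
    qed
    then have "mat 3 3 (\<lambda>(p, q). (map (dual_map V W f) fs ! p) (ws ! q)) =
      mat 3 3 (\<lambda>(p, q). (fs ! p) (map f ws ! q))"
      by (intro eq_matI) auto
    then show "pairing V 3 (pullback V W f (wedge (dual W) fs), wedge V ws) =
      pairing W 3 (wedge (dual W) fs, wedge W (map f ws))"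
      by (simp add: pullback_def ext_map(2)[OF dW dV dm fs] V.pairing_wedge[OF order_refl dfs ws]
          W.pairing_wedge[OF order_refl fs fws])
  qed
qed

text \<open>In this form the condition on morphisms is visibly preserved by composition.\<close>

lemma vol_hom_iff:
  assumes V: "(V, \<omega>) \<in> ob vol_cat" and W: "(W, \<eta>) \<in> ob vol_cat"
  shows "f \<in> hom_set vol_cat (V, \<omega>) (W, \<eta>) \<longleftrightarrow> f \<in> linear_maps V W \<and>
    (\<forall>ws \<in> tuples V 3. pairing W 3 (\<eta>, wedge W (map f ws)) = pairing V 3 (\<omega>, wedge V ws))"
proof -
  obtain c where c: "unimodular_coords V c \<omega>" using vol_object_coords[OF V] by blast
  obtain d where d: "unimodular_coords W d \<eta>" using vol_object_coords[OF W] by blast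
  interpret V: unimodular_coords V c \<omega> by fact
  interpret W: unimodular_coords W d \<eta> by fact
  have "pullback V W f \<eta> = \<omega> \<longleftrightarrow>
    (\<forall>ws \<in> tuples V 3. pairing W 3 (\<eta>, wedge W (map f ws)) = pairing V 3 (\<omega>, wedge V ws))"
    if f: "f \<in> linear_maps V W"
  proof
    note pb = pullback_volume[OF V.coords_axioms W.coords_axioms f W.\<omega>]
    show "pullback V W f \<eta> = \<omega>"
      if eq: "\<forall>ws \<in> tuples V 3. pairing W 3 (\<eta>, wedge W (map f ws)) = pairing V 3 (\<omega>, wedge V ws)"
    proof (rule V.volume_form_eqI[OF pb(1) V.\<omega>])
      have t: "[V.e1, V.e2, V.e3] \<in> tuples V 3" by (simp add: tuples_def)
      show "pairing V 3 (pullback V W f \<eta>, wedge V [V.e1, V.e2, V.e3]) =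
        pairing V 3 (\<omega>, wedge V [V.e1, V.e2, V.e3])"
        using pb(2)[OF t] bspec[OF eq t] by simp
    qed
  qed (use pullback_volume(2)[OF V.coords_axioms W.coords_axioms f W.\<omega>] in auto)
  then show ?thesis by (auto simp: vol_cat_def)
qed

text \<open>A volume-preserving map takes a unimodular basis to a unimodular basis. In the corresponding
  coordinates it is the identity.\<close>

lemma matching_coords:
  assumes V: "(V, \<omega>) \<in> ob vol_cat" and W: "(W, \<eta>) \<in> ob vol_cat" and f: "f \<in> hom_set vol_cat (V, \<omega>) (W, \<eta>)"
  obtains c d where "unimodular_coords V c \<omega>" "unimodular_coords W d \<eta>" "\<And>v. v \<in> carrier V \<Longrightarrow> d (f v) = c v"
proof -
  obtain c where c: "unimodular_coords V c \<omega>" using vol_object_coords[OF V] by blast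
  obtain d' where d': "unimodular_coords W d' \<eta>" using vol_object_coords[OF W] by blast
  interpret V: unimodular_coords V c \<omega> by fact
  interpret W: unimodular_coords W d' \<eta> by fact
  have lin: "f \<in> homs V W"
    and vol: "\<And>ws. ws \<in> tuples V 3 \<Longrightarrow> pairing W 3 (\<eta>, wedge W (map f ws)) = pairing V 3 (\<omega>, wedge V ws)"
    using f vol_hom_iff[OF V W] by (auto simp: linear_maps_homs)
  have "pairing W 3 (\<eta>, wedge W [f V.e1, f V.e2, f V.e3]) = 1"
    using vol[of "[V.e1, V.e2, V.e3]"] V.\<omega>_basis by (simp add: tuples_def)
  then obtain d where d: "unimodular_coords W d \<eta>" "d (f V.e1) = (1, 0, 0)" "d (f V.e2) = (0, 1, 0)"
    "d (f V.e3) = (0, 0, 1)"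
    using W.unimodular_coords_of_volume[OF W.\<omega>] homsD(1)[OF lin] by (metis V.vec_carrier)
  interpret D: unimodular_coords W d \<eta> by fact
  have "d (f v) = c v" if "v \<in> carrier V" for v
    by (rule V.homs_eqI[OF homs_comp[OF lin D.c] V.c _ _ _ that]) (simp_all add: d)
  then show thesis using that c d by blast
qed

section \<open>Fully faithful essentially surjective functors\<close>

lemma categoryD:
  assumes "is_category C"
  shows "X \<in> ob C \<Longrightarrow> idn C X \<in> hom_set C X X"
    and "X \<in> ob C \<Longrightarrow> Y \<in> ob C \<Longrightarrow> Z \<in> ob C \<Longrightarrow> f \<in> hom_set C X Y \<Longrightarrow> g \<in> hom_set C Y Z \<Longrightarrow>
      cmp C X Y Z g f \<in> hom_set C X Z"
    and "X \<in> ob C \<Longrightarrow> Y \<in> ob C \<Longrightarrow> f \<in> hom_set C X Y \<Longrightarrow> cmp C X X Y f (idn C X) = f"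
    and "X \<in> ob C \<Longrightarrow> Y \<in> ob C \<Longrightarrow> f \<in> hom_set C X Y \<Longrightarrow> cmp C X Y Y (idn C Y) f = f"
    and "W \<in> ob C \<Longrightarrow> X \<in> ob C \<Longrightarrow> Y \<in> ob C \<Longrightarrow> Z \<in> ob C \<Longrightarrow>
      f \<in> hom_set C W X \<Longrightarrow> g \<in> hom_set C X Y \<Longrightarrow> h \<in> hom_set C Y Z \<Longrightarrow>
      cmp C W X Z (cmp C X Y Z h g) f = cmp C W Y Z h (cmp C W X Y g f)"
  using assms unfolding is_category_def by (blast, blast, blast, blast, metis)

lemma functorD:
  assumes "is_functor C D F"
  shows "is_category C" "is_category D"
    and "X \<in> ob C \<Longrightarrow> omap F X \<in> ob D"
    and "X \<in> ob C \<Longrightarrow> Y \<in> ob C \<Longrightarrow> f \<in> hom_set C X Y \<Longrightarrow> amap F X Y f \<in> hom_set D (omap F X) (omap F Y)"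
    and "X \<in> ob C \<Longrightarrow> amap F X X (idn C X) = idn D (omap F X)"
    and "X \<in> ob C \<Longrightarrow> Y \<in> ob C \<Longrightarrow> Z \<in> ob C \<Longrightarrow> f \<in> hom_set C X Y \<Longrightarrow> g \<in> hom_set C Y Z \<Longrightarrow>
      amap F X Z (cmp C X Y Z g f) =
      cmp D (omap F X) (omap F Y) (omap F Z) (amap F Y Z g) (amap F X Y f)"
  using assms unfolding is_functor_def by blast+

text \<open>The inverse functor chooses a preimage \<open>X A\<close> of each object \<open>A\<close> up to an isomorphism \<open>e A\<close>
  with inverse \<open>d A\<close>, conjugates morphisms by these, and lifts along the bijections on morphisms.
  Equations between lifted morphisms are checked after applying the functor.\<close>

lemma equivalence_of_fully_faithful:
  fixes C :: "('o, 'm) cat" and D :: "('p, 'n) cat"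
  assumes F: "is_functor C D F"
    and full: "\<And>X Y h. X \<in> ob C \<Longrightarrow> Y \<in> ob C \<Longrightarrow> h \<in> hom_set D (omap F X) (omap F Y) \<Longrightarrow>
      \<exists>f \<in> hom_set C X Y. amap F X Y f = h"
    and faithful: "\<And>X Y f g. X \<in> ob C \<Longrightarrow> Y \<in> ob C \<Longrightarrow> f \<in> hom_set C X Y \<Longrightarrow> g \<in> hom_set C X Y \<Longrightarrow>
      amap F X Y f = amap F X Y g \<Longrightarrow> f = g"
    and surj: "\<And>A. A \<in> ob D \<Longrightarrow> \<exists>X \<in> ob C. \<exists>h. is_iso D (omap F X) A h"
  shows "is_equivalence C D F"
proof -
  note C = categoryD[OF functorD(1)[OF F]] and D = categoryD[OF functorD(2)[OF F]]
  note FD = functorD(3-6)[OF F]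
  have "\<exists>X h h'. X \<in> ob C \<and> h \<in> hom_set D (omap F X) A \<and> h' \<in> hom_set D A (omap F X) \<and>
     cmp D (omap F X) A (omap F X) h' h = idn D (omap F X) \<and> cmp D A (omap F X) A h h' = idn D A"
    if "A \<in> ob D" for A
    using surj[OF that] unfolding is_iso_def by metis
  then obtain X e d where X: "\<And>A. A \<in> ob D \<Longrightarrow> X A \<in> ob C"
    and e: "\<And>A. A \<in> ob D \<Longrightarrow> e A \<in> hom_set D (omap F (X A)) A"
    and d: "\<And>A. A \<in> ob D \<Longrightarrow> d A \<in> hom_set D A (omap F (X A))"
    and de: "\<And>A. A \<in> ob D \<Longrightarrow> cmp D (omap F (X A)) A (omap F (X A)) (d A) (e A) = idn D (omap F (X A))"
    and ed: "\<And>A. A \<in> ob D \<Longrightarrow> cmp D A (omap F (X A)) A (e A) (d A) = idn D A"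
    by metis
  define FX where "FX A = omap F (X A)" for A
  have FX: "FX A \<in> ob D" if "A \<in> ob D" for A using that by (simp add: FX_def FD(1) X)
  note e = e[folded FX_def] and d = d[folded FX_def] and de = de[folded FX_def] and ed = ed[folded FX_def]
  have e_d: "cmp D A (FX B) B (e B) (cmp D A B (FX B) (d B) m) = m"
    if "A \<in> ob D" "B \<in> ob D" "m \<in> hom_set D A B" for A B m
    using D(5)[of A B "FX B" B m "d B" "e B"] that by (simp add: FX e d ed D(4))
  have d_e: "cmp D A B (FX B) (d B) (cmp D A (FX B) B (e B) m) = m"
    if "A \<in> ob D" "B \<in> ob D" "m \<in> hom_set D A (FX B)" for A B m
    using D(5)[of A "FX B" B "FX B" m "e B" "d B"] that by (simp add: FX e d de D(4))
  obtain P where P: "\<And>X Y h. X \<in> ob C \<Longrightarrow> Y \<in> ob C \<Longrightarrow> h \<in> hom_set D (omap F X) (omap F Y) \<Longrightarrow>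
      P X Y h \<in> hom_set C X Y \<and> amap F X Y (P X Y h) = h"
    using full by metis
  define t where "t A B h = cmp D (FX A) B (FX B) (d B) (cmp D (FX A) A B h (e A))" for A B h
  have t: "t A B h \<in> hom_set D (FX A) (FX B)" if "A \<in> ob D" "B \<in> ob D" "h \<in> hom_set D A B" for A B h
    using that by (simp add: t_def D(2)[of _ B] D(2)[of _ A] FX e d)
  define G where "G = \<lparr>omap = X, amap = (\<lambda>A B h. P (X A) (X B) (t A B h))\<rparr>"
  have G: "omap G A = X A" "amap G A B h = P (X A) (X B) (t A B h)" for A B h by (simp_all add: G_def)
  have Pt: "P (X A) (X B) (t A B h) \<in> hom_set C (X A) (X B)" "amap F (X A) (X B) (P (X A) (X B) (t A B h)) = t A B h"
    if "A \<in> ob D" "B \<in> ob D" "h \<in> hom_set D A B" for A B h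
    using P[OF X X t[unfolded FX_def]] that by blast+
  have "is_functor D C G"
    unfolding is_functor_def G
  proof (intro conjI ballI)
    fix A assume A: "A \<in> ob D"
    have "t A A (idn D A) = idn D (FX A)"
      using A by (simp add: t_def D(4)[of _ A] FX e de)
    then show "P (X A) (X A) (t A A (idn D A)) = idn C (X A)"
      using Pt[OF A A D(1)[OF A]] A by (intro faithful[of "X A" "X A"]) (simp_all add: X C(1) FD FX_def)
  next
    fix A B E h k assume *: "A \<in> ob D" "B \<in> ob D" "E \<in> ob D" "h \<in> hom_set D A B" "k \<in> hom_set D B E"
    have hk: "cmp D A B E k h \<in> hom_set D A E" using * D(2) by blast
    have he: "cmp D (FX A) A B h (e A) \<in> hom_set D (FX A) B" using * by (intro D(2)) (simp_all add: FX e)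
    have "cmp D (FX A) (FX B) (FX E) (t B E k) (t A B h) =
      cmp D (FX A) E (FX E) (d E) (cmp D (FX A) (FX B) E (cmp D (FX B) B E k (e B)) (t A B h))"
      unfolding t_def[of B E] using * t by (intro D(5)) (simp_all add: FX e d D(2)[of _ B])
    also have "cmp D (FX A) (FX B) E (cmp D (FX B) B E k (e B)) (t A B h) =
      cmp D (FX A) B E k (cmp D (FX A) (FX B) B (e B) (t A B h))"
      using * t by (intro D(5)) (simp_all add: FX e)
    also have "cmp D (FX A) (FX B) B (e B) (t A B h) = cmp D (FX A) A B h (e A)"
      unfolding t_def using * he by (intro e_d) (simp_all add: FX)
    also have "cmp D (FX A) B E k (cmp D (FX A) A B h (e A)) = cmp D (FX A) A E (cmp D A B E k h) (e A)"
      using * by (intro D(5)[symmetric]) (simp_all add: FX e)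
    also have "cmp D (FX A) E (FX E) (d E) \<dots> = t A E (cmp D A B E k h)"
      by (simp add: t_def)
    finally have comp: "cmp D (FX A) (FX B) (FX E) (t B E k) (t A B h) = t A E (cmp D A B E k h)" .
    show "P (X A) (X E) (t A E (cmp D A B E k h)) =
      cmp C (X A) (X B) (X E) (P (X B) (X E) (t B E k)) (P (X A) (X B) (t A B h))"
    proof (rule faithful[of "X A" "X E"])
      show "cmp C (X A) (X B) (X E) (P (X B) (X E) (t B E k)) (P (X A) (X B) (t A B h)) \<in> hom_set C (X A) (X E)"
        by (rule C(2)) (use * in \<open>simp_all add: X Pt\<close>)
      show "amap F (X A) (X E) (P (X A) (X E) (t A E (cmp D A B E k h))) = amap F (X A) (X E)
        (cmp C (X A) (X B) (X E) (P (X B) (X E) (t B E k)) (P (X A) (X B) (t A B h)))"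
        using * hk comp by (subst FD(4)) (simp_all add: X Pt FX_def)
    qed (use * hk in \<open>simp_all add: X Pt\<close>)
  qed (simp_all add: functorD(1,2)[OF F] X Pt)
  moreover
  define \<eta> where "\<eta> Y = P Y (X (omap F Y)) (d (omap F Y))" for Y
  define \<eta>' where "\<eta>' Y = P (X (omap F Y)) Y (e (omap F Y))" for Y
  have \<eta>: "\<eta> Y \<in> hom_set C Y (X (omap F Y))" "amap F Y (X (omap F Y)) (\<eta> Y) = d (omap F Y)"
    "\<eta>' Y \<in> hom_set C (X (omap F Y)) Y" "amap F (X (omap F Y)) Y (\<eta>' Y) = e (omap F Y)"
    if Y: "Y \<in> ob C" for Y
    using P[OF Y X[OF FD(1)[OF Y]] d[OF FD(1)[OF Y], unfolded FX_def]]
      P[OF X[OF FD(1)[OF Y]] Y e[OF FD(1)[OF Y], unfolded FX_def]]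
    unfolding \<eta>_def \<eta>'_def by blast+
  have "is_natural_iso C C id_functor (comp_functor G F) \<eta>"
    unfolding is_natural_iso_def id_functor_def comp_functor_def fnctr.simps G
  proof (intro conjI ballI)
    fix Y assume Y: "Y \<in> ob C"
    let ?A = "omap F Y"
    note A = FD(1)[OF Y]
    have "cmp C Y (X ?A) Y (\<eta>' Y) (\<eta> Y) = idn C Y"
      using Y A by (intro faithful[OF Y Y C(2)[OF Y X[OF A] Y] C(1)[OF Y]])
        (simp_all add: \<eta> FD(3,4) X ed[unfolded FX_def])
    moreover have "cmp C (X ?A) Y (X ?A) (\<eta> Y) (\<eta>' Y) = idn C (X ?A)"
      using Y A by (intro faithful[OF X[OF A] X[OF A] C(2)[OF X[OF A] Y X[OF A]] C(1)[OF X[OF A]]])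
        (simp_all add: \<eta> FD(3,4) X de[unfolded FX_def])
    ultimately show "is_iso C Y (X ?A) (\<eta> Y)"
      unfolding is_iso_def using \<eta>[OF Y] by blast
  next
    fix Y Z f assume *: "Y \<in> ob C" "Z \<in> ob C" "f \<in> hom_set C Y Z"
    let ?A = "omap F Y" and ?B = "omap F Z" and ?h = "amap F Y Z f"
    have h: "?A \<in> ob D" "?B \<in> ob D" "?h \<in> hom_set D ?A ?B" using * FD by blast+
    have he: "cmp D (FX ?A) ?A ?B ?h (e ?A) \<in> hom_set D (FX ?A) ?B"
      using h by (intro D(2)) (simp_all add: FX e)
    have "cmp D ?A (FX ?A) (FX ?B) (t ?A ?B ?h) (d ?A) =
      cmp D ?A ?B (FX ?B) (d ?B) (cmp D ?A (FX ?A) ?B (cmp D (FX ?A) ?A ?B ?h (e ?A)) (d ?A))"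
      unfolding t_def using h he by (intro D(5)) (simp_all add: FX d)
    also have "cmp D ?A (FX ?A) ?B (cmp D (FX ?A) ?A ?B ?h (e ?A)) (d ?A) =
      cmp D ?A ?A ?B ?h (cmp D ?A (FX ?A) ?A (e ?A) (d ?A))"
      using h by (intro D(5)) (simp_all add: FX e d)
    also have "\<dots> = ?h" using h by (simp add: ed D(3))
    finally have eq: "cmp D ?A (FX ?A) (FX ?B) (t ?A ?B ?h) (d ?A) = cmp D ?A ?B (FX ?B) (d ?B) ?h" .
    show "cmp C Y Z (X ?B) (\<eta> Z) f = cmp C Y (X ?A) (X ?B) (P (X ?A) (X ?B) (t ?A ?B ?h)) (\<eta> Y)"
    proof (rule faithful[of Y "X ?B"])
      show "cmp C Y Z (X ?B) (\<eta> Z) f \<in> hom_set C Y (X ?B)"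
        by (rule C(2)) (use * h in \<open>simp_all add: X \<eta>\<close>)
      show "cmp C Y (X ?A) (X ?B) (P (X ?A) (X ?B) (t ?A ?B ?h)) (\<eta> Y) \<in> hom_set C Y (X ?B)"
        by (rule C(2)) (use * h in \<open>simp_all add: X \<eta> Pt\<close>)
      show "amap F Y (X ?B) (cmp C Y Z (X ?B) (\<eta> Z) f) =
        amap F Y (X ?B) (cmp C Y (X ?A) (X ?B) (P (X ?A) (X ?B) (t ?A ?B ?h)) (\<eta> Y))"
        using * h eq by (simp add: FD(4)[of Y Z] FD(4)[of Y "X ?A"] X \<eta> Pt FX_def)
    qed (use * h in \<open>simp_all add: X\<close>)
  qed
  moreover have "is_natural_iso D D (comp_functor F G) id_functor e"
    unfolding is_natural_iso_def id_functor_def comp_functor_def fnctr.simps G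
  proof (intro conjI ballI)
    fix A assume A: "A \<in> ob D"
    show "is_iso D (omap F (X A)) A (e A)"
      unfolding is_iso_def FX_def[symmetric] using e[OF A] d[OF A] de[OF A] ed[OF A] by blast
  next
    fix A B h assume *: "A \<in> ob D" "B \<in> ob D" "h \<in> hom_set D A B"
    have "cmp D (FX A) (FX B) B (e B) (t A B h) = cmp D (FX A) A B h (e A)"
      unfolding t_def using * by (intro e_d D(2)) (simp_all add: FX e)
    then show "cmp D (omap F (X A)) (omap F (X B)) B (e B) (amap F (X A) (X B) (P (X A) (X B) (t A B h))) =
      cmp D (omap F (X A)) A B h (e A)"
      using * by (simp add: Pt FX_def)
  qed
  ultimately show ?thesis
    unfolding is_equivalence_def using F by blast
qed

section \<open>The Zorn functor\<close>

lemma ext_map_id: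
  assumes V: "vspace V" and x: "x \<in> carrier (Ext V i)"
  shows "ext_map V V i (\<lambda>v \<in> carrier V. v) x = x"
proof -
  note f = linear_maps_homs[OF linear_maps_id[OF V]]
  have id: "(\<lambda>x. x) \<in> homs (Ext V i) (Ext V i)" by (rule homsI) simp_all
  show ?thesis
  proof (rule Ext_homs_eq[OF V linear_maps_homs[OF ext_map(1)[OF V V f]] id _ x])
    fix ws assume ws: "ws \<in> tuples V i"
    then have "map (\<lambda>v \<in> carrier V. v) ws = ws" by (intro map_idI) (auto simp: tuples_def)
    then show "ext_map V V i (\<lambda>v \<in> carrier V. v) (wedge V ws) = wedge V ws"
      by (simp add: ext_map(2)[OF V V f ws])
  qed
qed

lemma ext_map_compose:
  assumes U: "vspace U" and V: "vspace V" and W: "vspace W"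
    and f: "f \<in> linear_maps U V" and g: "g \<in> linear_maps V W" and x: "x \<in> carrier (Ext U i)"
  shows "ext_map U W i (compose (carrier U) g f) x = ext_map V W i g (ext_map U V i f x)"
proof -
  note f' = linear_maps_homs[OF f] and g' = linear_maps_homs[OF g]
  note gf = linear_maps_homs[OF linear_maps_compose[OF f g U]]
  show ?thesis
  proof (rule Ext_homs_eq[OF U linear_maps_homs[OF ext_map(1)[OF U W gf]]
        homs_comp[OF linear_maps_homs[OF ext_map(1)[OF U V f']] linear_maps_homs[OF ext_map(1)[OF V W g']]] _ x])
    fix ws assume ws: "ws \<in> tuples U i"
    then have "map (compose (carrier U) g f) ws = map g (map f ws)"
      by (auto simp: tuples_def compose_def)
    then show "ext_map U W i (compose (carrier U) g f) (wedge U ws) =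
      ext_map V W i g (ext_map U V i f (wedge U ws))"
      by (simp add: ext_map(2)[OF U W gf ws] ext_map(2)[OF U V f' ws] ext_map(2)[OF V W g' map_tuples[OF f' ws]]
          del: map_map)
  qed
qed

lemma is_category_vol_cat: "is_category (vol_cat :: (('k::field, 'v) vol_space, 'v \<Rightarrow> 'v) cat)"
proof -
  let ?C = "vol_cat :: (('k::field, 'v) vol_space, 'v \<Rightarrow> 'v) cat"
  have idn: "idn ?C X \<in> hom_set ?C X X" if "X \<in> ob ?C" for X
  proof -
    obtain V \<omega> where X: "X = (V, \<omega>)" by (cases X)
    have "map (\<lambda>v \<in> carrier V. v) ws = ws" if "ws \<in> tuples V 3" for ws
      using that by (intro map_idI) (auto simp: tuples_def)
    then have "(\<lambda>v \<in> carrier V. v) \<in> hom_set ?C X X"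
      using that unfolding X by (subst vol_hom_iff) (auto simp: linear_maps_id vol_objectD)
    then show ?thesis by (simp add: vol_cat_def X)
  qed
  have cmp: "cmp ?C X Y Z g f \<in> hom_set ?C X Z"
    if "X \<in> ob ?C" "Y \<in> ob ?C" "Z \<in> ob ?C" "f \<in> hom_set ?C X Y" "g \<in> hom_set ?C Y Z" for X Y Z f g
  proof -
    obtain U \<xi> where X: "X = (U, \<xi>)" by (cases X)
    obtain V \<omega> where Y: "Y = (V, \<omega>)" by (cases Y)
    obtain W \<eta> where Z: "Z = (W, \<eta>)" by (cases Z)
    note obs = that(1)[unfolded X] that(2)[unfolded Y] that(3)[unfolded Z]
    have f: "f \<in> linear_maps U V" "\<And>ws. ws \<in> tuples U 3 \<Longrightarrow> pairing V 3 (\<omega>, wedge V (map f ws)) = pairing U 3 (\<xi>, wedge U ws)"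
      using that(4) vol_hom_iff[OF obs(1,2)] by (auto simp: X Y)
    have g: "g \<in> linear_maps V W" "\<And>ws. ws \<in> tuples V 3 \<Longrightarrow> pairing W 3 (\<eta>, wedge W (map g ws)) = pairing V 3 (\<omega>, wedge V ws)"
      using that(5) vol_hom_iff[OF obs(2,3)] by (auto simp: Y Z)
    have "pairing W 3 (\<eta>, wedge W (map (compose (carrier U) g f) ws)) = pairing U 3 (\<xi>, wedge U ws)"
      if ws: "ws \<in> tuples U 3" for ws
    proof -
      have "map (compose (carrier U) g f) ws = map g (map f ws)"
        using ws by (auto simp: tuples_def compose_def)
      then show ?thesis
        using f(2)[OF ws] g(2)[OF map_tuples[OF linear_maps_homs[OF f(1)] ws]] by (simp del: map_map)
    qed
    then have "compose (carrier U) g f \<in> hom_set ?C X Z"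
      unfolding X Z vol_hom_iff[OF obs(1,3)]
      using linear_maps_compose[OF f(1) g(1) vol_objectD(1)[OF obs(1)]] by blast
    then show ?thesis by (simp add: vol_cat_def X)
  qed
  have lin: "f \<in> linear_maps (fst X) (fst Y)" if "f \<in> hom_set ?C X Y" for f X Y
    using that by (auto simp: vol_cat_def split: prod.splits)
  have mem: "f v \<in> carrier (fst Y)" if "f \<in> hom_set ?C X Y" "v \<in> carrier (fst X)" for f X Y v
    using homsD(1)[OF linear_maps_homs[OF lin[OF that(1)]] that(2)] .
  have ext: "f \<in> extensional (carrier (fst X))" if "f \<in> hom_set ?C X Y" for f X Y
    using lin[OF that] by (simp add: linear_maps_def)
  have ops: "cmp ?C X Y Z g f = compose (carrier (fst X)) g f" "idn ?C X = (\<lambda>v \<in> carrier (fst X). v)" for X Y Z f g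
    by (simp_all add: vol_cat_def split: prod.splits)
  show ?thesis
    unfolding is_category_def
  proof (intro conjI ballI)
    fix X Y f assume "X \<in> ob ?C" "Y \<in> ob ?C" and f: "f \<in> hom_set ?C X Y"
    show "cmp ?C X X Y f (idn ?C X) = f" "cmp ?C X Y Y (idn ?C Y) f = f"
      unfolding ops by (rule extensionalityI[of _ "carrier (fst X)"]; simp add: ext[OF f] compose_eq mem[OF f])+
  next
    fix W X Y Z f g h
    assume "W \<in> ob ?C" "X \<in> ob ?C" "Y \<in> ob ?C" "Z \<in> ob ?C"
      and f: "f \<in> hom_set ?C W X" and "g \<in> hom_set ?C X Y" "h \<in> hom_set ?C Y Z"
    show "cmp ?C W Y Z h (cmp ?C W X Y g f) = cmp ?C W X Z (cmp ?C X Y Z h g) f"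
      unfolding ops by (rule extensionalityI[of _ "carrier (fst W)"]; simp add: compose_eq mem[OF f])
  qed (use idn cmp in auto)
qed

lemma oct_homD:
  assumes "h \<in> hom_set oct_cat X Y"
  shows "h \<in> algebra_isos (fst X) (fst Y)" "h (snd X) = snd Y"
  using assms by (auto simp: oct_cat_def split: prod.splits)

lemma oct_homI: "h \<in> algebra_isos (fst X) (fst Y) \<Longrightarrow> h (snd X) = snd Y \<Longrightarrow> h \<in> hom_set oct_cat X Y"
  by (auto simp: oct_cat_def split: prod.splits)

lemma oct_objectD:
  assumes "X \<in> ob oct_cat"
  shows "is_algebra (fst X)" "algebra_isos (fst X) split_octonions \<noteq> {}"
    "snd X \<in> nontrivial_idempotents (fst X)" "snd X \<in> carrier (fst X)"
  using assms by (auto simp: oct_cat_def nontrivial_idempotents_def split: prod.splits)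

lemma oct_ops:
  "cmp oct_cat X Y Z g f = compose (carrier (fst X)) g f" "idn oct_cat X = (\<lambda>x \<in> carrier (fst X). x)"
  by (simp_all add: oct_cat_def split: prod.splits)

lemma is_category_oct_cat: "is_category (oct_cat :: (('k::field, 'a) pointed_algebra, 'a \<Rightarrow> 'a) cat)"
proof -
  let ?C = "oct_cat :: (('k::field, 'a) pointed_algebra, 'a \<Rightarrow> 'a) cat"
  have mem: "f v \<in> carrier (fst Y)" if "f \<in> hom_set ?C X Y" "v \<in> carrier (fst X)" for f X Y v
    using algebra_isosD(6)[OF oct_homD(1)[OF that(1)] that(2)] .
  have ext: "f \<in> extensional (carrier (fst X))" if "f \<in> hom_set ?C X Y" for f X Y
    using algebra_isosD(1)[OF oct_homD(1)[OF that(1)]] by (simp add: linear_maps_def)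
  show ?thesis
    unfolding is_category_def
  proof (intro conjI ballI)
    fix X assume X: "X \<in> ob ?C"
    show "idn ?C X \<in> hom_set ?C X X"
      by (rule oct_homI) (simp_all add: oct_ops algebra_isos_id oct_objectD[OF X])
  next
    fix X Y Z f g assume X: "X \<in> ob ?C" and "Y \<in> ob ?C" "Z \<in> ob ?C"
      and f: "f \<in> hom_set ?C X Y" and g: "g \<in> hom_set ?C Y Z"
    show "cmp ?C X Y Z g f \<in> hom_set ?C X Z"
      using algebra_isos_compose[OF oct_objectD(1)[OF X] oct_homD(1)[OF f] oct_homD(1)[OF g]]
        oct_homD(2)[OF f] oct_homD(2)[OF g] oct_objectD(4)[OF X]
      by (intro oct_homI) (simp_all add: oct_ops compose_eq)
  next
    fix X Y f assume "X \<in> ob ?C" "Y \<in> ob ?C" and f: "f \<in> hom_set ?C X Y"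
    show "cmp ?C X X Y f (idn ?C X) = f" "cmp ?C X Y Y (idn ?C Y) f = f"
      unfolding oct_ops by (rule extensionalityI[of _ "carrier (fst X)"]; simp add: ext[OF f] compose_eq mem[OF f])+
  next
    fix W X Y Z f g h
    assume "W \<in> ob ?C" "X \<in> ob ?C" "Y \<in> ob ?C" "Z \<in> ob ?C"
      and f: "f \<in> hom_set ?C W X" and "g \<in> hom_set ?C X Y" "h \<in> hom_set ?C Y Z"
    show "cmp ?C W Y Z h (cmp ?C W X Y g f) = cmp ?C W X Z (cmp ?C X Y Z h g) f"
      unfolding oct_ops by (rule extensionalityI[of _ "carrier (fst W)"]; simp add: compose_eq mem[OF f])
  qed
qed

lemma oct_hom_is_iso:
  assumes X: "X \<in> ob oct_cat" and Y: "Y \<in> ob oct_cat" and h: "h \<in> hom_set oct_cat X Y"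
  shows "is_iso oct_cat X Y h"
proof -
  note h' = oct_homD[OF h]
  let ?g = "iso_inv (fst X) (fst Y) h"
  note g = iso_inv_eq[OF h'(1)]
  have "?g \<in> hom_set oct_cat Y X"
    using algebra_isos_inv[OF oct_objectD(1)[OF X] is_algebraD(1)[OF oct_objectD(1)[OF Y]] h'(1)]
      g(1)[OF oct_objectD(4)[OF X]] h'(2)
    by (intro oct_homI) simp_all
  moreover have "cmp oct_cat X Y X ?g h = idn oct_cat X"
    unfolding oct_ops by (rule extensionalityI[of _ "carrier (fst X)"]) (simp_all add: compose_eq g)
  moreover have "cmp oct_cat Y X Y h ?g = idn oct_cat Y"
    unfolding oct_ops by (rule extensionalityI[of _ "carrier (fst Y)"]) (simp_all add: compose_eq g)
  ultimately show ?thesis unfolding is_iso_def using h by blast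
qed

abbreviation Zorn_map ::
  "('k::field, 'v) module \<Rightarrow> ('k, 'v \<Rightarrow> 'k) ext \<Rightarrow> ('k, 'v) module \<Rightarrow> ('k, 'v \<Rightarrow> 'k) ext
    \<Rightarrow> ('v \<Rightarrow> 'v) \<Rightarrow> ('k, 'v) zorn \<Rightarrow> ('k, 'v) zorn" where
  "Zorn_map V \<omega> W \<eta> f \<equiv> amap Zorn_functor (V, \<omega>) (W, \<eta>) f"

lemma Zorn_map_eq:
  "Zorn_map V \<omega> W \<eta> f = restrict (\<lambda>(\<alpha>, a, a', \<alpha>').
     (ext_map V W 0 f \<alpha>, ext_map V W 1 f a, ext_map V W 2 f a', ext_map V W 3 f \<alpha>')) (carrier (Zorn V \<omega>))"
  by (simp add: Zorn_functor_def)

lemma Zorn_map_closed: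
  assumes V: "vspace V" and W: "vspace W" and f: "f \<in> homs V W" and x: "x \<in> carrier (Zorn V \<omega>)"
  shows "Zorn_map V \<omega> W \<eta> f x \<in> carrier (Zorn W \<eta>)"
  using x homsD(1)[OF linear_maps_homs[OF ext_map(1)[OF V W f]]]
  by (auto simp: Zorn_map_eq Zorn_carrier)

text \<open>In coordinates that match under \<open>f\<close>, the induced map on Zorn algebras is the identity of the split
  octonions.\<close>

lemma Zorn_map_hom:
  assumes V: "(V, \<omega>) \<in> ob vol_cat" and W: "(W, \<eta>) \<in> ob vol_cat" and f: "f \<in> hom_set vol_cat (V, \<omega>) (W, \<eta>)"
  shows "Zorn_map V \<omega> W \<eta> f \<in> hom_set oct_cat (Zorn V \<omega>, Zorn_idempotent V \<omega>) (Zorn W \<eta>, Zorn_idempotent W \<eta>)"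
proof -
  obtain c d where c: "unimodular_coords V c \<omega>" and d: "unimodular_coords W d \<eta>"
    and dc: "\<And>v. v \<in> carrier V \<Longrightarrow> d (f v) = c v"
    using matching_coords[OF V W f] by blast
  interpret V: unimodular_coords V c \<omega> by (fact c)
  interpret W: unimodular_coords W d \<eta> by (fact d)
  let ?h = "Zorn_map V \<omega> W \<eta> f"
  have lin: "f \<in> homs V W" using f vol_hom_iff[OF V W] by (auto simp: linear_maps_homs)
  have pl: "W.pluecker i (ext_map V W i f x) = V.pluecker i x" if "x \<in> carrier (Ext V i)" for i x
  proof (rule Ext_homs_eq[OF V.V homs_comp[OF linear_maps_homs[OF ext_map(1)[OF V.V W.V lin]] W.pluecker] V.pluecker _ that])
    fix ws assume ws: "ws \<in> tuples V i"
    have "map d (map f ws) = map c ws" using ws dc by (auto simp: tuples_def)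
    then show "W.pluecker i (ext_map V W i f (wedge V ws)) = V.pluecker i (wedge V ws)"
      by (simp add: ext_map(2)[OF V.V W.V lin ws] W.pluecker_wedge[OF map_tuples[OF lin ws]] V.pluecker_wedge[OF ws]
          del: map_map)
  qed
  have coord: "W.zorn_coord (?h x) = V.zorn_coord x" if x: "x \<in> carrier (Zorn V \<omega>)" for x
  proof -
    obtain \<alpha> a a' \<alpha>' where x': "x = (\<alpha>, a, a', \<alpha>')" by (cases x) auto
    have "\<alpha> \<in> carrier (Ext V 0)" "a \<in> carrier (Ext V 1)" "a' \<in> carrier (Ext V 2)" "\<alpha>' \<in> carrier (Ext V 3)"
      using x by (auto simp: x' Zorn_carrier)
    note pls = this[THEN pl]
    show ?thesis
      using Zorn_map_closed[OF V.V W.V lin x, of \<eta>] x pls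
      unfolding W.zorn_coord_def V.zorn_coord_def by (simp add: Zorn_map_eq x')
  qed
  have "?h \<in> algebra_isos (Zorn V \<omega>) (Zorn W \<eta>)"
    by (rule algebra_isos_of_coordinates[OF V.is_algebra_Zorn W.is_algebra_Zorn is_algebra_octonions
          V.zorn_coord_iso W.zorn_coord_iso])
      (simp_all add: coord Zorn_map_closed[OF V.V W.V lin], simp add: Zorn_map_eq)
  moreover have "?h (Zorn_idempotent V \<omega>) = Zorn_idempotent W \<eta>"
    using algebra_isosD(7)[OF W.zorn_coord_iso Zorn_map_closed[OF V.V W.V lin V.zorn_coord_idem(1), of \<eta>] W.zorn_coord_idem(1)]
    by (simp add: coord V.zorn_coord_idem W.zorn_coord_idem)
  ultimately show ?thesis by (intro oct_homI) simp_all
qed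

lemma Zorn_functor_object: "(V, \<omega>) \<in> ob vol_cat \<Longrightarrow> (Zorn V \<omega>, Zorn_idempotent V \<omega>) \<in> ob oct_cat"
  using vol_object_coords unimodular_coords.Zorn_object by blast

lemma omap_Zorn: "omap Zorn_functor (V, \<omega>) = (Zorn V \<omega>, Zorn_idempotent V \<omega>)"
  by (simp add: Zorn_functor_def)

lemma is_functor_Zorn:
  "is_functor vol_cat oct_cat (Zorn_functor :: ('k::field, 'v) vol_oct_functor)"
  unfolding is_functor_def split_paired_Ball_Sigma
proof (intro conjI ballI)
  let ?C = "vol_cat :: (('k::field, 'v) vol_space, 'v \<Rightarrow> 'v) cat"
  let ?F = "Zorn_functor :: ('k, 'v) vol_oct_functor"
  fix X assume X: "X \<in> ob ?C"
  obtain V \<omega> where V: "X = (V, \<omega>)" by (cases X)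
  note obV = X[unfolded V]
  show "omap ?F X \<in> ob oct_cat" unfolding V omap_Zorn by (rule Zorn_functor_object[OF obV])
  show "amap ?F X X (idn ?C X) = idn oct_cat (omap ?F X)"
    unfolding V omap_Zorn
    by (rule extensionalityI[of _ "carrier (Zorn V \<omega>)"])
      (auto simp: Zorn_map_eq oct_ops, auto simp: vol_cat_def Zorn_carrier ext_map_id[OF vol_objectD(1)[OF obV]]
        ext_map_id[OF vol_objectD(1)[OF obV], of _ "Suc 0"])
  fix Y assume Y: "Y \<in> ob ?C"
  obtain W \<eta> where W: "Y = (W, \<eta>)" by (cases Y)
  note obW = Y[unfolded W]
  fix f assume f: "f \<in> hom_set ?C X Y"
  show "amap ?F X Y f \<in> hom_set oct_cat (omap ?F X) (omap ?F Y)"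
    using f unfolding V W omap_Zorn by (rule Zorn_map_hom[OF obV obW])
  fix Z assume Z: "Z \<in> ob ?C"
  obtain U \<xi> where U: "Z = (U, \<xi>)" by (cases Z)
  note obU = Z[unfolded U]
  fix g assume g: "g \<in> hom_set ?C Y Z"
  have lin: "f \<in> linear_maps V W" "g \<in> linear_maps W U"
    using f g vol_hom_iff[OF obV obW] vol_hom_iff[OF obW obU] by (auto simp: V W U)
  note comp = ext_map_compose[OF obV[THEN vol_objectD(1)] obW[THEN vol_objectD(1)] obU[THEN vol_objectD(1)] lin]
  have cmp: "cmp ?C (V, \<omega>) (W, \<eta>) (U, \<xi>) g f = compose (carrier V) g f" by (simp add: vol_cat_def)
  show "amap ?F X Z (cmp ?C X Y Z g f) =
    cmp oct_cat (omap ?F X) (omap ?F Y) (omap ?F Z) (amap ?F Y Z g) (amap ?F X Y f)"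
  proof (rule extensionalityI[of _ "carrier (Zorn V \<omega>)"])
    fix x assume x: "x \<in> carrier (Zorn V \<omega>)"
    obtain \<alpha> a a' \<alpha>' where x': "x = (\<alpha>, a, a', \<alpha>')" by (cases x) auto
    have c: "\<alpha> \<in> carrier (Ext V 0)" "a \<in> carrier (Ext V 1)" "a' \<in> carrier (Ext V 2)" "\<alpha>' \<in> carrier (Ext V 3)"
      using x by (auto simp: x' Zorn_carrier)
    have "Zorn_map V \<omega> W \<eta> f x \<in> carrier (Zorn W \<eta>)"
      by (rule Zorn_map_closed[OF obV[THEN vol_objectD(1)] obW[THEN vol_objectD(1)] linear_maps_homs[OF lin(1)] x])
    then show "amap ?F X Z (cmp ?C X Y Z g f) x =
      cmp oct_cat (omap ?F X) (omap ?F Y) (omap ?F Z) (amap ?F Y Z g) (amap ?F X Y f) x"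
      using x unfolding V W U cmp omap_Zorn oct_ops
      by (simp add: compose_eq) (simp add: Zorn_map_eq x' comp[OF c(1)] comp[OF c(2)] comp[OF c(3)] comp[OF c(4)] del: One_nat_def)
  qed (simp_all add: V U omap_Zorn oct_ops Zorn_map_eq)
qed (simp_all add: is_category_vol_cat is_category_oct_cat)

lemma Zorn_map_vector:
  assumes V: "vspace V" and W: "vspace W" and f: "f \<in> homs V W" and v: "v \<in> carrier V"
  shows "(\<zero>\<^bsub>Ext V 0\<^esub>, wedge V [v], \<zero>\<^bsub>Ext V 2\<^esub>, \<zero>\<^bsub>Ext V 3\<^esub>) \<in> carrier (Zorn V \<omega>)"
    and "Zorn_map V \<omega> W \<eta> f (\<zero>\<^bsub>Ext V 0\<^esub>, wedge V [v], \<zero>\<^bsub>Ext V 2\<^esub>, \<zero>\<^bsub>Ext V 3\<^esub>) =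
      (\<zero>\<^bsub>Ext W 0\<^esub>, wedge W [f v], \<zero>\<^bsub>Ext W 2\<^esub>, \<zero>\<^bsub>Ext W 3\<^esub>)"
proof -
  have t: "[v] \<in> tuples V 1" using v by (simp add: tuples_def)
  show 1: "(\<zero>\<^bsub>Ext V 0\<^esub>, wedge V [v], \<zero>\<^bsub>Ext V 2\<^esub>, \<zero>\<^bsub>Ext V 3\<^esub>) \<in> carrier (Zorn V \<omega>)"
    using wedge_carrier[OF V t] by (simp add: Zorn_carrier vspace_simps(1)[OF vspace_Ext[OF V]])
  have zero: "ext_map V W i f \<zero>\<^bsub>Ext V i\<^esub> = \<zero>\<^bsub>Ext W i\<^esub>" for i
    by (rule homs_zero[OF linear_maps_homs[OF ext_map(1)[OF V W f]] vspace_Ext[OF V] vspace_Ext[OF W]])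
  show "Zorn_map V \<omega> W \<eta> f (\<zero>\<^bsub>Ext V 0\<^esub>, wedge V [v], \<zero>\<^bsub>Ext V 2\<^esub>, \<zero>\<^bsub>Ext V 3\<^esub>) =
      (\<zero>\<^bsub>Ext W 0\<^esub>, wedge W [f v], \<zero>\<^bsub>Ext W 2\<^esub>, \<zero>\<^bsub>Ext W 3\<^esub>)"
    unfolding Zorn_map_eq using 1 ext_map(2)[OF V W f t] by (simp add: zero)
qed

lemma (in unimodular_coords) zorn_coord_vector:
  assumes "v \<in> carrier V"
  shows "zorn_coord (\<zero>\<^bsub>Ext V 0\<^esub>, wedge V [v], \<zero>\<^bsub>Ext V 2\<^esub>, \<zero>\<^bsub>Ext V 3\<^esub>) = (0, c v, (0, 0, 0), 0)"
proof -
  have id: "(\<lambda>x. x) \<in> homs V V" by (rule homsI) simp_all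
  have zero: "pluecker i \<zero>\<^bsub>Ext V i\<^esub> = (0, 0, 0)" for i
    using homs_zero[OF pluecker vspace_Ext[OF V] vspace_space3] by simp
  have "pluecker 1 (wedge V [v]) = c v"
    using assms by (subst pluecker_wedge) (simp_all add: tuples_def)
  then show ?thesis
    unfolding zorn_coord_def using Zorn_map_vector(1)[OF V V id assms, of \<omega>] by (simp add: zero)
qed

text \<open>The map \<open>f\<close> is recovered from the degree \<open>1\<close> part of the induced map.\<close>

lemma Zorn_faithful:
  assumes V: "(V, \<omega>) \<in> ob vol_cat" and W: "(W, \<eta>) \<in> ob vol_cat"
    and f: "f \<in> hom_set vol_cat (V, \<omega>) (W, \<eta>)" and g: "g \<in> hom_set vol_cat (V, \<omega>) (W, \<eta>)"
    and eq: "Zorn_map V \<omega> W \<eta> f = Zorn_map V \<omega> W \<eta> g"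
  shows "f = g"
proof -
  obtain d where d: "unimodular_coords W d \<eta>" using vol_object_coords[OF W] by blast
  interpret W: unimodular_coords W d \<eta> by (fact d)
  have lin: "f \<in> linear_maps V W" "g \<in> linear_maps V W" using f g vol_hom_iff[OF V W] by auto
  note hom = lin[THEN linear_maps_homs]
  show ?thesis
  proof (rule linear_maps_eqI[OF lin])
    fix v assume v: "v \<in> carrier V"
    have "wedge W [f v] = wedge W [g v]"
      using Zorn_map_vector(2)[OF vol_objectD(1)[OF V] W.V hom(1) v, of \<omega> \<eta>]
        Zorn_map_vector(2)[OF vol_objectD(1)[OF V] W.V hom(2) v, of \<omega> \<eta>] eq by simp
    then have "d (f v) = d (g v)"
      using W.zorn_coord_vector[OF homsD(1)[OF hom(1) v]] W.zorn_coord_vector[OF homsD(1)[OF hom(2) v]] by simp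
    then show "f v = g v"
      using W.vec_c[OF homsD(1)[OF hom(1) v]] W.vec_c[OF homsD(1)[OF hom(2) v]] by metis
  qed
qed

text \<open>In coordinates \<open>h\<close> becomes an automorphism of the split octonions that fixes the idempotent, and so acts on
  the upper right entry by a linear map \<open>M\<close>, the matrix of the sought map \<open>f\<close>. The induced map of \<open>f\<close> and
  \<open>h\<close> then agree on generators.\<close>

lemma Zorn_full:
  fixes V W :: "('k::field, 'v) module"
  assumes V: "(V, \<omega>) \<in> ob vol_cat" and W: "(W, \<eta>) \<in> ob vol_cat"
    and h: "h \<in> hom_set oct_cat (Zorn V \<omega>, Zorn_idempotent V \<omega>) (Zorn W \<eta>, Zorn_idempotent W \<eta>)"
  shows "\<exists>f \<in> hom_set vol_cat (V, \<omega>) (W, \<eta>). Zorn_map V \<omega> W \<eta> f = h"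
proof -
  obtain c where c: "unimodular_coords V c \<omega>" using vol_object_coords[OF V] by blast
  obtain d where d: "unimodular_coords W d \<eta>" using vol_object_coords[OF W] by blast
  interpret V: unimodular_coords V c \<omega> by (fact c)
  interpret W: unimodular_coords W d \<eta> by (fact d)
  let ?O = "split_octonions :: ('k, _) module"
  let ?i = "iso_inv (Zorn V \<omega>) ?O V.zorn_coord"
  note i = iso_inv_eq[OF V.zorn_coord_iso, simplified]
  define tr where "tr k = compose (carrier ?O) (compose (carrier (Zorn V \<omega>)) W.zorn_coord k) ?i" for k
  have tr: "tr k \<in> algebra_isos ?O ?O" "tr k octonion_idem = octonion_idem"
    "\<And>x. x \<in> carrier (Zorn V \<omega>) \<Longrightarrow> tr k (V.zorn_coord x) = W.zorn_coord (k x)"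
    if k: "k \<in> hom_set oct_cat (Zorn V \<omega>, Zorn_idempotent V \<omega>) (Zorn W \<eta>, Zorn_idempotent W \<eta>)" for k
  proof -
    note k' = oct_homD[OF k, simplified]
    show "tr k \<in> algebra_isos ?O ?O"
      unfolding tr_def
      by (rule algebra_isos_compose[OF is_algebra_octonions
            algebra_isos_inv[OF V.is_algebra_Zorn vspace_octonions V.zorn_coord_iso]
            algebra_isos_compose[OF V.is_algebra_Zorn k'(1) W.zorn_coord_iso]])
    show eq: "tr k (V.zorn_coord x) = W.zorn_coord (k x)" if "x \<in> carrier (Zorn V \<omega>)" for x
      using that by (simp add: tr_def compose_def i)
    show "tr k octonion_idem = octonion_idem"
      using eq[OF V.zorn_coord_idem(1)] by (simp add: V.zorn_coord_idem k'(2) W.zorn_coord_idem)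
  qed
  obtain M where M: "M \<in> homs space3 space3" "\<And>a. tr h (0, a, (0, 0, 0), 0) = (0, M a, (0, 0, 0), 0)"
    using octonion_auto_vector_part[OF tr(1,2)[OF h]] by blast
  define f where "f = (\<lambda>v \<in> carrier V. W.vec (M (c v)))"
  have f: "f \<in> linear_maps V W"
    unfolding f_def by (rule linear_maps_restrict[OF homs_comp[OF homs_comp[OF V.c M(1)] W.vec_homs] V.V])
  have df: "d (f v) = M (c v)" if "v \<in> carrier V" for v using that by (simp add: f_def)
  \<comment> \<open>The product \<open>(e1 e2) e3\<close> is the idempotent, which forces the matrix \<open>M\<close> to have determinant \<open>1\<close>.\<close>
  have det: "dot3 (cross3 (M (1, 0, 0)) (M (0, 1, 0))) (M (0, 0, 1)) = 1"
  proof -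
    let ?e = "\<lambda>a. (0, a, (0, 0, 0), 0)"
    note mult = algebra_isosD(5)[OF tr(1)[OF h], simplified]
    have "octonion_idem = tr h ((?e (1, 0, 0) \<otimes>\<^bsub>?O\<^esub> ?e (0, 1, 0)) \<otimes>\<^bsub>?O\<^esub> ?e (0, 0, 1))"
      using tr(2)[OF h] by simp
    also have "\<dots> = (?e (M (1, 0, 0)) \<otimes>\<^bsub>?O\<^esub> ?e (M (0, 1, 0))) \<otimes>\<^bsub>?O\<^esub> ?e (M (0, 0, 1))"
      by (simp only: mult M(2))
    finally show ?thesis
      by (cases "M (1, 0, 0)"; cases "M (0, 1, 0)"; cases "M (0, 0, 1)") (simp add: algebra_simps)
  qed
  have "pairing W 3 (\<eta>, wedge W [f V.e1, f V.e2, f V.e3]) = 1"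
  proof -
    have fe: "f V.e1 \<in> carrier W" "f V.e2 \<in> carrier W" "f V.e3 \<in> carrier W"
      using homsD(1)[OF linear_maps_homs[OF f]] by simp_all
    then have t: "[f V.e1, f V.e2, f V.e3] \<in> tuples W 3" by (simp add: tuples_def)
    show ?thesis
      using W.volume_eq[OF wedge_carrier[OF W.V t]] det by (simp add: W.pluecker_wedge[OF t] df)
  qed
  then have pb: "pullback V W f \<eta> = \<omega>"
    using pullback_volume[OF V.coords_axioms W.coords_axioms f W.\<omega>] V.\<omega> V.\<omega>_basis
    by (intro V.volume_form_eqI) (simp_all add: tuples_def)
  have f_hom: "f \<in> hom_set vol_cat (V, \<omega>) (W, \<eta>)"
    using f pb by (simp add: vol_cat_def)
  let ?Zf = "Zorn_map V \<omega> W \<eta> f"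
  note Zf = Zorn_map_hom[OF V W f_hom]
  have "tr ?Zf (0, a, (0, 0, 0), 0) = (0, M a, (0, 0, 0), 0)" for a
    using tr(3)[OF Zf Zorn_map_vector(1)[OF V.V W.V linear_maps_homs[OF f], of "V.vec a" \<omega>]]
      W.zorn_coord_vector[OF homsD(1)[OF linear_maps_homs[OF f]], of "V.vec a"]
    by (simp add: V.zorn_coord_vector Zorn_map_vector(2)[OF V.V W.V linear_maps_homs[OF f]] df)
  then have "tr ?Zf = tr h"
    using M(2) by (intro octonion_auto_eqI tr(1,2)[OF Zf] tr(1,2)[OF h]) simp
  have "?Zf = h"
  proof (rule linear_maps_eqI)
    note iso = oct_homD(1)[OF Zf, simplified] oct_homD(1)[OF h, simplified]
    show "?Zf \<in> linear_maps (Zorn V \<omega>) (Zorn W \<eta>)" "h \<in> linear_maps (Zorn V \<omega>) (Zorn W \<eta>)"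
      using iso algebra_isosD(1) by blast+
    fix x assume x: "x \<in> carrier (Zorn V \<omega>)"
    have "W.zorn_coord (?Zf x) = W.zorn_coord (h x)"
      using tr(3)[OF Zf x] tr(3)[OF h x] \<open>tr ?Zf = tr h\<close> by simp
    then show "?Zf x = h x"
      using algebra_isosD(7)[OF W.zorn_coord_iso algebra_isosD(6)[OF iso(1) x] algebra_isosD(6)[OF iso(2) x]] by blast
  qed
  then show ?thesis using f_hom by blast
qed

text \<open>A given algebra and the Zorn algebra both are isomorphic to the split octonions. The two idempotents
  correspond after composing with an automorphism that moves one to the other.\<close>

lemma Zorn_essentially_surjective:
  fixes V :: "('k::field, 'v) module"
  assumes V: "(V, \<omega>) \<in> ob vol_cat" and A: "(A, p) \<in> ob oct_cat"
  shows "\<exists>h. is_iso oct_cat (Zorn V \<omega>, Zorn_idempotent V \<omega>) (A, p) h"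
proof -
  obtain c where c: "unimodular_coords V c \<omega>" using vol_object_coords[OF V] by blast
  interpret V: unimodular_coords V c \<omega> by (fact c)
  let ?O = "split_octonions :: ('k, _) module"
  note A' = oct_objectD[OF A, simplified]
  obtain \<theta> where \<theta>: "\<theta> \<in> algebra_isos A ?O" using A'(2) by blast
  have "\<theta> p \<in> nontrivial_idempotents ?O"
  proof -
    have p: "p \<in> carrier A" "p \<otimes>\<^bsub>A\<^esub> p = p" "p \<noteq> \<zero>\<^bsub>A\<^esub>" "p \<noteq> \<one>\<^bsub>A\<^esub>"
      using A'(3) by (auto simp: nontrivial_idempotents_def)
    have "\<theta> p \<otimes>\<^bsub>?O\<^esub> \<theta> p = \<theta> p" using algebra_isosD(5)[OF \<theta> p(1) p(1)] p(2) by simp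
    moreover have "\<theta> p \<noteq> \<theta> \<zero>\<^bsub>A\<^esub>" "\<theta> p \<noteq> \<theta> \<one>\<^bsub>A\<^esub>"
      using algebra_isosD(7)[OF \<theta> p(1)] p(3,4) is_algebraD(3)[OF A'(1)] vspace_simps(1)[OF is_algebraD(1)[OF A'(1)]]
      by blast+
    ultimately show ?thesis
      using homs_zero[OF algebra_isosD(2)[OF \<theta>] is_algebraD(1)[OF A'(1)] vspace_octonions] algebra_isosD(4)[OF \<theta>]
      by (simp add: nontrivial_idempotents_def)
  qed
  then obtain g where g: "g \<in> algebra_isos ?O ?O" "g (\<theta> p) = octonion_idem"
    using octonion_idempotent_normal_form by blast
  let ?\<psi> = "compose (carrier A) g \<theta>"
  have \<psi>: "?\<psi> \<in> algebra_isos A ?O" by (rule algebra_isos_compose[OF A'(1) \<theta> g(1)])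
  let ?h = "compose (carrier (Zorn V \<omega>)) (iso_inv A ?O ?\<psi>) V.zorn_coord"
  have "?h \<in> algebra_isos (Zorn V \<omega>) A"
    by (rule algebra_isos_compose[OF V.is_algebra_Zorn V.zorn_coord_iso
          algebra_isos_inv[OF A'(1) vspace_octonions \<psi>]])
  moreover have "?h (Zorn_idempotent V \<omega>) = p"
    using iso_inv_eq(1)[OF \<psi> A'(4)] g(2) A'(4)
    by (simp add: compose_def V.zorn_coord_idem)
  ultimately have "?h \<in> hom_set oct_cat (Zorn V \<omega>, Zorn_idempotent V \<omega>) (A, p)"
    by (intro oct_homI) simp_all
  then show ?thesis using oct_hom_is_iso[OF V.Zorn_object A] by blast
qed

text \<open>A copy of \<open>k\<^sup>3\<close> inside the universe, with the determinant as volume form.\<close>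

lemma vol_cat_nonempty:
  fixes emb :: "'k::field \<times> 'k \<times> 'k \<Rightarrow> 'v"
  assumes emb: "inj emb"
  obtains V :: "('k, 'v) module" and \<omega> where "(V, \<omega>) \<in> ob vol_cat"
proof -
  define V :: "('k, 'v) module" where
    "V = \<lparr>carrier = range emb, mult = (\<lambda>_ _. undefined), one = undefined, zero = emb (0, 0, 0),
      add = (\<lambda>x y. emb (inv_into UNIV emb x \<oplus>\<^bsub>space3\<^esub> inv_into UNIV emb y)), smult = (\<lambda>a x. emb (a \<odot>\<^bsub>space3\<^esub> inv_into UNIV emb x))\<rparr>"
  have V_simps: "carrier V = range emb" "\<zero>\<^bsub>V\<^esub> = emb (0, 0, 0)"
    "emb x \<oplus>\<^bsub>V\<^esub> emb y = emb (x \<oplus>\<^bsub>space3\<^esub> y)" "a \<odot>\<^bsub>V\<^esub> emb x = emb (a \<odot>\<^bsub>space3\<^esub> x)" for x y a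
    using emb by (simp_all add: V_def)
  have vsV: "vspace V"
    by (rule vspaceI) (auto simp: V_simps simp del: direct_sum_simps,
        simp_all add: algebra_simps)
  interpret coords V "inv_into UNIV emb"
  proof (rule coords.intro[OF vsV])
    show "inv_into UNIV emb \<in> homs V space3"
      by (rule homsI) (auto simp: V_simps emb simp del: direct_sum_simps(2-4))
    show "bij_betw (inv_into UNIV emb) (carrier V) UNIV"
      by (rule bij_betw_byWitness[where f' = emb]) (auto simp: V_simps emb)
  qed
  interpret D: coords "dual V" dual_coord by (rule coords_dual)
  let ?\<omega> = "D.from_pluecker 3 (1, 0, 0)"
  have pl: "D.pluecker 3 ?\<omega> = (1, 0, 0)"
    by (rule D.pluecker_from_pluecker) (simp_all add: pluecker_range_def)
  have "?\<omega> \<in> carrier (Ext (dual V) 3)"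
    using homsD(1)[OF D.from_pluecker_homs[of 3]] by simp
  moreover have "?\<omega> \<noteq> \<zero>\<^bsub>Ext (dual V) 3\<^esub>"
    using pl homs_zero[OF D.pluecker vspace_Ext[OF D.V] vspace_space3, of 3] by auto
  ultimately have "(V, ?\<omega>) \<in> ob vol_cat"
    using vsV dim_3 by (simp add: vol_cat_def volume_forms_def)
  then show thesis using that by blast
qed

theorem theorem6:
  fixes emb :: "'k::field \<times> 'k \<times> 'k \<Rightarrow> 'v"
  assumes "inj emb"
  shows "is_functor vol_cat oct_cat (Zorn_functor :: ('k, 'v) vol_oct_functor) \<and>
    is_equivalence vol_cat oct_cat (Zorn_functor :: ('k, 'v) vol_oct_functor)"
proof
  let ?C = "vol_cat :: (('k, 'v) vol_space, 'v \<Rightarrow> 'v) cat"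
  let ?F = "Zorn_functor :: ('k, 'v) vol_oct_functor"
  show F: "is_functor ?C oct_cat ?F" by (rule is_functor_Zorn)
  obtain V0 :: "('k, 'v) module" and \<omega>0 where V0: "(V0, \<omega>0) \<in> ob vol_cat"
    using vol_cat_nonempty[OF assms] by blast
  show "is_equivalence ?C oct_cat ?F"
  proof (rule equivalence_of_fully_faithful[OF F])
    fix X Y h assume "X \<in> ob ?C" "Y \<in> ob ?C" "h \<in> hom_set oct_cat (omap ?F X) (omap ?F Y)"
    then show "\<exists>f \<in> hom_set ?C X Y. amap ?F X Y f = h"
      by (cases X; cases Y) (simp add: omap_Zorn Zorn_full)
  next
    fix X Y f g assume "X \<in> ob ?C" "Y \<in> ob ?C" "f \<in> hom_set ?C X Y" "g \<in> hom_set ?C X Y"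
      "amap ?F X Y f = amap ?F X Y g"
    then show "f = g" by (cases X; cases Y) (blast intro: Zorn_faithful)
  next
    fix A :: "('k, ('k, 'v) zorn) pointed_algebra" assume "A \<in> ob oct_cat"
    then show "\<exists>X \<in> ob ?C. \<exists>h. is_iso oct_cat (omap ?F X) A h"
      using V0 Zorn_essentially_surjective[OF V0] by (cases A) (auto simp: omap_Zorn intro!: bexI[of _ "(V0, \<omega>0)"])
  qed
qed

end
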